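(* Suppose that $1\le p<\infty$, $\lambda>-1$ and $\alpha\in\mathbb R$ satisfy $$\begin{cases}\alpha>\dfrac{\lambda+1}{p}-1,&1<p<\infty,\\ \alpha\ge\lambda,&p=1.\end{cases}$$ If $f\in A^p_\lambda(T_B)$, then $$f=\frac{(2i)^N\,\Gamma(1+\alpha)}{\Gamma(1+\alpha+N)}\,\mathcal T_\alpha\big(\rho^N\mathcal L_n^Nf\big)$$ for any $N\in\mathbb N_0$.
   Context: Let $n$ be a positive integer. For $z=x+iy\in\mathbb C^n$ write $z'=(z_1,\dots,z_{n-1})$, $y'=(y_1,\dots,y_{n-1})$. The tubular domain is $T_B=\{z=x+iy\in\mathbb C^n:|y'|^2<y_n\}$. Put $\rho(z,w)=\frac14\big(\sum_{j=1}^{n-1}(z_j-\overline{w_j})^2-2i(z_n-\overline{w_n})\big)$ (positive real part on $T_B\times T_B$; powers are principal branches) and $\rho(z)=\rho(z,z)=y_n-|y'|^2$. $A^p_\lambda(T_B)$ is the weighted Bergman space of holomorphic $f$ on $T_B$ with $\int_{T_B}|f(z)|^p\rho(z)^\lambda\,dV(z)<\infty$, $dV$ being Lebesgue measure on $\mathbb C^n$. $\mathcal L_n=\partial/\partial z_n$, and $\mathbb N_0$ is the set of non-negative integers. For $\alpha>-1$, $$\mathcal T_\alpha f(z)=\frac{\Gamma(n+1+\alpha)}{2^{n+1}\pi^n\Gamma(\alpha+1)}\int_{T_B}\frac{\rho(w)^\alpha}{\rho(z,w)^{n+1+\alpha}}f(w)\,dV(w).$$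
   Formalization: The constant (2i)^N is corrected to (-2i)^N; the printed formula fails for odd N, e.g. n=1, p=2, λ=0, α=1, N=1, f(w)=-4/(w+i)^2, where at z=i its right side is -1 but f(i)=1. *)

theory Defs
  imports "HOL-Analysis.Analysis"
begin

text \<open>
  Points of complex $n$-space are vectors of type \<^typ>\<open>complex ^ 'n\<close>, where the finite linearly
  ordered index type plays the role of $1 < \dots < n$, with $n = $ \<^term>\<open>CARD('n)\<close>. All $n \ge 1$
  are covered. The greatest index singles out the coordinate $z_n$.
\<close>

definition last_index :: "'n::{finite,linorder}" where
  "last_index = Max UNIV"

definition tube_rho :: "complex ^ ('n::{finite,linorder}) \<Rightarrow> real" where
  "tube_rho z = Im (z $ last_index) - (\<Sum>j\<in>UNIV - {last_index}. (Im (z $ j))\<^sup>2)"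

definition tube_domain :: "(complex ^ ('n::{finite,linorder})) set" where
  "tube_domain = {z. (\<Sum>j\<in>UNIV - {last_index}. (Im (z $ j))\<^sup>2) < Im (z $ last_index)}"

definition tube_rho2 :: "complex ^ ('n::{finite,linorder}) \<Rightarrow> complex ^ ('n::{finite,linorder}) \<Rightarrow> complex" where
  "tube_rho2 z w =
     1 / 4 * ((\<Sum>j\<in>UNIV - {last_index}. (z $ j - cnj (w $ j))\<^sup>2)
              - 2 * \<i> * (z $ last_index - cnj (w $ last_index)))"

lemma tube_rho2_diag: "tube_rho2 z z = of_real (tube_rho z)"
proof -
  have d: "u - cnj u = 2 * \<i> * of_real (Im u)" for u
    by (simp add: complex_eq_iff)
  show ?thesis
    unfolding tube_rho2_def tube_rho_def d
    by (simp add: power_mult_distrib sum_distrib_left[symmetric] sum_negf algebra_simps)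
qed

text \<open>
  Holomorphy in several variables: a complex-linear total derivative exists at every point.
  The relation \<^const>\<open>has_derivative\<close> supplies only a real-linear map.
\<close>

definition holomorphic_vec_on :: "(complex ^ 'n \<Rightarrow> complex) \<Rightarrow> (complex ^ 'n) set \<Rightarrow> bool" where
  "holomorphic_vec_on f S \<longleftrightarrow>
     (\<forall>z\<in>S. \<exists>D. (f has_derivative D) (at z within S) \<and> (\<forall>c v. D (c *s v) = c * D v))"

definition tube_bergman_space :: "real \<Rightarrow> real \<Rightarrow> (complex ^ ('n::{finite,linorder}) \<Rightarrow> complex) set" where
  "tube_bergman_space p l =
     {f. holomorphic_vec_on f tube_domain \<and>
         set_integrable lborel tube_domain (\<lambda>z. norm (f z) powr p * tube_rho z powr l)}"

text \<open>
  The complex partial derivative in $z_n$. The derivative of \<^const>\<open>tube_rho\<close> in $w_n$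
  (in the sense of Wirtinger) is $1/(2i)$, and integration by parts contributes a factor $-1$. So a
  formula recovering $f$ from its $N$-th derivative in $z_n$ carries the factor $(-2i)^N$.
\<close>

definition deriv_last :: "(complex ^ ('n::{finite,linorder}) \<Rightarrow> complex) \<Rightarrow> complex ^ ('n::{finite,linorder}) \<Rightarrow> complex" where
  "deriv_last f z =
     deriv (\<lambda>t. f (\<chi> j. if j = last_index then t else z $ j)) (z $ last_index)"

text \<open>
  The Bochner integral is $0$ by convention when the integrand is not integrable, so absolute
  convergence of the integral is a predicate of its own.
\<close>

definition tube_integrand ::
  "real \<Rightarrow> (complex ^ ('n::{finite,linorder}) \<Rightarrow> complex) \<Rightarrow> complex ^ ('n::{finite,linorder}) \<Rightarrow> complex ^ ('n::{finite,linorder}) \<Rightarrow> complex" where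
  "tube_integrand a f z w =
     of_real (tube_rho w powr a) / (tube_rho2 z w powr of_real (real CARD('n) + 1 + a)) * f w"

definition tube_T_converges ::
  "real \<Rightarrow> (complex ^ ('n::{finite,linorder}) \<Rightarrow> complex) \<Rightarrow> complex ^ ('n::{finite,linorder}) \<Rightarrow> bool" where
  "tube_T_converges a f z \<longleftrightarrow> set_integrable lborel tube_domain (tube_integrand a f z)"

definition tube_T ::
  "real \<Rightarrow> (complex ^ ('n::{finite,linorder}) \<Rightarrow> complex) \<Rightarrow> complex ^ ('n::{finite,linorder}) \<Rightarrow> complex" where
  "tube_T a f z =
     of_real (Gamma (real CARD('n) + 1 + a) / (2 ^ (CARD('n) + 1) * pi ^ CARD('n) * Gamma (a + 1)))
     * (LINT w:tube_domain|lborel. tube_integrand a f z w)"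

end

(*
  The domain is foliated by half-planes in z_n, and the shear Psi_z below (heis) makes the kernel
  rho(z, w) independent of the remaining coordinates. Composed with a Cayley transform in the last
  coordinate and a scaling by 1/(1 - q_n) in the others it becomes a biholomorphic map Phi of the
  unit ball onto the domain with Phi(0) = z, and the integrand of T_alpha f turns into
  2^(n+1) (1 - |q|^2)^alpha times the holomorphic function (1 - q_n)^(-(n+1+alpha)) f(Phi(q)).
  Rotating q by a unit complex number and averaging (the mean value property) gives the case N = 0.

  For N > 0 one uses induction on N, for all alpha at once: apply the case (alpha + 1, N) to the
  derivative of f at the points z + i t e_n and integrate over t > 0. On one side this lowers the
  exponent of the kernel by one, on the other it recovers i f(z), because f(z + i t e_n) tends
  to 0 (dominated convergence in the case N = 0).

  The only integrability that this needs is that of rho^alpha |f| / |rho(z, .)|^(n+1+alpha). It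
  follows from the Bergman condition by Young's inequality and a Forelli-Rudin estimate, and the
  Cauchy estimate on the circle of radius rho(w)/2 in w_n transfers it to the derivatives.
*)
theory Submission
  imports Defs "HOL-Complex_Analysis.Cauchy_Integral_Formula"
begin

section \<open>Lebesgue measure on complex vectors\<close>

text \<open>Integration by parts in w_n would need the boundary behaviour of f and of its
  derivatives, which an integral condition does not give directly; integrating over rays replaces it
  by Fubini. The two exponents move separately in the inductive step. Passing to (alpha + 1, N) with
  the derivative of f raises those of the weight and of the kernel, whereas the ray integral lowers
  only that of the kernel. Hence \<open>tube_int s m\<close> has two independent exponents. Each
  step contributes a factor i/2: the 1/2 because rho(z + i t e_n, w) = rho(z, w) + t/2, the i
  because f is recovered from its derivative in the direction i. The inverse of i/2 is the -2i of
  the theorem, and the Gamma quotients telescope through Gamma (m + 1) = m * Gamma m.\<close>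

lemma prod_Basis_complex: "(\<Prod>b\<in>Basis. f b) = f (1::complex) * f \<i>"
  by (simp add: Basis_complex_def complex_eq_iff)

lemma measurable_vec_lambda [measurable]:
  fixes f :: "'i::finite \<Rightarrow> 'b \<Rightarrow> 'a::euclidean_space"
  assumes "\<And>i. f i \<in> M \<rightarrow>\<^sub>M borel"
  shows "(\<lambda>x. \<chi> i. f i x) \<in> M \<rightarrow>\<^sub>M borel"
proof (subst borel_measurable_euclidean_space, intro ballI)
  fix b :: "'a ^ 'i" assume "b \<in> Basis"
  then obtain i u where "b = axis i u" by (auto simp: Basis_vec_def)
  with assms[of i] show "(\<lambda>x. (\<chi> i. f i x) \<bullet> b) \<in> borel_measurable M"
    by (simp add: inner_axis borel_measurable_inner)
qed

lemma measurable_vec_nth [measurable]: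
  "(\<lambda>x. (x :: 'a::euclidean_space ^ 'i::finite) $ i) \<in> borel \<rightarrow>\<^sub>M borel"
  by (intro borel_measurable_continuous_onI continuous_intros)

lemma prod_Basis_vec:
  fixes f :: "('a::euclidean_space ^ 'n::finite) \<Rightarrow> 'c::comm_monoid_mult"
  shows "(\<Prod>b\<in>Basis. f b) = (\<Prod>i\<in>UNIV. \<Prod>u\<in>Basis. f (axis i u))"
proof -
  have B: "(Basis :: ('a^'n) set) = (\<lambda>(i,u). axis i u) ` (UNIV \<times> Basis)"
    by (auto simp: Basis_vec_def)
  have "inj_on (\<lambda>(i,u). axis i u :: 'a^'n) (UNIV \<times> Basis)"
    by (auto simp: inj_on_def axis_eq_axis)
  then have "(\<Prod>b\<in>Basis. f b) = (\<Prod>(i,u)\<in>UNIV\<times>Basis. f (axis i u))"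
    by (subst B, subst prod.reindex) (auto simp: case_prod_beta o_def)
  then show ?thesis by (simp add: prod.cartesian_product)
qed

lemma mem_box_vec:
  fixes x :: "'a::euclidean_space ^ 'n::finite"
  shows "x \<in> box l u \<longleftrightarrow> (\<forall>i. x $ i \<in> box (l $ i) (u $ i))"
  by (auto simp: mem_box Basis_vec_def inner_axis)

text \<open>Lebesgue measure is determined by its values on boxes, and a box of vectors is a product
  of boxes. The product form makes Fubini available for a single coordinate.\<close>

lemma lborel_vec:
  "(lborel :: ('a::euclidean_space ^ 'n::finite) measure) =
     distr (\<Pi>\<^sub>M i\<in>UNIV. lborel) borel (\<lambda>x. \<chi> i. x i)"
proof (rule lborel_eqI)
  fix l u :: "'a ^ 'n" assume le: "\<And>b. b \<in> Basis \<Longrightarrow> l \<bullet> b \<le> u \<bullet> b"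
  interpret product_sigma_finite "\<lambda>_::'n. lborel :: 'a measure" by standard
  have le': "l $ i \<bullet> b \<le> u $ i \<bullet> b" if "b \<in> Basis" for i b
    using le[of "axis i b"] that by (simp add: inner_axis axis_in_Basis_iff)
  have "(\<lambda>x. \<chi> i. x i) -` box l u \<inter> space (\<Pi>\<^sub>M i\<in>UNIV. lborel :: 'a measure) = (\<Pi>\<^sub>E i\<in>UNIV. box (l $ i) (u $ i))"
    by (auto simp: space_PiM mem_box_vec PiE_UNIV_domain Pi_iff)
  then have "emeasure (distr (\<Pi>\<^sub>M i\<in>UNIV. lborel :: 'a measure) borel (\<lambda>x. \<chi> i. x i)) (box l u)
     = (\<Prod>i\<in>UNIV. emeasure lborel (box (l $ i) (u $ i)))"
    by (subst emeasure_distr) (auto simp: emeasure_PiM)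
  also have "\<dots> = (\<Prod>i\<in>UNIV. ennreal (\<Prod>b\<in>Basis. (u $ i - l $ i) \<bullet> b))"
    by (simp add: le')
  also have "\<dots> = ennreal (\<Prod>i\<in>UNIV. \<Prod>b\<in>Basis. (u $ i - l $ i) \<bullet> b)"
    by (rule prod_ennreal) (auto intro!: prod_nonneg simp: inner_diff_left le')
  also have "(\<Prod>i\<in>UNIV. \<Prod>b\<in>Basis. (u $ i - l $ i) \<bullet> b) = (\<Prod>b\<in>Basis. (u - l) \<bullet> b)"
    by (simp add: prod_Basis_vec inner_axis)
  finally show "emeasure (distr (\<Pi>\<^sub>M i\<in>UNIV. lborel) borel (\<lambda>x. \<chi> i. x i)) (box l u)
      = ennreal (\<Prod>b\<in>Basis. (u - l) \<bullet> b)" .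
qed simp

definition vec_upd :: "'a ^ 'n \<Rightarrow> 'n \<Rightarrow> 'a \<Rightarrow> 'a ^ 'n::finite" where
  "vec_upd v k t = (\<chi> j. if j = k then t else v $ j)"

lemma vec_upd_nth [simp]: "vec_upd v k t $ j = (if j = k then t else v $ j)"
  by (simp add: vec_upd_def)

lemma vec_upd_upd [simp]: "vec_upd (vec_upd v k s) k t = vec_upd v k t"
  by (simp add: vec_eq_iff)

lemma measurable_vec_upd [measurable]:
  assumes "f \<in> M \<rightarrow>\<^sub>M borel" "g \<in> M \<rightarrow>\<^sub>M (borel :: 'a::euclidean_space measure)"
  shows "(\<lambda>x. vec_upd (f x) k (g x)) \<in> M \<rightarrow>\<^sub>M borel"
proof -
  have "(\<lambda>x. if j = k then g x else f x $ j) \<in> M \<rightarrow>\<^sub>M borel" for j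
    using assms by (cases "j = k") auto
  then show ?thesis
    unfolding vec_upd_def by (rule measurable_vec_lambda)
qed

text \<open>The outer variable \<open>x\<close> is a function on the other indices. Whatever value
  the vector made from it has at \<open>k\<close> is overwritten by \<open>vec_upd\<close>, so the
  vector type itself need not be split.\<close>

lemma nn_integral_vec_fibre:
  fixes F :: "('a::euclidean_space ^ 'n::finite) \<Rightarrow> ennreal"
  assumes [measurable]: "F \<in> borel_measurable borel"
  shows "(\<integral>\<^sup>+v. F v \<partial>lborel) =
    (\<integral>\<^sup>+x. \<integral>\<^sup>+t. F (vec_upd (\<chi> i. x i) k t) \<partial>lborel \<partial>(\<Pi>\<^sub>M i\<in>UNIV - {k}. lborel))"
proof -
  interpret product_sigma_finite "\<lambda>_::'n. lborel :: 'a measure" by standard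
  have U: "(UNIV :: 'n set) = insert k (UNIV - {k})" by auto
  have m: "(\<lambda>x. F (\<chi> i. x i)) \<in> borel_measurable (\<Pi>\<^sub>M i\<in>UNIV. lborel)"
    by measurable
  have "(\<integral>\<^sup>+v. F v \<partial>lborel) = (\<integral>\<^sup>+x. F (\<chi> i. x i) \<partial>(\<Pi>\<^sub>M i\<in>UNIV. lborel))"
    by (subst lborel_vec) (simp add: nn_integral_distr)
  also have "\<dots> = (\<integral>\<^sup>+x. \<integral>\<^sup>+t. F (\<chi> i. (x(k := t)) i) \<partial>lborel \<partial>(\<Pi>\<^sub>M i\<in>UNIV - {k}. lborel))"
    using product_nn_integral_insert[of "UNIV - {k}" k "\<lambda>x. F (\<chi> i. x i)"] m
    by (simp flip: U)
  also have "(\<lambda>x t. F (\<chi> i. (x(k := t)) i)) = (\<lambda>x t. F (vec_upd (\<chi> i. x i) k t))"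
    by (intro ext arg_cong[where f = F]) (simp add: vec_eq_iff)
  finally show ?thesis .
qed

text \<open>Scalings, shears and the Cayley transform are substituted in one complex coordinate at a
  time, with the others as parameters, through this lemma and its version for equality.\<close>

lemma nn_integral_fibre_le:
  fixes F G :: "('a::euclidean_space ^ 'n::finite) \<Rightarrow> ennreal"
  assumes "F \<in> borel_measurable borel" "G \<in> borel_measurable borel"
    and "\<And>v. (\<integral>\<^sup>+t. F (vec_upd v k t) \<partial>lborel) \<le> (\<integral>\<^sup>+t. G (vec_upd v k t) \<partial>lborel)"
  shows "(\<integral>\<^sup>+v. F v \<partial>lborel) \<le> (\<integral>\<^sup>+v. G v \<partial>lborel)"
  unfolding nn_integral_vec_fibre[OF assms(1), of k] nn_integral_vec_fibre[OF assms(2), of k]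
  by (intro nn_integral_mono assms)

lemma nn_integral_fibre_eq:
  fixes F G :: "('a::euclidean_space ^ 'n::finite) \<Rightarrow> ennreal"
  assumes "F \<in> borel_measurable borel" "G \<in> borel_measurable borel"
    and "\<And>v. (\<integral>\<^sup>+t. F (vec_upd v k t) \<partial>lborel) = (\<integral>\<^sup>+t. G (vec_upd v k t) \<partial>lborel)"
  shows "(\<integral>\<^sup>+v. F v \<partial>lborel) = (\<integral>\<^sup>+v. G v \<partial>lborel)"
  by (intro antisym nn_integral_fibre_le[where k = k] assms) (auto simp: assms(3))

section \<open>Lebesgue measure on the plane and holomorphic substitution\<close>

lemma lborel_complex_prod:
  "(lborel :: complex measure) = distr (lborel \<Otimes>\<^sub>M lborel) borel (\<lambda>(x, y). Complex x y)"
proof (rule lborel_eqI)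
  fix l u :: complex assume le: "\<And>b. b \<in> Basis \<Longrightarrow> l \<bullet> b \<le> u \<bullet> b"
  have le': "Re l \<le> Re u" "Im l \<le> Im u"
    using le[of 1] le[of \<i>] by (auto simp: Basis_complex_def)
  have [measurable]: "(\<lambda>(x, y). Complex x y) \<in> borel_measurable (lborel \<Otimes>\<^sub>M lborel)"
    unfolding Complex_eq by measurable
  have "(\<lambda>(x, y). Complex x y) -` box l u \<inter> space (lborel \<Otimes>\<^sub>M lborel)
     = {Re l<..<Re u} \<times> {Im l<..<Im u}"
    by (auto simp: mem_box Basis_complex_def space_pair_measure)
  then show "emeasure (distr (lborel \<Otimes>\<^sub>M lborel) borel (\<lambda>(x, y). Complex x y)) (box l u)
      = ennreal (\<Prod>b\<in>Basis. (u - l) \<bullet> b)"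
    using le' by (simp add: emeasure_distr lborel.emeasure_pair_measure_Times prod_Basis_complex ennreal_mult)
qed simp

lemma nn_integral_complex:
  assumes [measurable]: "F \<in> borel_measurable borel"
  shows "(\<integral>\<^sup>+z. F z \<partial>lborel) = (\<integral>\<^sup>+y. \<integral>\<^sup>+x. F (Complex x y) \<partial>lborel \<partial>lborel)"
proof -
  have [measurable]: "(\<lambda>(x, y). Complex x y) \<in> borel_measurable (lborel \<Otimes>\<^sub>M lborel)"
    unfolding Complex_eq by measurable
  have "(\<integral>\<^sup>+z. F z \<partial>lborel) = (\<integral>\<^sup>+p. F (case p of (x, y) \<Rightarrow> Complex x y) \<partial>(lborel \<Otimes>\<^sub>M lborel))"
    by (subst lborel_complex_prod) (simp add: nn_integral_distr)
  also have "\<dots> = (\<integral>\<^sup>+p. (\<lambda>(x, y). F (Complex x y)) p \<partial>(lborel \<Otimes>\<^sub>M lborel))"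
    by (simp add: case_prod_beta)
  also have "\<dots> = (\<integral>\<^sup>+y. \<integral>\<^sup>+x. F (Complex x y) \<partial>lborel \<partial>lborel)"
    by (subst lborel_pair.nn_integral_snd[symmetric]) (auto simp: Complex_eq)
  finally show ?thesis .
qed

text \<open>The Jacobian theorem applied below concerns \<open>real^'n\<close> with its determinant,
  so planar measure is moved to \<open>real^2\<close>.\<close>

lemma lborel_complex_real2:
  "(lborel :: complex measure) = distr (lborel :: (real^2) measure) borel (\<lambda>v. Complex (v $ 1) (v $ 2))"
proof (rule lborel_eqI)
  fix l u :: complex assume le: "\<And>b. b \<in> Basis \<Longrightarrow> l \<bullet> b \<le> u \<bullet> b"
  have le': "Re l \<le> Re u" "Im l \<le> Im u"
    using le[of 1] le[of \<i>] by (auto simp: Basis_complex_def)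
  have [measurable]: "(\<lambda>v::real^2. Complex (v $ 1) (v $ 2)) \<in> borel_measurable borel"
    unfolding Complex_eq by measurable
  let ?l = "vector [Re l, Im l] :: real^2" and ?u = "vector [Re u, Im u] :: real^2"
  have "(\<lambda>v::real^2. Complex (v $ 1) (v $ 2)) -` box l u \<inter> space lborel = box ?l ?u"
    by (auto simp: mem_box_cart mem_box Basis_complex_def forall_2)
  moreover have "?l \<bullet> b \<le> ?u \<bullet> b" if "b \<in> Basis" for b
  proof -
    obtain i where "b = axis i 1" using \<open>b \<in> Basis\<close> by (auto simp: Basis_vec_def)
    then show ?thesis using le' exhaust_2[of i] by (auto simp: inner_axis)
  qed
  ultimately show "emeasure (distr (lborel :: (real^2) measure) borel (\<lambda>v. Complex (v $ 1) (v $ 2))) (box l u)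
      = ennreal (\<Prod>b\<in>Basis. (u - l) \<bullet> b)"
    by (simp add: emeasure_distr prod_Basis_vec prod_Basis_complex inner_axis UNIV_2 inner_diff_left)
qed simp


lemma nn_integral_complex_real2:
  assumes [measurable]: "F \<in> borel_measurable borel"
  shows "(\<integral>\<^sup>+z. F z \<partial>lborel) = (\<integral>\<^sup>+v. F (Complex (v $ 1) (v $ 2)) \<partial>(lborel :: (real^2) measure))"
proof -
  have [measurable]: "(\<lambda>v::real^2. Complex (v $ 1) (v $ 2)) \<in> borel_measurable borel"
    unfolding Complex_eq by measurable
  show ?thesis by (subst lborel_complex_real2) (simp add: nn_integral_distr)
qed

text \<open>Multiplication by a + i b has real determinant a^2 + b^2, so the Jacobian of
  \<open>g\<close> is the squared modulus of \<open>g'\<close>. Boundedness of \<open>B\<close>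
  gives the image finite measure, as the measure formula for differentiable images requires.\<close>

lemma nn_integral_holomorphic_substitution_bounded:
  fixes g :: "complex \<Rightarrow> complex"
  assumes S: "open S" and g: "\<And>z. z \<in> S \<Longrightarrow> (g has_field_derivative g' z) (at z)"
    and inj: "inj_on g S" and gS: "g ` S \<in> sets borel"
    and B: "B \<in> sets borel" "bounded B"
    and g' [measurable]: "g' \<in> borel_measurable borel"
  shows "emeasure lborel (B \<inter> g ` S) = (\<integral>\<^sup>+z. indicator {z \<in> S. g z \<in> B} z * ennreal ((cmod (g' z))\<^sup>2) \<partial>lborel)"
proof -
  define C :: "real^2 \<Rightarrow> complex" where "C v = Complex (v $ 1) (v $ 2)" for v
  define R :: "complex \<Rightarrow> real^2" where "R z = vector [Re z, Im z]" for z
  have CR [simp]: "C (R z) = z" "R (C v) = v" for z v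
    by (auto simp: C_def R_def vec_eq_iff forall_2)
  have linC: "linear C" and linR: "linear R"
    by (auto intro!: linearI simp: C_def R_def complex_eq_iff vec_eq_iff forall_2)
  note dC = linear_imp_has_derivative[OF linC] and dR = linear_imp_has_derivative[OF linR]
  have [measurable]: "C \<in> borel_measurable borel"
    unfolding C_def Complex_eq by measurable
  have RV: "R ` Y = C -` Y" for Y
    by (auto simp: image_iff) (metis CR(2))
  define A where "A = {z \<in> S. g z \<in> B}"
  have cont: "continuous_on S g"
    using g by (meson DERIV_isCont continuous_at_imp_continuous_on)
  have [measurable]: "S \<in> sets borel" using S by simp
  \<comment> \<open>\<open>g\<close> is controlled only on \<open>S\<close>. Its extension by 0 is
    measurable and has the same preimages within \<open>S\<close>.\<close>
  have [measurable]: "(\<lambda>z. indicator S z *\<^sub>R g z) \<in> borel_measurable borel"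
    by (rule borel_measurable_continuous_on_indicator[OF _ cont]) simp
  have "A = S \<inter> (\<lambda>z. indicator S z *\<^sub>R g z) -` B"
    by (auto simp: A_def)
  moreover have "(\<lambda>z. indicator S z *\<^sub>R g z) -` B \<in> sets borel"
    using measurable_sets_borel[OF \<open>(\<lambda>z. indicator S z *\<^sub>R g z) \<in> borel_measurable borel\<close> B(1)] by simp
  ultimately have A [measurable]: "A \<in> sets borel" by simp
  have X [measurable]: "B \<inter> g ` S \<in> sets borel" using B gS by simp
  have gA: "g ` A = B \<inter> g ` S" by (auto simp: A_def)
  define A2 where "A2 = C -` A"
  define G where "G = R \<circ> g \<circ> C"
  have A2: "A2 \<in> sets borel"
    unfolding A2_def using measurable_sets_borel[OF \<open>C \<in> borel_measurable borel\<close> A] by simp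
  have GA: "G ` A2 = C -` (B \<inter> g ` S)"
  proof -
    have "G ` A2 = R ` g ` A"
      unfolding G_def A2_def RV[symmetric] by (simp add: image_comp o_def)
    also have "\<dots> = C -` (B \<inter> g ` S)" unfolding gA by (rule RV)
    finally show ?thesis .
  qed
  define D where "D v = R \<circ> (*) (g' (C v)) \<circ> C" for v
  have der: "(G has_derivative D v) (at v within A2)" if "v \<in> A2" for v
  proof -
    have "(g has_derivative (*) (g' (C v))) (at (C v))"
      using g[of "C v"] that by (auto simp: A2_def A_def has_field_derivative_def)
    then have "(G has_derivative D v) (at v)"
      unfolding G_def D_def by (intro diff_chain_at dC dR) (auto simp: o_def intro: dR)
    then show ?thesis by (rule has_derivative_at_withinI)
  qed
  have injG: "inj_on G A2"
    unfolding G_def A2_def A_def inj_on_def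
    using inj CR by (metis (mono_tags, lifting) comp_apply inj_on_def mem_Collect_eq vimageE)
  have det: "\<bar>det (matrix (D v))\<bar> = (cmod (g' (C v)))\<^sup>2" for v
    by (simp add: det_2 matrix_def D_def R_def C_def axis_def flip: cmod_power2 power2_eq_square)
  have em: "emeasure lborel (B \<inter> g ` S) = emeasure lborel (C -` (B \<inter> g ` S))"
    by (subst lborel_complex_real2) (simp add: emeasure_distr C_def[symmetric])
  have fin: "emeasure lborel (B \<inter> g ` S) < \<infinity>"
    by (rule le_less_trans[OF emeasure_mono emeasure_bounded_finite[OF B(2)]]) (use B in auto)
  then have "C -` (B \<inter> g ` S) \<in> lmeasurable"
    unfolding em using measurable_sets_borel[OF \<open>C \<in> borel_measurable borel\<close> X]
    by (auto simp: fmeasurable_def emeasure_completion sets_completionI_sets)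
  then have "((\<lambda>v. \<bar>det (matrix (D v))\<bar>) has_integral measure lebesgue (C -` (B \<inter> g ` S))) A2"
    by (subst has_measure_differentiable_image[OF _ der injG, symmetric])
       (use A2 in \<open>auto simp: GA\<close>)
  then have "((\<lambda>v. (cmod (g' (C v)))\<^sup>2) has_integral measure lebesgue (C -` (B \<inter> g ` S))) A2"
    by (simp only: det)
  then have "((\<lambda>v. indicator A2 v * (cmod (g' (C v)))\<^sup>2) has_integral measure lebesgue (C -` (B \<inter> g ` S))) UNIV"
    by (subst (asm) has_integral_restrict_UNIV[symmetric], elim has_integral_eq[rotated]) auto
  then have "(\<integral>\<^sup>+v. ennreal (indicator A2 v * (cmod (g' (C v)))\<^sup>2) \<partial>lborel) = ennreal (measure lebesgue (C -` (B \<inter> g ` S)))"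
    using A2 by (intro nn_integral_has_integral_lborel) auto
  also have "\<dots> = emeasure lborel (C -` (B \<inter> g ` S))"
    using measurable_sets_borel[OF \<open>C \<in> borel_measurable borel\<close> X] fin
    by (simp add: em emeasure_eq_ennreal_measure)
  finally have "(\<integral>\<^sup>+v. ennreal (indicator A2 v * (cmod (g' (C v)))\<^sup>2) \<partial>lborel) = emeasure lborel (B \<inter> g ` S)"
    by (simp only: em)
  moreover have "(\<integral>\<^sup>+z. indicator A z * ennreal ((cmod (g' z))\<^sup>2) \<partial>lborel)
      = (\<integral>\<^sup>+v. ennreal (indicator A2 v * (cmod (g' (C v)))\<^sup>2) \<partial>lborel)"
    by (subst nn_integral_complex_real2)
       (auto simp: C_def[symmetric] A2_def split: split_indicator intro!: nn_integral_cong)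
  ultimately show ?thesis by (simp add: A_def)
qed

text \<open>Both sides integrate \<open>F\<close>, one against Lebesgue measure restricted to the
  image of \<open>g\<close>, the other against the image under \<open>g\<close> of the measure with
  density |g'|^2 on \<open>S\<close>. These measures agree on bounded sets by the previous lemma,
  and balls exhaust every Borel set.\<close>

lemma nn_integral_holomorphic_substitution:
  fixes g :: "complex \<Rightarrow> complex"
  assumes S: "open S" and g: "\<And>z. z \<in> S \<Longrightarrow> (g has_field_derivative g' z) (at z)"
    and inj: "inj_on g S" and gS [measurable]: "g ` S \<in> sets borel"
    and gm [measurable]: "g \<in> borel_measurable borel" and g' [measurable]: "g' \<in> borel_measurable borel"
    and F [measurable]: "F \<in> borel_measurable borel"
  shows "(\<integral>\<^sup>+z. indicator (g ` S) z * F z \<partial>lborel) =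
    (\<integral>\<^sup>+z. indicator S z * ennreal ((cmod (g' z))\<^sup>2) * F (g z) \<partial>lborel)"
proof -
  have [measurable]: "S \<in> sets borel" using S by simp
  define \<nu> where "\<nu> = distr (density lborel (\<lambda>z. indicator S z * ennreal ((cmod (g' z))\<^sup>2))) borel g"
  define \<mu> where "\<mu> = density lborel (indicator (g ` S) :: complex \<Rightarrow> ennreal)"
  have "\<mu> = \<nu>"
  proof (rule measure_eqI)
    fix B assume "B \<in> sets \<mu>"
    then have B [measurable]: "B \<in> sets borel" by (simp add: \<mu>_def)
    have eq: "emeasure \<mu> (B \<inter> ball 0 (real n)) = emeasure \<nu> (B \<inter> ball 0 (real n))" for n :: nat
    proof -
      let ?B = "B \<inter> ball 0 (real n)"
      have "emeasure \<mu> ?B = emeasure lborel (?B \<inter> g ` S)"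
        unfolding \<mu>_def
        by (subst emeasure_density, simp, simp)
           (auto simp: indicator_def mult.commute simp flip: nn_integral_indicator intro!: nn_integral_cong)
      also have "\<dots> = (\<integral>\<^sup>+z. indicator {z \<in> S. g z \<in> ?B} z * ennreal ((cmod (g' z))\<^sup>2) \<partial>lborel)"
        by (rule nn_integral_holomorphic_substitution_bounded[OF S g inj gS _ _ g'])
           (auto intro: bounded_subset[OF bounded_ball])
      also have "\<dots> = emeasure \<nu> ?B"
        unfolding \<nu>_def
        by (subst emeasure_distr, simp, simp, subst emeasure_density, simp, measurable)
           (auto simp: indicator_def intro!: nn_integral_cong)
      finally show ?thesis .
    qed
    have U: "(\<Union>n. B \<inter> ball 0 (real n)) = B"
      using reals_Archimedean2 by (auto simp: mem_ball dist_norm)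
    have inc: "incseq (\<lambda>n. B \<inter> ball 0 (real n))"
      by (auto simp: incseq_def intro: order.strict_trans2)
    have "emeasure \<mu> B = (SUP n. emeasure \<mu> (B \<inter> ball 0 (real n)))"
      using SUP_emeasure_incseq[of "\<lambda>n. B \<inter> ball 0 (real n)" \<mu>] inc U by (simp add: \<mu>_def image_subset_iff)
    also have "\<dots> = emeasure \<nu> B"
      using SUP_emeasure_incseq[of "\<lambda>n. B \<inter> ball 0 (real n)" \<nu>] inc U by (simp add: eq \<nu>_def image_subset_iff)
    finally show "emeasure \<mu> B = emeasure \<nu> B" .
  qed (simp add: \<mu>_def \<nu>_def)
  have "(\<integral>\<^sup>+z. indicator (g ` S) z * F z \<partial>lborel) = (\<integral>\<^sup>+z. F z \<partial>\<mu>)"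
    by (simp add: \<mu>_def nn_integral_density)
  also have "\<dots> = (\<integral>\<^sup>+z. F z \<partial>\<nu>)" by (simp add: \<open>\<mu> = \<nu>\<close>)
  also have "\<dots> = (\<integral>\<^sup>+z. indicator S z * ennreal ((cmod (g' z))\<^sup>2) * F (g z) \<partial>lborel)"
    by (simp add: \<nu>_def nn_integral_distr nn_integral_density)
  finally show ?thesis .
qed

section \<open>Rotations and the mean value property on the ball\<close>

lemma nn_integral_complex_translate:
  fixes a :: complex
  assumes "F \<in> borel_measurable borel"
  shows "(\<integral>\<^sup>+z. F (z + a) \<partial>lborel) = (\<integral>\<^sup>+z. F z \<partial>lborel)"
proof -
  have "range (\<lambda>z. z + a) = UNIV" by (metis add_diff_cancel_right' surjI diff_add_cancel)
  moreover have "((\<lambda>z. z + a) has_field_derivative 1) (at z)" for z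
    by (auto intro!: derivative_eq_intros)
  ultimately show ?thesis
    using nn_integral_holomorphic_substitution[of UNIV "\<lambda>z. z + a" "\<lambda>_. 1" F] assms
    by simp
qed

lemma nn_integral_complex_scale:
  fixes c :: complex
  assumes "F \<in> borel_measurable borel" "c \<noteq> 0"
  shows "(\<integral>\<^sup>+z. ennreal ((cmod c)\<^sup>2) * F (c * z) \<partial>lborel) = (\<integral>\<^sup>+z. F z \<partial>lborel)"
proof -
  have "range (\<lambda>z. c * z) = UNIV" by (rule surjI[of _ "\<lambda>z. z / c"]) (use assms in auto)
  moreover have "((\<lambda>z. c * z) has_field_derivative c) (at z)" for z
    by (auto intro!: derivative_eq_intros)
  ultimately show ?thesis
    using nn_integral_holomorphic_substitution[of UNIV "\<lambda>z. c * z" "\<lambda>_. c" F] assms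
    by (simp add: inj_on_def)
qed

section \<open>Scalings and rotations of the coordinates\<close>

definition scale_coords :: "'n set \<Rightarrow> complex \<Rightarrow> complex ^ 'n::finite \<Rightarrow> complex ^ 'n" where
  "scale_coords J c v = (\<chi> j. if j \<in> J then c * v $ j else v $ j)"

lemma scale_coords_nth [simp]: "scale_coords J c v $ j = (if j \<in> J then c * v $ j else v $ j)"
  by (simp add: scale_coords_def)

lemma measurable_scale_coords [measurable]:
  assumes "f \<in> M \<rightarrow>\<^sub>M borel" "g \<in> M \<rightarrow>\<^sub>M (borel :: complex measure)"
  shows "(\<lambda>x. scale_coords J (g x) (f x)) \<in> M \<rightarrow>\<^sub>M borel"
proof -
  have "(\<lambda>x. if j \<in> J then g x * f x $ j else f x $ j) \<in> M \<rightarrow>\<^sub>M borel" for j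
    using assms by (cases "j \<in> J") auto
  then show ?thesis
    unfolding scale_coords_def by (rule measurable_vec_lambda)
qed

text \<open>The factor \<open>c\<close> may depend on the coordinates outside \<open>J\<close>: the
  ball model scales all coordinates but the last by a multiple of 1/(1 - q_n). The induction scales
  one more coordinate at a time, each at the cost of one factor |c|^2.\<close>

lemma nn_integral_scale_coords:
  fixes F W :: "complex ^ 'n::finite \<Rightarrow> ennreal"
  assumes [measurable]: "F \<in> borel_measurable borel" "W \<in> borel_measurable borel" "c \<in> borel_measurable borel"
    and c: "\<And>v k t. k \<in> J \<Longrightarrow> c (vec_upd v k t) = c v"
    and W: "\<And>v k t. k \<in> J \<Longrightarrow> W (vec_upd v k t) = W v"
    and nz: "\<And>v. W v \<noteq> 0 \<Longrightarrow> c v \<noteq> 0"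
  shows "(\<integral>\<^sup>+v. W v * ennreal (cmod (c v) ^ (2 * card J)) * F (scale_coords J (c v) v) \<partial>lborel)
    = (\<integral>\<^sup>+v. W v * F v \<partial>lborel)"
proof -
  have "finite J" by simp
  then show ?thesis using c W
  proof (induction J)
    case empty
    then show ?case by (simp add: scale_coords_def)
  next
    case (insert k J)
    have "(\<integral>\<^sup>+v. W v * ennreal (cmod (c v) ^ (2 * card (insert k J))) * F (scale_coords (insert k J) (c v) v) \<partial>lborel)
        = (\<integral>\<^sup>+v. W v * ennreal (cmod (c v) ^ (2 * card J)) * F (scale_coords J (c v) v) \<partial>lborel)"
    proof (rule nn_integral_fibre_eq[where k = k])
      fix v :: "complex ^ 'n"
      have ck: "c (vec_upd v k t) = c v" "W (vec_upd v k t) = W v" for t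
        using insert.prems by auto
      show "(\<integral>\<^sup>+t. W (vec_upd v k t) * ennreal (cmod (c (vec_upd v k t)) ^ (2 * card (insert k J)))
            * F (scale_coords (insert k J) (c (vec_upd v k t)) (vec_upd v k t)) \<partial>lborel)
          = (\<integral>\<^sup>+t. W (vec_upd v k t) * ennreal (cmod (c (vec_upd v k t)) ^ (2 * card J))
            * F (scale_coords J (c (vec_upd v k t)) (vec_upd v k t)) \<partial>lborel)"
      proof (cases "W v = 0")
        case False
        have "scale_coords (insert k J) (c v) (vec_upd v k t) = scale_coords J (c v) (vec_upd v k (c v * t))" for t
          using insert.hyps by (auto simp: vec_eq_iff)
        moreover have "cmod (c v) ^ (2 * card (insert k J)) = (cmod (c v))\<^sup>2 * cmod (c v) ^ (2 * card J)"
          using insert.hyps by (simp add: power_add[symmetric])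
        ultimately show ?thesis
          unfolding ck
          using nn_integral_complex_scale[of "\<lambda>t. W v * ennreal (cmod (c v) ^ (2 * card J)) * F (scale_coords J (c v) (vec_upd v k t))" "c v"]
            nz[OF False]
          by (simp add: ennreal_mult' mult_ac)
      qed (simp add: ck)
    qed measurable
    also have "\<dots> = (\<integral>\<^sup>+v. W v * F v \<partial>lborel)"
      by (rule insert.IH) (use insert.prems in auto)
    finally show ?case .
  qed
qed

lemma measurable_vector_scalar_mult [measurable]:
  assumes "f \<in> M \<rightarrow>\<^sub>M borel" "g \<in> M \<rightarrow>\<^sub>M (borel :: complex measure)"
  shows "(\<lambda>x. g x *s (f x :: complex ^ 'n::finite)) \<in> M \<rightarrow>\<^sub>M borel"
  unfolding vector_scalar_mult_def using assms by measurable

lemma distr_lborel_rotation: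
  assumes "cmod c = 1"
  shows "distr lborel borel (\<lambda>v. c *s v) = (lborel :: (complex ^ 'n::finite) measure)"
proof (rule measure_eqI)
  fix X assume "X \<in> sets (distr lborel borel (\<lambda>v. c *s (v :: complex ^ 'n)))"
  then have X [measurable]: "X \<in> sets borel" by simp
  have "c \<noteq> 0" using assms by auto
  have "scale_coords UNIV c v = c *s v" for v :: "complex ^ 'n" by (simp add: vec_eq_iff)
  then have "(\<integral>\<^sup>+v. indicator X (c *s v) \<partial>lborel) = (\<integral>\<^sup>+v. indicator X v \<partial>lborel)"
    using nn_integral_scale_coords[of "indicator X" "\<lambda>_. 1" "\<lambda>_. c" UNIV] assms \<open>c \<noteq> 0\<close> by simp
  then show "emeasure (distr lborel borel (\<lambda>v. c *s v)) X = emeasure lborel X"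
    by (simp add: nn_integral_distr flip: nn_integral_indicator)
qed simp

text \<open>Cauchy's formula at the centre. Parametrising the circle by [0, 1] leaves no normalising
  factor.\<close>

lemma mean_value_circle:
  assumes "open U" "cball 0 1 \<subseteq> U" "G holomorphic_on U"
  shows "has_bochner_integral lborel (\<lambda>x. indicator {0..1} x *\<^sub>R G (exp (2 * of_real pi * \<i> * of_real x))) (G 0)"
proof -
  let ?e = "\<lambda>x::real. exp (2 * of_real pi * \<i> * of_real x)"
  have cont: "continuous_on (cball 0 1) G" and hol: "G holomorphic_on ball 0 1"
    using assms ball_subset_cball[of "0 :: complex" 1]
    by (meson holomorphic_on_imp_continuous_on holomorphic_on_subset subset_trans)+
  have "((\<lambda>u. G u / (u - 0)) has_contour_integral (2 * of_real pi * \<i> * G 0)) (circlepath 0 1)"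
    by (rule Cauchy_integral_circlepath[OF cont hol]) simp
  then have "((\<lambda>x. G (?e x) * (2 * of_real pi * \<i>)) has_integral (2 * of_real pi * \<i> * G 0)) {0..1}"
    unfolding has_contour_integral_def
    by (rule has_integral_eq[rotated])
       (simp add: vector_derivative_circlepath01, simp add: circlepath)
  note scaled = has_integral_mult_left[OF this, of "inverse (2 * of_real pi * \<i>)"]
  have c: "2 * of_real pi * \<i> \<noteq> (0 :: complex)" by simp
  have "g * c * inverse c = g" "c * g * inverse c = g" if "c \<noteq> 0" for c g :: complex
    using that by auto
  from scaled[unfolded this[OF c]]
  have *: "((\<lambda>x. G (?e x)) has_integral G 0) {0..1}" .
  have "continuous_on {0..1} (\<lambda>x. G (?e x))"
    by (rule continuous_on_compose2[OF cont]) (auto intro!: continuous_intros)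
  then have si: "set_integrable lborel {0..1} (\<lambda>x. G (?e x))"
    by (intro borel_integrable_atLeastAtMost')
  have "(LINT x:{0..1}|lborel. G (?e x)) = G 0"
    unfolding set_borel_integral_eq_integral(2)[OF si] by (rule integral_unique[OF *])
  with si show ?thesis
    unfolding has_bochner_integral_iff set_integrable_def set_lebesgue_integral_def by blast
qed

text \<open>
  The circular means may replace the integrand because rotations preserve Lebesgue measure (Fubini).
\<close>

lemma integral_circular_mean:
  fixes M :: "complex ^ 'n::finite \<Rightarrow> complex"
  assumes int: "integrable lborel M"
    and mean: "\<And>v. has_bochner_integral lborel (\<lambda>x. indicator {0..1} x *\<^sub>R M (exp (2 * of_real pi * \<i> * of_real x) *s v)) (A v)"
  shows "integral\<^sup>L lborel M = integral\<^sup>L lborel A"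
proof -
  let ?e = "\<lambda>x::real. exp (2 * of_real pi * \<i> * of_real x)"
  let ?g = "\<lambda>(x, v). indicator {0..1} x *\<^sub>R M (?e x *s v)"
  have [measurable]: "M \<in> borel_measurable borel"
    using borel_measurable_integrable[OF int] by simp
  have [measurable]: "(\<lambda>x. ?e x) \<in> borel_measurable borel"
    by (intro borel_measurable_continuous_onI continuous_intros)
  have e1: "cmod (?e x) = 1" for x by simp
  have rot: "integrable lborel (\<lambda>v. M (?e x *s v))" "integral\<^sup>L lborel (\<lambda>v. M (?e x *s v)) = integral\<^sup>L lborel M"
    "(\<integral>v. norm (M (?e x *s v)) \<partial>lborel) = (\<integral>v. norm (M v) \<partial>lborel)" for x
  proof -
    note D = distr_lborel_rotation[OF e1[of x], where 'n = 'n]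
    show "integrable lborel (\<lambda>v. M (?e x *s v))"
      using int by (subst (asm) D[symmetric]) (simp add: integrable_distr_eq)
    show "integral\<^sup>L lborel (\<lambda>v. M (?e x *s v)) = integral\<^sup>L lborel M"
      by (subst (2) D[symmetric]) (simp add: integral_distr)
    show "(\<integral>v. norm (M (?e x *s v)) \<partial>lborel) = (\<integral>v. norm (M v) \<partial>lborel)"
      by (subst (2) D[symmetric]) (simp add: integral_distr)
  qed
  have I: "integrable (lborel \<Otimes>\<^sub>M lborel) ?g"
  proof (rule lborel_pair.Fubini_integrable)
    show "integrable lborel (\<lambda>x. \<integral>v. norm (?g (x, v)) \<partial>lborel)"
      by (simp add: rot)
  qed (auto simp: rot intro!: AE_I2)
  have "integral\<^sup>L lborel M = (\<integral>x. indicator {0..1::real} x *\<^sub>R integral\<^sup>L lborel M \<partial>lborel)"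
    by simp
  also have "\<dots> = (\<integral>x. (\<integral>v. ?g (x, v) \<partial>lborel) \<partial>lborel)"
    by (simp add: rot)
  also have "\<dots> = (\<integral>v. (\<integral>x. ?g (x, v) \<partial>lborel) \<partial>lborel)"
    using lborel_pair.Fubini_integral[of "\<lambda>x v. ?g (x, v)"] I by simp
  also have "\<dots> = integral\<^sup>L lborel A"
    using mean by (intro Bochner_Integration.integral_cong) (auto simp: has_bochner_integral_iff)
  finally show ?thesis .
qed

text \<open>The weight is constant on the circle of points \<open>exp (2 pi i x) *s q\<close>, while
  \<open>E\<close> is holomorphic on the slice through 0 and \<open>q\<close> and has mean
  \<open>E 0\<close> on that circle. Only one-variable holomorphy on these slices enters.\<close>

lemma integral_ball_mean_value:
  fixes E :: "complex ^ 'n::finite \<Rightarrow> complex" and w :: "real \<Rightarrow> real"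
  assumes int: "integrable lborel (\<lambda>q. indicator (ball 0 1) q *\<^sub>R (of_real (w (norm q)) * E q))"
    and hol: "\<And>q. norm q < 1 \<Longrightarrow> \<exists>U. open U \<and> cball 0 1 \<subseteq> U \<and> (\<lambda>t. E (t *s q)) holomorphic_on U"
  shows "(\<integral>q. indicator (ball 0 1) q *\<^sub>R (of_real (w (norm q)) * E q) \<partial>lborel)
     = E 0 * of_real (\<integral>q. indicator (ball 0 1) (q :: complex ^ 'n) * w (norm q) \<partial>lborel)"
proof -
  have nrm: "norm (exp (2 * of_real pi * \<i> * of_real x) *s q) = norm q" for x :: real and q :: "complex ^ 'n"
    by (simp add: norm_vec_def L2_set_def norm_mult)
  let ?M = "\<lambda>q. indicator (ball 0 1) q *\<^sub>R (of_real (w (norm q)) * E q)"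
  let ?A = "\<lambda>q :: complex ^ 'n. indicator (ball 0 1) q *\<^sub>R (of_real (w (norm q)) * E 0)"
  have "integral\<^sup>L lborel ?M = integral\<^sup>L lborel ?A"
  proof (rule integral_circular_mean[OF int])
    fix q :: "complex ^ 'n"
    show "has_bochner_integral lborel (\<lambda>x. indicator {0..1} x *\<^sub>R ?M (exp (2 * of_real pi * \<i> * of_real x) *s q)) (?A q)"
    proof (cases "norm q < 1")
      case True
      from hol[OF True] obtain U where U: "open U" "cball 0 1 \<subseteq> U" "(\<lambda>t. E (t *s q)) holomorphic_on U"
        by blast
      have "has_bochner_integral lborel (\<lambda>x. of_real (w (norm q)) * (indicator {0..1} x *\<^sub>R E (exp (2 * of_real pi * \<i> * of_real x) *s q)))
         (of_real (w (norm q)) * E (0 *s q))"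
        by (intro has_bochner_integral_mult_right mean_value_circle[OF U])
      moreover have "?M (exp (2 * of_real pi * \<i> * of_real x) *s q)
          = of_real (w (norm q)) * E (exp (2 * of_real pi * \<i> * of_real x) *s q)" for x :: real
        unfolding nrm using True nrm[of x q] by simp
      then have "(\<lambda>x::real. indicator {0..1} x *\<^sub>R ?M (exp (2 * of_real pi * \<i> * of_real x) *s q)) =
         (\<lambda>x. of_real (w (norm q)) * (indicator {0..1} x *\<^sub>R E (exp (2 * of_real pi * \<i> * of_real x) *s q)))"
        by (simp only: mult_scaleR_right)
      moreover have "?A q = of_real (w (norm q)) * E (0 *s q)"
        using True by simp
      ultimately show ?thesis by (simp only:)
    qed (auto simp: nrm)
  qed
  also have "?A = (\<lambda>q. E 0 * of_real (indicator (ball 0 1) q * w (norm q)))"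
    by (auto simp: fun_eq_iff indicator_def)
  finally show ?thesis by (simp only: integral_mult_right_zero integral_complex_of_real)
qed

text \<open>Polar coordinates without a surface measure: the ball of radius sqrt x in C^n has volume
  pi^n x^n / n!, and differentiating this distribution function in x gives the density.\<close>

lemma nn_integral_norm_sq:
  fixes F :: "real \<Rightarrow> ennreal"
  assumes [measurable]: "F \<in> borel_measurable borel"
  shows "(\<integral>\<^sup>+q. F ((norm (q :: complex ^ 'n::finite))\<^sup>2) \<partial>lborel) =
    (\<integral>\<^sup>+x. ennreal (pi ^ CARD('n) / fact (CARD('n) - 1) * x ^ (CARD('n) - 1)) * indicator {0..} x * F x \<partial>lborel)"
proof -
  let ?n = "CARD('n)"
  have n: "?n > 0" by simp
  then have f: "fact ?n = real ?n * fact (?n - 1)" by (rule fact_reduce)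
  define \<mu> where "\<mu> = distr (lborel :: (complex ^ 'n) measure) borel (\<lambda>q. (norm q)\<^sup>2)"
  define \<nu> where "\<nu> = density lborel (\<lambda>x::real. ennreal (pi ^ ?n / fact (?n - 1) * x ^ (?n - 1)) * indicator {0..} x)"
  have V: "emeasure \<mu> {..x} = (if x < 0 then 0 else ennreal (pi ^ ?n / fact ?n * x ^ ?n))" for x
  proof -
    have "(\<lambda>q. (norm q)\<^sup>2) -` {..x} \<inter> space lborel = (if x < 0 then {} else cball (0 :: complex ^ 'n) (sqrt x))"
      by (auto simp: real_le_rsqrt) (smt (verit) zero_le_power2, metis norm_ge_zero power_mono real_sqrt_pow2 not_less)
    moreover have "(sqrt x ^ ?n)\<^sup>2 = x ^ ?n" if "\<not> x < 0"
      using that by (simp only: power2_eq_square power_mult_distrib[symmetric]) simp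
    ultimately show ?thesis
      unfolding \<mu>_def
      by (auto simp: emeasure_distr emeasure_cball unit_ball_vol_def powr_realpow Gamma_fact
          power_mult add.commute[of _ 1])
  qed
  have W: "emeasure \<nu> {..x} = (if x < 0 then 0 else ennreal (pi ^ ?n / fact ?n * x ^ ?n))" for x
  proof -
    have "emeasure \<nu> {..x} = (\<integral>\<^sup>+t. ennreal (pi ^ ?n / fact (?n - 1) * t ^ (?n - 1)) * indicator {0..x} t \<partial>lborel)"
      unfolding \<nu>_def by (subst emeasure_density) (auto intro!: nn_integral_cong split: split_indicator)
    also have "\<dots> = (if x < 0 then 0 else ennreal (pi ^ ?n / fact ?n * x ^ ?n))"
    proof (cases "x < 0")
      case False
      have "(\<integral>\<^sup>+t. ennreal (pi ^ ?n / fact (?n - 1) * t ^ (?n - 1)) * indicator {0..x} t \<partial>lborel)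
         = ennreal (pi ^ ?n / fact ?n * x ^ ?n - pi ^ ?n / fact ?n * 0 ^ ?n)"
        by (rule nn_integral_FTC_Icc) (use False n in \<open>auto intro!: derivative_eq_intros simp: f\<close>)
      then show ?thesis using False n by (simp add: power_0_left)
    qed simp
    finally show ?thesis .
  qed
  have "\<mu> = \<nu>"
  proof (rule measure_eqI_generator_eq[where E = "range (atMost :: real \<Rightarrow> real set)" and \<Omega> = UNIV and A = "\<lambda>i. {..real i}"])
    show "Int_stable (range (atMost :: real \<Rightarrow> real set))"
      by (auto simp: Int_stable_def)
    show "sets \<mu> = sigma_sets UNIV (range atMost)" "sets \<nu> = sigma_sets UNIV (range atMost)"
      by (simp_all add: \<mu>_def \<nu>_def borel_eq_atMost)
    show "(\<Union>i. {..real i}) = UNIV" by (auto intro: real_arch_simple)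
  qed (auto simp: V W)
  have "(\<integral>\<^sup>+q. F ((norm (q :: complex ^ 'n::finite))\<^sup>2) \<partial>lborel) = (\<integral>\<^sup>+x. F x \<partial>\<mu>)"
    by (simp add: \<mu>_def nn_integral_distr)
  also have "\<dots> = (\<integral>\<^sup>+x. F x \<partial>\<nu>)" by (simp add: \<open>\<mu> = \<nu>\<close>)
  finally show ?thesis by (simp add: \<nu>_def nn_integral_density)
qed

text \<open>In the variable x = |q|^2 this is the Beta integral B(n, a + 1). The reciprocal of the
  value is the normalising constant of T_a up to the factor 2^(n+1), which comes from the Jacobian
  of the ball model.\<close>

lemma has_bochner_integral_ball_weight:
  assumes a: "a > -1"
  shows "has_bochner_integral lborel (\<lambda>q :: complex ^ 'n::finite. indicator (ball 0 1) q * (1 - (norm q)\<^sup>2) powr a)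
    (pi ^ CARD('n) * Gamma (a + 1) / Gamma (real CARD('n) + 1 + a))"
proof (rule has_bochner_integral_nn_integral)
  let ?n = "CARD('n)"
  have n: "real ?n > 0" by simp
  have fg: "fact (?n - 1) = Gamma (real ?n)"
    using Gamma_fact[of "?n - 1", where 'a = real] by (simp add: of_nat_diff)
  have "((\<lambda>t. t powr (real ?n - 1) * (1 - t) powr (a + 1 - 1)) has_integral Beta (real ?n) (a + 1)) {0..1}"
    by (rule has_integral_Beta_real) (use a in auto)
  then have B: "((\<lambda>t. pi ^ ?n / fact (?n - 1) * (t powr (real ?n - 1) * (1 - t) powr a)) has_integral 
     pi ^ ?n / fact (?n - 1) * Beta (real ?n) (a + 1)) {0..1}"
    by (intro has_integral_mult_right) simp
  have ind: "indicator (ball 0 1) q = (indicator {..<1} ((norm q)\<^sup>2) :: real)" for q :: "complex ^ 'n"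
    by (auto simp: indicator_def power_less_one_iff abs_square_less_1)
  have "(\<integral>\<^sup>+q. ennreal (indicator (ball 0 1) (q :: complex ^ 'n) * (1 - (norm q)\<^sup>2) powr a) \<partial>lborel)
      = (\<integral>\<^sup>+q. ennreal (indicator {..<1} ((norm (q :: complex ^ 'n))\<^sup>2) * (1 - (norm q)\<^sup>2) powr a) \<partial>lborel)"
    by (simp only: ind)
  also have "\<dots> = (\<integral>\<^sup>+x. ennreal (pi ^ ?n / fact (?n - 1) * x ^ (?n - 1)) * indicator {0..} x * ennreal (indicator {..<1} x * (1 - x) powr a) \<partial>lborel)"
    by (rule nn_integral_norm_sq[where F = "\<lambda>x. ennreal (indicator {..<1} x * (1 - x) powr a)"]) measurable
  also have "\<dots> = (\<integral>\<^sup>+x. ennreal (indicator {0..1} x * (pi ^ ?n / fact (?n - 1) * (x powr (real ?n - 1) * (1 - x) powr a))) \<partial>lborel)"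
  \<comment> \<open>For n = 1 the integrands differ at 0, where \<open>0 ^ 0 = 1\<close> but
    \<open>0 powr 0 = 0\<close>, so they are compared almost everywhere.\<close>
  proof (rule nn_integral_cong_AE, use AE_lborel_singleton[of 0] AE_lborel_singleton[of 1] in eventually_elim)
    fix x :: real assume "x \<noteq> 0" "x \<noteq> 1"
    have "x ^ (?n - 1) = x powr (real ?n - 1)" if "x > 0"
      using that by (simp add: powr_realpow[symmetric] of_nat_diff)
    with \<open>x \<noteq> 0\<close> \<open>x \<noteq> 1\<close> show "ennreal (pi ^ ?n / fact (?n - 1) * x ^ (?n - 1)) * indicator {0..} x * ennreal (indicator {..<1} x * (1 - x) powr a)
      = ennreal (indicator {0..1} x * (pi ^ ?n / fact (?n - 1) * (x powr (real ?n - 1) * (1 - x) powr a)))"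
      by (auto simp: indicator_def ennreal_mult'[symmetric] mult_ac)
  qed
  also have "\<dots> = ennreal (pi ^ ?n / fact (?n - 1) * Beta (real ?n) (a + 1))"
    using B by (rule nn_integral_has_integral_lebesgue[rotated]) simp
  also have "pi ^ ?n / fact (?n - 1) * Beta (real ?n) (a + 1) = pi ^ ?n * Gamma (a + 1) / Gamma (real ?n + 1 + a)"
    unfolding fg Beta_def using less_imp_neq[OF Gamma_real_pos[OF n]] by (simp add: field_simps)
  finally show "(\<integral>\<^sup>+q. ennreal (indicator (ball 0 1) (q :: complex ^ 'n) * (1 - (norm q)\<^sup>2) powr a) \<partial>lborel)
     = ennreal (pi ^ ?n * Gamma (a + 1) / Gamma (real ?n + 1 + a))" .
  show "0 \<le> pi ^ ?n * Gamma (a + 1) / Gamma (real ?n + 1 + a)"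
    using a by (intro divide_nonneg_nonneg mult_nonneg_nonneg Gamma_real_nonneg) auto
  have "(\<lambda>q :: complex ^ 'n. indicator (ball 0 1) q * (1 - (norm q)\<^sup>2) powr a) \<in> borel_measurable borel"
    by (intro borel_measurable_times borel_measurable_indicator powr_real_measurable borel_measurable_diff
        borel_measurable_power borel_measurable_norm) auto
  then show "(\<lambda>q :: complex ^ 'n. indicator (ball 0 1) q * (1 - (norm q)\<^sup>2) powr a) \<in> borel_measurable lborel"
    by simp
qed (auto intro!: AE_I2)

section \<open>The ball model of the tube domain\<close>

lemma pred_ball_borel [measurable]:
  fixes f :: "'b \<Rightarrow> 'a::euclidean_space"
  assumes [measurable]: "f \<in> borel_measurable M"
  shows "Measurable.pred M (\<lambda>x. f x \<in> ball a r)"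
  unfolding mem_ball dist_norm by measurable

lemma cmod_sq: "(cmod w)\<^sup>2 = Re w * Re w + Im w * Im w"
  unfolding cmod_power2 by (simp add: power2_eq_square)

abbreviation rest :: "'n::{finite,linorder} set" where "rest \<equiv> UNIV - {last_index}"

lemma tube_domain_iff: "z \<in> tube_domain \<longleftrightarrow> 0 < tube_rho z"
  by (simp add: tube_domain_def tube_rho_def)

text \<open>
  A shear that preserves Lebesgue measure. Its last component is chosen so that
  \<^term>\<open>tube_rho2 z (heis z v)\<close> depends only on the last coordinate of \<^term>\<open>v\<close>.
\<close>

definition heis :: "(complex, 'n::{finite,linorder}) vec \<Rightarrow> (complex, 'n::{finite,linorder}) vec \<Rightarrow> (complex, 'n::{finite,linorder}) vec" where
  "heis z v = (\<chi> j. if j = last_index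
     then v $ last_index + \<i> * of_real (\<Sum>k\<in>rest. (Im (z $ k))\<^sup>2)
        + (\<Sum>k\<in>rest. 2 * of_real (Im (z $ k)) * v $ k - \<i> / 2 * (v $ k)\<^sup>2)
     else z $ j + v $ j)"

text \<open>The last coordinate of the vector that \<open>heis z\<close> maps to \<open>z\<close>;
  the other coordinates of that vector are 0.\<close>

definition base_pt :: "(complex, 'n::{finite,linorder}) vec \<Rightarrow> complex" where
  "base_pt z = z $ last_index - \<i> * of_real (\<Sum>k\<in>rest. (Im (z $ k))\<^sup>2)"

lemma Im_base_pt: "Im (base_pt z) = tube_rho z"
  by (simp add: base_pt_def tube_rho_def)

text \<open>Since (Im u)^2 = |u|^2/2 - Re(u^2)/2, the quadratic term of \<open>heis\<close> replaces
  imaginary parts by full moduli. The domain becomes Im v_n > |v'|^2/2, the Siegel form of the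
  ball.\<close>

lemma tube_rho_heis: "tube_rho (heis z v) = Im (v $ last_index) - (\<Sum>k\<in>rest. (cmod (v $ k))\<^sup>2) / 2"
proof -
  have "(\<Sum>k\<in>rest. (Im (z $ k + v $ k))\<^sup>2) = (\<Sum>k\<in>rest. (Im (z $ k))\<^sup>2) +
     (\<Sum>k\<in>rest. Im (2 * of_real (Im (z $ k)) * v $ k - \<i> / 2 * (v $ k)\<^sup>2)) + (\<Sum>k\<in>rest. (cmod (v $ k))\<^sup>2) / 2"
    unfolding sum_divide_distrib sum.distrib[symmetric]
    unfolding cmod_sq by (rule sum.cong) (auto simp: power2_eq_square field_simps)
  then show ?thesis by (simp add: tube_rho_def heis_def)
qed

lemma tube_rho2_heis: "tube_rho2 z (heis z v) = (base_pt z - cnj (v $ last_index)) / (2 * \<i>)"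
proof -
  define b where "b k = 2 * of_real (Im (z $ k)) * v $ k - \<i> / 2 * (v $ k)\<^sup>2" for k
  have eq: "(z $ k - cnj (z $ k + v $ k))\<^sup>2 = - 4 * of_real ((Im (z $ k))\<^sup>2) - 2 * \<i> * cnj (b k)" for k
  proof -
    have *: "z $ k - cnj (z $ k + v $ k) = 2 * \<i> * of_real (Im (z $ k)) - cnj (v $ k)"
      by (simp add: complex_eq_iff)
    show ?thesis unfolding * b_def by (simp add: power2_eq_square algebra_simps)
  qed
  define A where "A = (\<Sum>k\<in>rest. (Im (z $ k))\<^sup>2)"
  define B where "B = (\<Sum>k\<in>rest. b k)"
  have "(\<Sum>k\<in>rest. (z $ k - cnj (heis z v $ k))\<^sup>2) = (\<Sum>k\<in>rest. (z $ k - cnj (z $ k + v $ k))\<^sup>2)"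
    by (rule sum.cong) (auto simp: heis_def)
  also have "\<dots> = - 4 * of_real A - 2 * \<i> * cnj B"
    by (simp only: A_def B_def eq sum_subtractf sum_distrib_left of_real_sum cnj_sum)
  finally have S: "(\<Sum>k\<in>rest. (z $ k - cnj (heis z v $ k))\<^sup>2) = - 4 * of_real A - 2 * \<i> * cnj B" .
  have L: "heis z v $ last_index = v $ last_index + \<i> * of_real A + B"
    by (simp add: heis_def A_def B_def b_def)
  show ?thesis
    unfolding tube_rho2_def S L base_pt_def A_def[symmetric]
    by (simp add: divide_simps) (simp add: algebra_simps)
qed

lemma measurable_heis [measurable]: "heis z \<in> borel \<rightarrow>\<^sub>M borel"
proof -
  have "(\<lambda>v. if j = last_index
     then v $ last_index + \<i> * of_real (\<Sum>k\<in>rest. (Im (z $ k))\<^sup>2)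
        + (\<Sum>k\<in>rest. 2 * of_real (Im (z $ k)) * v $ k - \<i> / 2 * (v $ k)\<^sup>2)
     else z $ j + v $ j) \<in> borel \<rightarrow>\<^sub>M borel" for j
    by (cases "j = last_index") auto
  then show ?thesis unfolding heis_def[abs_def] by (rule measurable_vec_lambda)
qed

text \<open>For fixed other coordinates the last one is only translated, by an amount
  \<open>S\<close> depending on them. What is left is the translation by the constant vector
  \<open>b\<close>.\<close>

lemma nn_integral_heis:
  assumes [measurable]: "F \<in> borel_measurable borel"
  shows "(\<integral>\<^sup>+v. F (heis z v) \<partial>lborel) = (\<integral>\<^sup>+v. F v \<partial>lborel)"
proof -
  define b where "b = vec_upd z last_index (\<i> * of_real (\<Sum>k\<in>rest. (Im (z $ k))\<^sup>2))"
  have "(\<integral>\<^sup>+v. F (heis z v) \<partial>lborel) = (\<integral>\<^sup>+v. F (b + v) \<partial>lborel)"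
  proof (rule nn_integral_fibre_eq[where k = last_index])
      fix v
    define S where "S = (\<Sum>k\<in>rest. 2 * of_real (Im (z $ k)) * v $ k - \<i> / 2 * (v $ k)\<^sup>2)"
    have "heis z (vec_upd v last_index t) = b + vec_upd v last_index (t + S)" for t
      by (auto simp: vec_eq_iff heis_def b_def S_def)
    then show "(\<integral>\<^sup>+t. F (heis z (vec_upd v last_index t)) \<partial>lborel) = (\<integral>\<^sup>+t. F (b + vec_upd v last_index t) \<partial>lborel)"
      using nn_integral_complex_translate[of "\<lambda>t. F (b + vec_upd v last_index t)" S] by simp
  qed measurable
  also have "\<dots> = (\<integral>\<^sup>+v. F v \<partial>distr lborel borel ((+) b))"
    by (simp add: nn_integral_distr)
  finally show ?thesis by (simp add: lborel_distr_plus)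
qed

text \<open>For Im Z > 0 this maps the unit disc onto the upper half plane, with 0 going to
  \<open>Z\<close> and the boundary point 1 to infinity.\<close>

definition cayley :: "complex \<Rightarrow> complex \<Rightarrow> complex" where
  "cayley Z q = (Z - q * cnj Z) / (1 - q)"

lemma Im_cayley:
  assumes "q \<noteq> 1"
  shows "Im (cayley Z q) = Im Z * (1 - (cmod q)\<^sup>2) / (cmod (1 - q))\<^sup>2"
proof -
  have "cayley Z q = (Z - q * cnj Z) * cnj (1 - q) / of_real ((cmod (1 - q))\<^sup>2)"
    using assms by (simp add: cayley_def complex_norm_square divide_simps del: of_real_power)
  moreover have "Im ((Z - q * cnj Z) * cnj (1 - q)) = Im Z * (1 - (cmod q)\<^sup>2)"
    unfolding cmod_sq by (simp add: algebra_simps)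
  ultimately show ?thesis by (simp only: Im_divide_of_real)
qed

lemma cayley_image:
  assumes "Im Z > 0"
  shows "cayley Z ` ball 0 1 = {t. 0 < Im t}"
proof (intro equalityI subsetI)
  fix t assume "t \<in> cayley Z ` ball 0 1"
  then obtain q where q: "cmod q < 1" "t = cayley Z q" by auto
  then have "q \<noteq> 1" "(cmod q)\<^sup>2 < 1" by (auto simp: abs_square_less_1)
  then show "t \<in> {t. 0 < Im t}" using assms q Im_cayley[of q Z] by simp
next
  fix t assume "t \<in> {t. 0 < Im t}"
  then have t: "Im t > 0" by simp
  then have ne: "t - cnj Z \<noteq> 0" using assms by (auto simp: complex_eq_iff)
  have ZZ: "Z - cnj Z \<noteq> 0" using assms by (auto simp: complex_eq_iff)
  define q where "q = (t - Z) / (t - cnj Z)"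
  have 1: "1 - q = (Z - cnj Z) / (t - cnj Z)" using ne by (simp add: q_def field_simps)
  \<comment> \<open>The two squares differ by 4 Im Z Im t.\<close>
  have "(cmod (t - Z))\<^sup>2 < (cmod (t - cnj Z))\<^sup>2"
    unfolding cmod_sq using mult_pos_pos[OF assms t] by (simp add: algebra_simps)
  then have "cmod q < 1" using ne by (simp add: q_def norm_divide power_less_imp_less_base)
  moreover have "cayley Z q = t"
    unfolding cayley_def 1 using ne ZZ by (simp add: q_def divide_simps) (simp add: algebra_simps)
  ultimately show "t \<in> cayley Z ` ball 0 1" by force
qed

lemma cayley_inj: "Im Z > 0 \<Longrightarrow> inj_on (cayley Z) (ball 0 1)"
proof (rule inj_onI)
  fix q r assume Z: "Im Z > 0" and qr: "q \<in> ball 0 1" "r \<in> ball 0 1" "cayley Z q = cayley Z r"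
  then have "q \<noteq> 1" "r \<noteq> 1" by auto
  with qr have "(Z - q * cnj Z) * (1 - r) = (Z - r * cnj Z) * (1 - q)"
    by (simp add: cayley_def frac_eq_eq)
  moreover have "(Z - cnj Z) * (q - r) = (Z - q * cnj Z) * (1 - r) - (Z - r * cnj Z) * (1 - q)"
    by (simp add: algebra_simps)
  ultimately have "(Z - cnj Z) * (q - r) = 0" by simp
  moreover have "Z - cnj Z \<noteq> 0" using Z by (auto simp: complex_eq_iff)
  ultimately show "q = r" by simp
qed

lemma cayley_deriv:
  "q \<noteq> 1 \<Longrightarrow> (cayley Z has_field_derivative (Z - cnj Z) / (1 - q)\<^sup>2) (at q)"
  unfolding cayley_def[abs_def]
  by (auto intro!: derivative_eq_intros simp: power2_eq_square divide_simps algebra_simps)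

lemma cayley_borel [measurable]: "cayley Z \<in> borel_measurable borel"
  unfolding cayley_def[abs_def] by measurable

lemma nn_integral_cayley:
  assumes "Im Z > 0" and [measurable]: "F \<in> borel_measurable borel"
  shows "(\<integral>\<^sup>+t. indicator {t. 0 < Im t} t * F t \<partial>lborel) =
    (\<integral>\<^sup>+q. indicator (ball 0 1) q * ennreal (4 * (Im Z)\<^sup>2 / cmod (1 - q) ^ 4) * F (cayley Z q) \<partial>lborel)"
proof -
  have "(\<integral>\<^sup>+t. indicator {t. 0 < Im t} t * F t \<partial>lborel) =
    (\<integral>\<^sup>+q. indicator (ball 0 1) q * ennreal ((cmod ((Z - cnj Z) / (1 - q)\<^sup>2))\<^sup>2) * F (cayley Z q) \<partial>lborel)"
    unfolding cayley_image[OF assms(1), symmetric]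
    by (rule nn_integral_holomorphic_substitution)
       (use assms in \<open>auto simp: cayley_image open_halfspace_Im_gt intro!: cayley_inj cayley_deriv\<close>)
  moreover have "(cmod ((Z - cnj Z) / (1 - q)\<^sup>2))\<^sup>2 = 4 * (Im Z)\<^sup>2 / cmod (1 - q) ^ 4" for q
    by (simp add: norm_divide norm_power power_divide complex_diff_cnj norm_mult power_mult_distrib flip: power_mult)
  ultimately show ?thesis by simp
qed


text \<open>The constant sqrt(2 rho(z)) makes the two contributions to rho combine. The Cayley
  transform gives rho(z) (1 - |q_n|^2) / |1 - q_n|^2, the scaled coordinates subtract rho(z) |q'|^2
  / |1 - q_n|^2, and positivity of the difference means |q| < 1.\<close>

definition ball_to_tube :: "(complex, 'n::{finite,linorder}) vec \<Rightarrow> (complex, 'n::{finite,linorder}) vec \<Rightarrow> (complex, 'n::{finite,linorder}) vec" where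
  "ball_to_tube z q = heis z (vec_upd
     (scale_coords rest (of_real (sqrt (2 * tube_rho z)) / (1 - q $ last_index)) q)
     last_index (cayley (base_pt z) (q $ last_index)))"

lemma norm_sq_split:
  "(norm q)\<^sup>2 = (cmod (q $ last_index))\<^sup>2 + (\<Sum>k\<in>rest. (cmod (q $ k))\<^sup>2)"
  for q :: "(complex, 'n::{finite,linorder}) vec"
proof -
  have "(norm q)\<^sup>2 = (\<Sum>k\<in>UNIV. (cmod (q $ k))\<^sup>2)"
    by (simp add: norm_vec_def L2_set_def sum_nonneg)
  then show ?thesis by (simp add: sum.remove[of UNIV last_index])
qed

lemma last_lt_1:
  assumes "norm q < 1"
  shows "cmod (q $ last_index) < 1" "1 - q $ last_index \<noteq> 0" "q $ last_index \<noteq> 1"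
proof -
  show "cmod (q $ last_index) < 1" using assms Finite_Cartesian_Product.norm_nth_le[of q last_index] by simp
  then show "1 - q $ last_index \<noteq> 0" "q $ last_index \<noteq> 1" by auto
qed

lemma tube_rho_ball_to_tube:
  assumes "q $ last_index \<noteq> 1" "tube_rho z \<ge> 0"
  shows "tube_rho (ball_to_tube z q) = tube_rho z * (1 - (norm q)\<^sup>2) / (cmod (1 - q $ last_index))\<^sup>2"
proof -
  have "(\<Sum>k\<in>rest. (cmod (vec_upd
     (scale_coords rest (of_real (sqrt (2 * tube_rho z)) / (1 - q $ last_index)) q)
     last_index (cayley (base_pt z) (q $ last_index)) $ k))\<^sup>2)
    = (\<Sum>k\<in>rest. 2 * tube_rho z / (cmod (1 - q $ last_index))\<^sup>2 * (cmod (q $ k))\<^sup>2)"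
    by (rule sum.cong) (use assms in \<open>auto simp: norm_mult norm_divide power_mult_distrib power_divide\<close>)
  also have "\<dots> = 2 * tube_rho z / (cmod (1 - q $ last_index))\<^sup>2 * (\<Sum>k\<in>rest. (cmod (q $ k))\<^sup>2)"
    by (simp only: sum_distrib_left)
  finally have S: "(\<Sum>k\<in>rest. (cmod (vec_upd
     (scale_coords rest (of_real (sqrt (2 * tube_rho z)) / (1 - q $ last_index)) q)
     last_index (cayley (base_pt z) (q $ last_index)) $ k))\<^sup>2) = \<dots>" .
  show ?thesis
    unfolding ball_to_tube_def tube_rho_heis norm_sq_split S
    using assms by (simp add: Im_cayley Im_base_pt) (simp add: diff_divide_distrib add_divide_distrib algebra_simps)
qed

lemma tube_rho2_ball_to_tube:
  assumes "q $ last_index \<noteq> 1"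
  shows "tube_rho2 z (ball_to_tube z q) = of_real (tube_rho z) / cnj (1 - q $ last_index)"
proof -
  have "base_pt z - cnj (base_pt z) = 2 * \<i> * of_real (tube_rho z)"
    by (simp add: complex_eq_iff flip: Im_base_pt)
  moreover have "base_pt z - cnj (cayley (base_pt z) (q $ last_index))
     = (base_pt z - cnj (base_pt z)) / cnj (1 - q $ last_index)"
  proof -
    have "cnj (1 - q $ last_index) \<noteq> 0" using assms by (metis complex_cnj_zero_iff right_minus_eq)
    then show ?thesis by (simp add: cayley_def divide_simps) (simp add: algebra_simps)
  qed
  ultimately have "tube_rho2 z (ball_to_tube z q) = 2 * \<i> * of_real (tube_rho z) / cnj (1 - q $ last_index) / (2 * \<i>)"
    unfolding ball_to_tube_def tube_rho2_heis by (simp only: vec_upd_nth simp_thms if_True)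
  moreover have "2 * \<i> * r / D / (2 * \<i>) = r / D" for r D :: complex
    by simp
  ultimately show ?thesis by (simp only:)
qed

lemma ball_to_tube_0: "ball_to_tube z 0 = z"
  by (simp add: vec_eq_iff ball_to_tube_def heis_def cayley_def base_pt_def)

lemma measurable_ball_to_tube [measurable]: "ball_to_tube z \<in> borel \<rightarrow>\<^sub>M borel"
  unfolding ball_to_tube_def[abs_def] by measurable

lemma sets_tube_domain [measurable]: "(tube_domain :: (complex, 'n::{finite,linorder}) vec set) \<in> sets borel"
proof -
  have "open (tube_domain :: (complex, 'n::{finite,linorder}) vec set)"
    unfolding tube_domain_def by (intro open_Collect_less continuous_intros)
  then show ?thesis by simp
qed

text \<open>With x = 2 rho(z) / |1 - q_n|^2, the Cayley transform contributes x^2 to the Jacobian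
  and the n - 1 scaled coordinates contribute x^(n-1). The last coordinate is substituted first,
  because the scaling factor depends on the new variable q_n.\<close>

lemma nn_integral_ball_to_tube:
  fixes z :: "(complex, 'n::{finite,linorder}) vec"
  assumes z: "z \<in> tube_domain" and F [measurable]: "F \<in> borel_measurable borel"
  shows "(\<integral>\<^sup>+w. indicator tube_domain w * F w \<partial>lborel) =
    (\<integral>\<^sup>+q. indicator (ball 0 1) q * ennreal ((2 * tube_rho z / (cmod (1 - q $ last_index))\<^sup>2) ^ (CARD('n) + 1))
       * F (ball_to_tube z q) \<partial>lborel)"
proof -
  let ?l = "last_index :: 'n" and ?T = "tube_domain :: (complex, 'n) vec set"
  define s where "s = tube_rho z"
  define Z where "Z = base_pt z"
  have s: "s > 0" and ImZ: "Im Z = s" using z by (auto simp: s_def Z_def tube_domain_iff Im_base_pt)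
  define G where "G v = indicator ?T (heis z v) * F (heis z v)" for v
  have Gm [measurable]: "G \<in> borel_measurable borel"
    unfolding G_def[abs_def] by measurable
  \<comment> \<open>The Cayley transform covers the half plane Im v_n > 0. The domain lies over it,
    so \<open>G\<close> vanishes elsewhere.\<close>
  have G0: "G v = indicator {t. 0 < Im t} (v $ ?l) * G v" for v
  proof (cases "0 < Im (v $ ?l)")
    case False
    moreover have "0 \<le> (\<Sum>k\<in>rest. (cmod (v $ k))\<^sup>2)" by (intro sum_nonneg) auto
    ultimately have "\<not> tube_rho (heis z v) > 0" by (simp add: tube_rho_heis)
    then show ?thesis by (simp add: G_def tube_domain_iff)
  qed simp
  define W where "W q = indicator (ball 0 1) (q $ ?l) * ennreal (4 * s\<^sup>2 / cmod (1 - q $ ?l) ^ 4)" for q :: "(complex, 'n) vec"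
  have Wm [measurable]: "W \<in> borel_measurable borel" unfolding W_def[abs_def] by measurable
  define c where "c q = of_real (sqrt (2 * s)) / (1 - q $ ?l)" for q :: "(complex, 'n) vec"
  have cm [measurable]: "c \<in> borel_measurable borel" unfolding c_def[abs_def] by measurable
  define H where "H q = G (vec_upd q ?l (cayley Z (q $ ?l)))" for q
  have Hm [measurable]: "H \<in> borel_measurable borel" unfolding H_def[abs_def] by measurable
  have "(\<integral>\<^sup>+w. indicator ?T w * F w \<partial>lborel) = (\<integral>\<^sup>+v. G v \<partial>lborel)"
    unfolding G_def by (rule nn_integral_heis[of "\<lambda>w. indicator ?T w * F w" z, symmetric]) measurable
  also have "\<dots> = (\<integral>\<^sup>+q. W q * H q \<partial>lborel)"
  proof (rule nn_integral_fibre_eq[where k = ?l])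
    fix v
    have "(\<integral>\<^sup>+t. G (vec_upd v ?l t) \<partial>lborel) = (\<integral>\<^sup>+t. indicator {t. 0 < Im t} t * G (vec_upd v ?l t) \<partial>lborel)"
      by (subst G0) simp
    also have "\<dots> = (\<integral>\<^sup>+q. indicator (ball 0 1) q * ennreal (4 * (Im Z)\<^sup>2 / cmod (1 - q) ^ 4) * G (vec_upd v ?l (cayley Z q)) \<partial>lborel)"
      by (rule nn_integral_cayley[of Z "\<lambda>t. G (vec_upd v ?l t)"]) (use s ImZ in simp, measurable)
    finally show "(\<integral>\<^sup>+t. G (vec_upd v ?l t) \<partial>lborel) = (\<integral>\<^sup>+t. W (vec_upd v ?l t) * H (vec_upd v ?l t) \<partial>lborel)"
      by (simp add: W_def H_def ImZ)
  qed measurable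
  also have "\<dots> = (\<integral>\<^sup>+q. W q * ennreal (cmod (c q) ^ (2 * card (rest :: 'n set))) * H (scale_coords rest (c q) q) \<partial>lborel)"
  proof (rule nn_integral_scale_coords[OF Hm Wm cm, symmetric])
    show "c v \<noteq> 0" if "W v \<noteq> 0" for v
    proof -
      from that have "cmod (v $ ?l) < 1" by (auto simp: W_def split: split_indicator_asm)
      then have "1 - v $ ?l \<noteq> 0" by auto
      then show ?thesis using s by (simp add: c_def)
    qed
  qed (auto simp: c_def W_def)
  also have "\<dots> = (\<integral>\<^sup>+q. indicator (ball 0 1) q * ennreal ((2 * s / (cmod (1 - q $ ?l))\<^sup>2) ^ (CARD('n) + 1))
       * F (ball_to_tube z q) \<partial>lborel)"
  proof (rule nn_integral_cong)
    fix q :: "(complex, 'n) vec"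
    have eq: "H (scale_coords rest (c q) q) = indicator ?T (ball_to_tube z q) * F (ball_to_tube z q)"
      by (simp add: H_def G_def ball_to_tube_def c_def s_def Z_def)
    show "W q * ennreal (cmod (c q) ^ (2 * card (rest :: 'n set))) * H (scale_coords rest (c q) q)
       = indicator (ball 0 1) q * ennreal ((2 * s / (cmod (1 - q $ ?l))\<^sup>2) ^ (CARD('n) + 1)) * F (ball_to_tube z q)"
    proof (cases "cmod (q $ ?l) < 1")
      case False
      then have "q \<notin> ball 0 1" using last_lt_1(1)[of q] by auto
      then show ?thesis using False by (simp add: W_def)
    next
      case True
      then have ne: "1 - q $ ?l \<noteq> 0" "q $ ?l \<noteq> 1" by auto
      \<comment> \<open>The Cayley substitution leaves the set |q_n| < 1, inside which the indicator
        of the domain cuts out the ball.\<close>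
      have "ball_to_tube z q \<in> ?T \<longleftrightarrow> q \<in> ball 0 1"
        using ne s by (simp add: tube_domain_iff tube_rho_ball_to_tube s_def[symmetric] zero_less_mult_iff
            zero_less_divide_iff abs_square_less_1)
      then have ind: "indicator ?T (ball_to_tube z q) = (indicator (ball 0 1) q :: ennreal)"
        by (simp add: indicator_def)
      define x where "x = 2 * s / (cmod (1 - q $ ?l))\<^sup>2"
      have A: "4 * s\<^sup>2 / cmod (1 - q $ ?l) ^ 4 = x ^ 2"
        by (simp add: x_def power_divide power_mult_distrib flip: power_mult)
      have B: "cmod (c q) ^ (2 * card (rest :: 'n set)) = x ^ (CARD('n) - 1)"
        using s by (simp add: c_def x_def norm_divide power_mult power_divide)
      have C: "x ^ (CARD('n) + 1) = x ^ 2 * x ^ (CARD('n) - 1)"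
        unfolding power_add[symmetric] by (rule arg_cong[where f = "\<lambda>m. x ^ m"]) (use zero_less_card_finite[where 'a='n] in simp)
      have "x \<ge> 0" using s by (simp add: x_def)
      then show ?thesis
        unfolding W_def eq ind A B C x_def[symmetric] using True by (simp add: ennreal_mult' mult_ac)
    qed
  qed
  finally show ?thesis by (simp add: s_def)
qed

section \<open>The reproducing formula\<close>

text \<open>
  Continuity together with holomorphy along all holomorphic curves. Unlike total complex
  differentiability, this is easily seen to pass to the derivative in \<open>z_n\<close>, as a locally uniform
  limit of difference quotients.
\<close>

definition holo_tube :: "((complex, 'n::{finite,linorder}) vec \<Rightarrow> complex) \<Rightarrow> bool" where
  "holo_tube f \<longleftrightarrow> continuous_on tube_domain f \<and>
     (\<forall>U \<gamma>. open U \<longrightarrow> (\<forall>j. (\<lambda>t. \<gamma> t $ j) holomorphic_on U) \<longrightarrow> \<gamma> ` U \<subseteq> tube_domain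
        \<longrightarrow> (\<lambda>t. f (\<gamma> t)) holomorphic_on U)"

lemma open_tube_domain: "open (tube_domain :: (complex, 'n::{finite,linorder}) vec set)"
  unfolding tube_domain_def by (intro open_Collect_less continuous_intros)

lemma holo_tube_comp:
  assumes "holo_tube f" "open U" "\<And>j. (\<lambda>t. \<gamma> t $ j) holomorphic_on U" "\<And>t. t \<in> U \<Longrightarrow> \<gamma> t \<in> tube_domain"
  shows "(\<lambda>t. f (\<gamma> t)) holomorphic_on U"
  using assms unfolding holo_tube_def by blast

lemma has_derivative_vec_components:
  fixes \<gamma> :: "complex \<Rightarrow> (complex, 'n::finite) vec"
  assumes "\<And>j. ((\<lambda>t. \<gamma> t $ j) has_field_derivative d $ j) (at t)"
  shows "(\<gamma> has_derivative (\<lambda>h. h *s d)) (at t)"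
proof (subst has_derivative_componentwise_within, rule ballI)
  fix b :: "(complex, 'n) vec" assume "b \<in> Basis"
  then obtain j u where b: "b = axis j u" by (auto simp: Basis_vec_def)
  have "((\<lambda>t. \<gamma> t $ j \<bullet> u) has_derivative (\<lambda>h. (d $ j * h) \<bullet> u)) (at t)"
    using assms[of j] unfolding has_field_derivative_def by (rule has_derivative_inner_left)
  then show "((\<lambda>x. \<gamma> x \<bullet> b) has_derivative (\<lambda>x. (x *s d) \<bullet> b)) (at t)"
    by (simp add: b inner_axis mult.commute)
qed

text \<open>Chain rule. Complex linearity of \<open>D\<close> turns the real derivative of the
  composite into multiplication by a complex number.\<close>

lemma holo_tubeI:
  fixes f :: "(complex, 'n::{finite,linorder}) vec \<Rightarrow> complex"
  assumes "holomorphic_vec_on f tube_domain"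
  shows "holo_tube f"
  unfolding holo_tube_def
proof (intro conjI allI impI)
  show "continuous_on tube_domain f"
    using assms unfolding holomorphic_vec_on_def continuous_on_eq_continuous_within
    by (meson has_derivative_continuous)
next
  fix U and \<gamma> :: "complex \<Rightarrow> (complex, 'n) vec"
  assume U: "open U" and \<gamma>: "\<forall>j. (\<lambda>t. \<gamma> t $ j) holomorphic_on U" "\<gamma> ` U \<subseteq> tube_domain"
  show "(\<lambda>t. f (\<gamma> t)) holomorphic_on U"
    unfolding holomorphic_on_open[OF U]
  proof
    fix t assume t: "t \<in> U"
    define d where "d = (\<chi> j. deriv (\<lambda>t. \<gamma> t $ j) t)"
    have d: "(\<gamma> has_derivative (\<lambda>h. h *s d)) (at t)"
      by (rule has_derivative_vec_components)
        (use \<gamma> t U in \<open>auto simp: d_def intro: holomorphic_derivI\<close>)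
    from \<gamma> t have T: "\<gamma> t \<in> tube_domain" by auto
    with assms obtain D where "(f has_derivative D) (at (\<gamma> t) within tube_domain)"
      and D2: "\<And>c v. D (c *s v) = c * D v"
      unfolding holomorphic_vec_on_def by blast
    then have D: "(f has_derivative D) (at (\<gamma> t))"
      by (simp add: at_within_open[OF T open_tube_domain])
    have "((\<lambda>t. f (\<gamma> t)) has_derivative (\<lambda>h. D (h *s d))) (at t)"
      by (rule has_derivative_compose[OF d D])
    moreover have "(\<lambda>h. D (h *s d)) = (*) (D d)"
      by (simp add: D2 fun_eq_iff mult.commute)
    ultimately have "((\<lambda>t. f (\<gamma> t)) has_field_derivative D d) (at t)"
      unfolding has_field_derivative_def by simp
    then show "\<exists>f'. ((\<lambda>t. f (\<gamma> t)) has_field_derivative f') (at t)" ..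
  qed
qed

text \<open>The real part is the mean of rho(z) and rho(w) plus a nonnegative sum. This keeps the
  principal power away from its cut and bounds both rho(z) and rho(w) by 2 |rho(z, w)|.\<close>

lemma Re_tube_rho2:
  "Re (tube_rho2 z w) = (tube_rho z + tube_rho w) / 2 + (\<Sum>k\<in>rest. (cmod (z $ k - w $ k))\<^sup>2) / 4"
proof -
  have eq: "Re ((z $ k - cnj (w $ k))\<^sup>2) = (cmod (z $ k - w $ k))\<^sup>2 - 2 * (Im (z $ k))\<^sup>2 - 2 * (Im (w $ k))\<^sup>2" for k
    unfolding cmod_sq by (simp add: power2_eq_square algebra_simps)
  show ?thesis
    by (simp add: tube_rho2_def tube_rho_def eq sum_subtractf sum.distrib Re_sum sum_distrib_left[symmetric] field_simps)
qed

lemma tube_rho2_bounds: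
  assumes "z \<in> tube_domain" "w \<in> tube_domain"
  shows "Re (tube_rho2 z w) > 0" "cmod (tube_rho2 z w) > 0" "tube_rho2 z w \<noteq> 0"
    "tube_rho z \<le> 2 * cmod (tube_rho2 z w)" "tube_rho w \<le> 2 * cmod (tube_rho2 z w)"
    "tube_rho z > 0" "tube_rho w > 0"
proof -
  show p: "tube_rho z > 0" "tube_rho w > 0" using assms by (auto simp: tube_domain_iff)
  have s: "0 \<le> (\<Sum>k\<in>rest. (cmod (z $ k - w $ k))\<^sup>2)" by (intro sum_nonneg) auto
  define R where "R = Re (tube_rho2 z w)"
  define C where "C = cmod (tube_rho2 z w)"
  have F: "(tube_rho z + tube_rho w) / 2 \<le> R" unfolding R_def Re_tube_rho2 using s by simp
  have "R \<le> C" unfolding R_def C_def by (rule complex_Re_le_cmod)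
  with F p have "R > 0" "C > 0" "tube_rho z \<le> 2 * C" "tube_rho w \<le> 2 * C" by auto
  then show "Re (tube_rho2 z w) > 0" "cmod (tube_rho2 z w) > 0"
    "tube_rho z \<le> 2 * cmod (tube_rho2 z w)" "tube_rho w \<le> 2 * cmod (tube_rho2 z w)"
    unfolding R_def C_def by auto
  then show "tube_rho2 z w \<noteq> 0" by auto
qed

section \<open>Absolutely convergent kernel integrals with two exponents\<close>

lemma continuous_on_tube_rho: "continuous_on S tube_rho"
  unfolding tube_rho_def[abs_def] by (intro continuous_intros)

lemma continuous_on_tube_rho2: "continuous_on S (\<lambda>w. tube_rho2 z w)"
  unfolding tube_rho2_def[abs_def] by (intro continuous_intros)

lemma borel_measurable_tube_rho [measurable]: "tube_rho \<in> borel_measurable borel"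
  by (intro borel_measurable_continuous_onI continuous_on_tube_rho)

lemma borel_measurable_tube_rho2 [measurable]: "tube_rho2 z \<in> borel_measurable borel"
  by (intro borel_measurable_continuous_onI continuous_on_tube_rho2)

text \<open>The condition is imposed at every \<open>z\<close>, since the induction evaluates the
  integrals along a whole ray. The exponents are independent because differentiation of
  \<open>f\<close> raises only \<open>s\<close>.\<close>

definition tube_finite :: "real \<Rightarrow> real \<Rightarrow> ((complex, 'n::{finite,linorder}) vec \<Rightarrow> complex) \<Rightarrow> bool" where
  "tube_finite s m f \<longleftrightarrow> (\<forall>z\<in>tube_domain.
     (\<integral>\<^sup>+w. indicator tube_domain w * ennreal (tube_rho w powr s / cmod (tube_rho2 z w) powr m * cmod (f w)) \<partial>lborel) < \<infinity>)"

text \<open>T_alpha applied to rho^N g has the exponents s = alpha + N and m = n + 1 +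
  alpha.\<close>

definition tube_kernel :: "real \<Rightarrow> real \<Rightarrow> ((complex, 'n::{finite,linorder}) vec \<Rightarrow> complex) \<Rightarrow> (complex, 'n::{finite,linorder}) vec \<Rightarrow> (complex, 'n::{finite,linorder}) vec \<Rightarrow> complex" where
  "tube_kernel s m f z w = of_real (tube_rho w powr s) / (tube_rho2 z w powr of_real m) * f w"

definition tube_int :: "real \<Rightarrow> real \<Rightarrow> ((complex, 'n::{finite,linorder}) vec \<Rightarrow> complex) \<Rightarrow> (complex, 'n::{finite,linorder}) vec \<Rightarrow> complex" where
  "tube_int s m f z = (LINT w:tube_domain|lborel. tube_kernel s m f z w)"

lemma norm_tube_kernel:
  "norm (tube_kernel s m f z w) = tube_rho w powr s / cmod (tube_rho2 z w) powr m * cmod (f w)"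
  by (simp add: tube_kernel_def norm_mult norm_divide norm_powr_real_powr')

lemma continuous_on_tube_kernel:
  assumes "continuous_on tube_domain f" "z \<in> tube_domain"
  shows "continuous_on tube_domain (tube_kernel s m f z)"
proof -
  have nn: "tube_rho2 z w \<notin> \<real>\<^sub>\<le>\<^sub>0" "tube_rho2 z w \<noteq> 0" "tube_rho w \<noteq> 0" if "w \<in> tube_domain" for w
    using tube_rho2_bounds[OF assms(2) that] by (auto simp: complex_nonpos_Reals_iff)
  show ?thesis
    unfolding tube_kernel_def[abs_def]
    by (intro continuous_intros continuous_on_tube_rho continuous_on_tube_rho2 assms)
       (use nn less_imp_le[OF tube_rho2_bounds(1)[OF assms(2)]] in auto)
qed

lemma borel_measurable_tube_kernel:
  assumes "continuous_on tube_domain f" "z \<in> tube_domain"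
  shows "(\<lambda>w. indicator tube_domain w *\<^sub>R tube_kernel s m f z w) \<in> borel_measurable borel"
  by (intro borel_measurable_continuous_on_indicator continuous_on_tube_kernel assms) simp

lemma tube_kernel_integrable:
  assumes f: "continuous_on tube_domain f" "tube_finite s m f" and z: "z \<in> tube_domain"
  shows "set_integrable lborel tube_domain (tube_kernel s m f z)"
  unfolding set_integrable_def
proof (rule integrableI_bounded)
  show "(\<lambda>w. indicator tube_domain w *\<^sub>R tube_kernel s m f z w) \<in> borel_measurable lborel"
    using borel_measurable_tube_kernel[OF f(1) z] by simp
  have "(\<integral>\<^sup>+ w. ennreal (norm (indicator tube_domain w *\<^sub>R tube_kernel s m f z w)) \<partial>lborel)
    = (\<integral>\<^sup>+w. indicator tube_domain w * ennreal (tube_rho w powr s / cmod (tube_rho2 z w) powr m * cmod (f w)) \<partial>lborel)"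
    by (intro nn_integral_cong) (auto simp: norm_tube_kernel split: split_indicator)
  also have "\<dots> < \<infinity>" using f(2) z unfolding tube_finite_def by blast
  finally show "(\<integral>\<^sup>+ w. ennreal (norm (indicator tube_domain w *\<^sub>R tube_kernel s m f z w)) \<partial>lborel) < \<infinity>" .
qed

text \<open>By the formula for nonnegative functions, the measure \<open>\<mu>\<close> on the domain
  is the image of \<open>\<nu>\<close> under the ball map, so integrability and value of complex
  integrals transfer together. It is the extension \<open>g'\<close> of \<open>g\<close> by 0 that
  is known to be measurable.\<close>

lemma integral_ball_to_tube:
  fixes z :: "(complex, 'n::{finite,linorder}) vec" and g :: "(complex, 'n::{finite,linorder}) vec \<Rightarrow> complex"
  assumes z: "z \<in> tube_domain" and g: "set_integrable lborel tube_domain g"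
  defines "J \<equiv> \<lambda>q. (2 * tube_rho z / (cmod (1 - q $ last_index))\<^sup>2) ^ (CARD('n) + 1)"
  shows "set_integrable lborel (ball 0 1) (\<lambda>q. J q *\<^sub>R g (ball_to_tube z q))"
    and "(LINT w:tube_domain|lborel. g w) = (LINT q:ball 0 1|lborel. J q *\<^sub>R g (ball_to_tube z q))"
proof -
  let ?T = "tube_domain :: (complex, 'n) vec set"
  have [measurable]: "J \<in> borel_measurable borel" unfolding J_def by measurable
  have J: "J q \<ge> 0" for q using z by (simp add: J_def tube_domain_iff)
  define g' where "g' w = indicator ?T w *\<^sub>R g w" for w
  have g': "integrable lborel g'" using g by (simp add: g'_def[abs_def] set_integrable_def)
  have [measurable]: "g' \<in> borel_measurable borel"
    using borel_measurable_integrable[OF g'] by simp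
  define \<mu> where "\<mu> = density lborel (\<lambda>w. ennreal (indicator ?T w))"
  define \<nu> where "\<nu> = density lborel (\<lambda>q. ennreal (indicator (ball 0 1) q * J q))"
  have m\<nu>: "ball_to_tube z \<in> \<nu> \<rightarrow>\<^sub>M borel" by (simp add: \<nu>_def)
  have mu_nu: "\<mu> = distr \<nu> borel (ball_to_tube z)"
  proof (rule measure_eqI)
    fix X assume "X \<in> sets \<mu>"
    then have [measurable]: "X \<in> sets borel" by (simp add: \<mu>_def)
    have "emeasure \<mu> X = (\<integral>\<^sup>+w. indicator ?T w * indicator X w \<partial>lborel)"
      unfolding \<mu>_def by (subst emeasure_density) (auto simp: ennreal_indicator)
    also have "\<dots> = (\<integral>\<^sup>+q. indicator (ball 0 1) q * ennreal (J q) * indicator X (ball_to_tube z q) \<partial>lborel)"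
      unfolding J_def by (rule nn_integral_ball_to_tube[OF z]) simp
    also have "\<dots> = (\<integral>\<^sup>+q. indicator X (ball_to_tube z q) \<partial>\<nu>)"
      unfolding \<nu>_def by (subst nn_integral_density) (auto simp: ennreal_mult' ennreal_indicator)
    also have "\<dots> = (\<integral>\<^sup>+w. indicator X w \<partial>distr \<nu> borel (ball_to_tube z))"
      by (rule nn_integral_distr[OF m\<nu>, symmetric]) simp
    also have "\<dots> = emeasure (distr \<nu> borel (ball_to_tube z)) X"
      by (rule nn_integral_indicator) simp
    finally show "emeasure \<mu> X = emeasure (distr \<nu> borel (ball_to_tube z)) X" .
  qed (simp add: \<mu>_def)
  have iT: "indicator ?T w *\<^sub>R g' w = g' w" for w by (simp add: g'_def indicator_def)
  have "integrable \<mu> g'"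
    unfolding \<mu>_def by (subst integrable_density) (auto simp: iT g')
  then have "integrable \<nu> (\<lambda>q. g' (ball_to_tube z q))"
    unfolding mu_nu by (subst (asm) integrable_distr_eq[OF m\<nu>]) auto
  then have 1: "integrable lborel (\<lambda>q. (indicator (ball 0 1) q * J q) *\<^sub>R g' (ball_to_tube z q))"
    unfolding \<nu>_def by (subst (asm) integrable_density) (auto simp: J)
  have "(LINT w:?T|lborel. g w) = integral\<^sup>L \<mu> g'"
    unfolding \<mu>_def by (subst integral_density) (simp_all add: iT set_lebesgue_integral_def flip: g'_def)
  also have "\<dots> = (\<integral>q. g' (ball_to_tube z q) \<partial>\<nu>)"
    unfolding mu_nu by (rule integral_distr[OF m\<nu>]) simp
  also have "\<dots> = (\<integral>q. (indicator (ball 0 1) q * J q) *\<^sub>R g' (ball_to_tube z q) \<partial>lborel)"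
    unfolding \<nu>_def by (subst integral_density) (auto simp: J)
  finally have 2: "(LINT w:?T|lborel. g w) = (\<integral>q. (indicator (ball 0 1) q * J q) *\<^sub>R g' (ball_to_tube z q) \<partial>lborel)" .
  have 3: "(indicator (ball 0 1) q * J q) *\<^sub>R g' (ball_to_tube z q) = indicator (ball 0 1) q *\<^sub>R J q *\<^sub>R g (ball_to_tube z q)" for q
  proof (cases "norm q < 1")
    case True
    then have "(norm q)\<^sup>2 < 1" by (simp add: abs_square_less_1)
    then have "ball_to_tube z q \<in> ?T"
      using z last_lt_1[OF True] by (simp add: tube_domain_iff tube_rho_ball_to_tube)
    then show ?thesis by (simp add: g'_def)
  qed simp
  from 1 2 show "set_integrable lborel (ball 0 1) (\<lambda>q. J q *\<^sub>R g (ball_to_tube z q))"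
    "(LINT w:?T|lborel. g w) = (LINT q:ball 0 1|lborel. J q *\<^sub>R g (ball_to_tube z q))"
    unfolding 3 set_integrable_def set_lebesgue_integral_def by auto
qed

lemma ball_to_tube_in:
  assumes "z \<in> tube_domain" "norm q < 1"
  shows "ball_to_tube z q \<in> tube_domain"
proof -
  have "(norm q)\<^sup>2 < 1" using assms by (simp add: abs_square_less_1)
  then show ?thesis
    using assms last_lt_1[of q] by (simp add: tube_domain_iff tube_rho_ball_to_tube)
qed

text \<open>The quotient is the positive multiple r/|u|^2 of \<open>u\<close>, so the principal
  power splits. This turns the antiholomorphic kernel of the ball model into a holomorphic function
  times powers of moduli.\<close>

lemma powr_div_cnj:
  assumes "r > 0" "Re u > 0"
  shows "(of_real r / cnj u) powr of_real m = of_real (r powr m / cmod u powr (2 * m)) * u powr of_real m"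
proof -
  have u: "u \<noteq> 0" using assms by auto
  then have "cmod u > 0" by simp
  have "of_real r / cnj u = of_real (r / (cmod u)\<^sup>2) * u"
    using u by (simp add: complex_norm_square divide_simps del: of_real_power)
  also have "\<dots> powr of_real m = of_real (r / (cmod u)\<^sup>2) powr of_real m * u powr of_real m"
    by (rule powr_times_real_left) (use assms u in auto)
  also have "of_real (r / (cmod u)\<^sup>2) powr of_real m = complex_of_real ((r / (cmod u)\<^sup>2) powr m)"
    by (rule powr_of_real) (use assms in auto)
  also have "(r / (cmod u)\<^sup>2) powr m = r powr m / cmod u powr (2 * m)"
    using assms \<open>cmod u > 0\<close> by (simp add: powr_divide powr_powr flip: powr_numeral)
  finally show ?thesis .
qed

text \<open>The exponent n + 1 + a makes the moduli cancel: the Jacobian contributes |1 -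
  q_n|^(-2(n+1)), the weight |1 - q_n|^(-2a), and the kernel the opposite power through
  \<open>powr_div_cnj\<close>. The powers of rho(z) cancel in the same way, and a radial weight
  times a holomorphic function remains.\<close>

lemma reproducing_formula:
  fixes z :: "(complex, 'n::{finite,linorder}) vec"
  assumes f: "holo_tube f" "tube_finite a (real CARD('n) + 1 + a) f" and a: "a > -1" and z: "z \<in> tube_domain"
  shows "tube_int a (real CARD('n) + 1 + a) f z
    = of_real (2 ^ (CARD('n) + 1) * pi ^ CARD('n) * Gamma (a + 1) / Gamma (real CARD('n) + 1 + a)) * f z"
proof -
  let ?n = "CARD('n)" and ?l = "last_index :: 'n"
  define m where "m = real ?n + 1 + a"
  define s where "s = tube_rho z"
  have s: "s > 0" using z by (simp add: s_def tube_domain_iff)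
  have cont: "continuous_on tube_domain f" using f(1) by (simp add: holo_tube_def)
  define J where "J q = (2 * s / (cmod (1 - q $ ?l))\<^sup>2) ^ (?n + 1)" for q :: "(complex, 'n) vec"
  define E where "E q = 2 ^ (?n + 1) * f (ball_to_tube z q) / (1 - q $ ?l) powr of_real m" for q
  define w where "w r = (1 - r\<^sup>2) powr a" for r :: real
  have int: "set_integrable lborel tube_domain (tube_kernel a m f z)"
    using tube_kernel_integrable[OF cont f(2) z] by (simp add: m_def)
  note I = integral_ball_to_tube[OF z int, folded s_def, folded J_def]
  have eq: "indicator (ball 0 1) q *\<^sub>R J q *\<^sub>R tube_kernel a m f z (ball_to_tube z q)
      = indicator (ball 0 1) q *\<^sub>R (of_real (w (norm q)) * E q)" for q
  proof (cases "norm q < 1")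
    case True
    define u where "u = 1 - q $ ?l"
    define d where "d = cmod u"
    have q2: "(norm q)\<^sup>2 < 1" using True by (simp add: abs_square_less_1)
    have "Re (q $ ?l) < 1" using complex_Re_le_cmod[of "q $ ?l"] last_lt_1(1)[OF True] by simp
    then have u: "Re u > 0" by (simp add: u_def)
    then have d: "d > 0" by (auto simp: d_def)
    have rho: "tube_rho (ball_to_tube z q) = s * (1 - (norm q)\<^sup>2) / d\<^sup>2"
      using tube_rho_ball_to_tube[of q z] last_lt_1[OF True] s by (simp add: s_def d_def u_def)
    have rho_a: "tube_rho (ball_to_tube z q) powr a = s powr a * w (norm q) / d powr (2 * a)"
      unfolding rho w_def using s d q2 by (simp add: powr_divide powr_mult powr_powr flip: powr_numeral)
    have k: "tube_rho2 z (ball_to_tube z q) powr of_real m = of_real (s powr m / d powr (2 * m)) * u powr of_real m"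
      using tube_rho2_ball_to_tube[of q z] last_lt_1[OF True] powr_div_cnj[OF s u, of m]
      by (simp add: s_def u_def d_def)
    have Jd: "J q = 2 ^ (?n + 1) * s powr (real ?n + 1) / d powr (2 * (real ?n + 1))"
    proof -
      have "s powr (real ?n + 1) = s ^ (?n + 1)" using powr_realpow[OF s, of "?n + 1"] by (simp add: add.commute)
      moreover have "d powr (2 * (real ?n + 1)) = (d\<^sup>2) ^ (?n + 1)"
      proof -
        have "d powr (2 * (real ?n + 1)) = (d\<^sup>2) powr real (?n + 1)"
          using d by (simp add: powr_powr add.commute flip: powr_numeral)
        also have "\<dots> = (d\<^sup>2) ^ (?n + 1)" by (rule powr_realpow) (use d in simp)
        finally show ?thesis .
      qed
      ultimately show ?thesis
        by (simp only: J_def u_def[symmetric] d_def[symmetric] power_divide power_mult_distrib)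
    qed
    have "J q * (s powr a * w (norm q) / d powr (2 * a)) / (s powr m / d powr (2 * m)) = 2 ^ (?n + 1) * w (norm q)"
    proof -
      have "s powr m = s powr (real ?n + 1) * s powr a"
        by (simp add: m_def powr_add[symmetric])
      moreover have "d powr (2 * m) = d powr (2 * (real ?n + 1)) * d powr (2 * a)"
        by (simp add: m_def powr_add[symmetric] algebra_simps)
      ultimately show ?thesis unfolding Jd using s d by (simp add: field_simps)
    qed
    then have R: "of_real (J q) * (of_real (s powr a * w (norm q) / d powr (2 * a)) / of_real (s powr m / d powr (2 * m)))
       = (2 ^ (?n + 1) * of_real (w (norm q)) :: complex)"
      by (metis (no_types, lifting) of_real_divide of_real_mult of_real_numeral of_real_power times_divide_eq_right)
    have "J q *\<^sub>R tube_kernel a m f z (ball_to_tube z q)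
      = of_real (J q) * (of_real (s powr a * w (norm q) / d powr (2 * a)) / of_real (s powr m / d powr (2 * m)))
          * (f (ball_to_tube z q) / u powr of_real m)"
      unfolding tube_kernel_def rho_a k scaleR_conv_of_real by (simp add: divide_inverse mult_ac)
    also have "\<dots> = of_real (w (norm q)) * E q"
      unfolding R E_def u_def by simp
    finally show ?thesis by simp
  qed simp
  have "tube_int a m f z = (\<integral>q. indicator (ball 0 1) q *\<^sub>R J q *\<^sub>R tube_kernel a m f z (ball_to_tube z q) \<partial>lborel)"
    using I(2) unfolding tube_int_def set_lebesgue_integral_def .
  also have "\<dots> = (\<integral>q. indicator (ball 0 1) q *\<^sub>R (of_real (w (norm q)) * E q) \<partial>lborel)"
    by (simp only: eq)
  also have "\<dots> = E 0 * of_real (\<integral>q. indicator (ball 0 1) (q :: (complex, 'n) vec) * w (norm q) \<partial>lborel)"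
  proof (rule integral_ball_mean_value)
    show "integrable lborel (\<lambda>q. indicator (ball 0 1) q *\<^sub>R (of_real (w (norm q)) * E q))"
      using I(1) unfolding set_integrable_def eq .
    fix q :: "(complex, 'n) vec" assume q: "norm q < 1"
    \<comment> \<open>The disc of radius 1/|q|, or the whole plane if q = 0. It contains the closed
      unit disc because |q| < 1.\<close>
    define U where "U = {t :: complex. cmod t * norm q < 1}"
    have U: "open U" unfolding U_def by (intro open_Collect_less continuous_intros)
    have UU: "cball 0 1 \<subseteq> U"
    proof
      fix t :: complex assume "t \<in> cball 0 1"
      then have "cmod t * norm q \<le> 1 * norm q" by (intro mult_right_mono) auto
      then show "t \<in> U" using q by (simp add: U_def)
    qed
    have nrm: "norm (t *s q) = cmod t * norm q" for t
      by (simp add: norm_vec_def L2_set_def norm_mult power_mult_distrib sum_distrib_left[symmetric] real_sqrt_mult)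
    have in1: "norm (t *s q) < 1" if "t \<in> U" for t using that by (simp add: nrm U_def)
    have ne: "1 - t * q $ ?l \<noteq> 0" "Re (1 - t * q $ ?l) > 0" if "t \<in> U" for t
      using last_lt_1[OF in1[OF that]] complex_Re_le_cmod[of "t * q $ ?l"] by (auto simp: algebra_simps)
    have ne1: "t * q $ ?l \<noteq> 1" if "t \<in> U" for t using ne(1)[OF that] by auto
    have "(\<lambda>t. f (ball_to_tube z (t *s q))) holomorphic_on U"
    proof (rule holo_tube_comp[OF f(1) U])
      show "ball_to_tube z (t *s q) \<in> tube_domain" if "t \<in> U" for t
        by (rule ball_to_tube_in[OF z in1[OF that]])
      fix j
      show "(\<lambda>t. ball_to_tube z (t *s q) $ j) holomorphic_on U"
        unfolding ball_to_tube_def heis_def cayley_def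
        by (cases "j = ?l") (auto intro!: holomorphic_intros simp: ne1)
    qed
    moreover have "(1 - t * q $ ?l) \<notin> \<real>\<^sub>\<le>\<^sub>0" if "t \<in> U" for t
      using ne[OF that] by (auto simp: complex_nonpos_Reals_iff)
    ultimately have "(\<lambda>t. E (t *s q)) holomorphic_on U"
      unfolding E_def by (auto intro!: holomorphic_intros simp: ne1)
    then show "\<exists>U. open U \<and> cball 0 1 \<subseteq> U \<and> (\<lambda>t. E (t *s q)) holomorphic_on U"
      using U UU by blast
  qed
  also have "E 0 = 2 ^ (?n + 1) * f z" by (simp add: E_def ball_to_tube_0)
  also have "(\<integral>q. indicator (ball 0 1) (q :: (complex, 'n) vec) * w (norm q) \<partial>lborel)
     = pi ^ ?n * Gamma (a + 1) / Gamma (real ?n + 1 + a)"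
    unfolding w_def using has_bochner_integral_ball_weight[OF a, where 'n = 'n] by (simp add: has_bochner_integral_iff)
  finally show ?thesis by (simp add: m_def mult_ac)
qed

section \<open>The derivative in the last coordinate\<close>

definition shift_last :: "(complex, 'n::{finite,linorder}) vec \<Rightarrow> complex \<Rightarrow> (complex, 'n::{finite,linorder}) vec" where
  "shift_last w t = vec_upd w last_index (w $ last_index + t)"

lemma shift_last_nth: "shift_last w t $ j = (if j = last_index then w $ last_index + t else w $ j)"
  by (simp add: shift_last_def)

lemma shift_last_0 [simp]: "shift_last w 0 = w"
  by (simp add: vec_eq_iff shift_last_nth)

lemma tube_rho_shift_last: "tube_rho (shift_last w t) = tube_rho w + Im t"
  by (simp add: tube_rho_def shift_last_nth)

lemma tube_rho2_shift_last_right: "tube_rho2 z (shift_last w t) = tube_rho2 z w + \<i> / 2 * cnj t"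
  by (simp add: tube_rho2_def shift_last_nth algebra_simps)

lemma tube_rho2_shift_last_left: "tube_rho2 (shift_last z t) w = tube_rho2 z w - \<i> / 2 * t"
  by (simp add: tube_rho2_def shift_last_nth algebra_simps)

lemma shift_last_in:
  assumes "w \<in> tube_domain" "cmod t < tube_rho w"
  shows "shift_last w t \<in> tube_domain"
  using assms abs_Im_le_cmod[of t] by (simp add: tube_domain_iff tube_rho_shift_last)

lemma continuous_on_shift_last:
  assumes "continuous_on S f" "continuous_on S g"
  shows "continuous_on S (\<lambda>x. shift_last (f x) (g x))"
proof -
  have "continuous_on S (\<lambda>x. if j = last_index then f x $ last_index + g x else f x $ j)" for j
    by (cases "j = last_index") (auto intro!: continuous_intros assms)
  then show ?thesis
    unfolding shift_last_def vec_upd_def by (intro continuous_on_vec_lambda)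
qed

lemma measurable_shift_last [measurable]:
  assumes "f \<in> M \<rightarrow>\<^sub>M borel" "g \<in> M \<rightarrow>\<^sub>M borel"
  shows "(\<lambda>x. shift_last (f x) (g x)) \<in> M \<rightarrow>\<^sub>M borel"
  unfolding shift_last_def using assms by measurable

lemma holo_tube_shift_last:
  assumes f: "holo_tube f" and U: "open U" and \<gamma>: "\<And>j. (\<lambda>t. \<gamma> t $ j) holomorphic_on U" "h holomorphic_on U"
    and "\<And>t. t \<in> U \<Longrightarrow> shift_last (\<gamma> t) (h t) \<in> tube_domain"
  shows "(\<lambda>t. f (shift_last (\<gamma> t) (h t))) holomorphic_on U"
proof (rule holo_tube_comp[OF f U])
  show "(\<lambda>t. shift_last (\<gamma> t) (h t) $ j) holomorphic_on U" for j
    by (cases "j = last_index") (auto simp: shift_last_nth intro!: holomorphic_intros \<gamma>)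
qed (use assms in auto)

lemma holomorphic_shift_last:
  assumes "holo_tube f" "w \<in> tube_domain"
  shows "(\<lambda>t. f (shift_last w t)) holomorphic_on ball 0 (tube_rho w)"
  by (rule holo_tube_shift_last) (use assms in \<open>auto intro!: holomorphic_intros shift_last_in\<close>)

lemma deriv_last_shift:
  assumes "holo_tube f" "w \<in> tube_domain"
  shows "((\<lambda>t. f (shift_last w t)) has_field_derivative deriv_last f w) (at 0)"
proof -
  have w: "tube_rho w > 0" using assms by (simp add: tube_domain_iff)
  define g where "g t = f (vec_upd w last_index t)" for t
  have 1: "(\<lambda>t. f (shift_last w t)) = (\<lambda>t. g (t + w $ last_index))"
    by (simp add: g_def shift_last_def add.commute)
  have "deriv_last f w = deriv g (w $ last_index)"
    unfolding deriv_last_def g_def vec_upd_def ..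
  also have "\<dots> = deriv (\<lambda>t. f (shift_last w t)) 0"
    unfolding 1 using deriv_shift_0[of g "w $ last_index"] by (simp add: o_def add.commute)
  finally have eq: "deriv_last f w = deriv (\<lambda>t. f (shift_last w t)) 0" .
  show ?thesis unfolding eq
    by (rule holomorphic_derivI[OF holomorphic_shift_last[OF assms]]) (use w in auto)
qed

text \<open>Taylor's formula with Cauchy's estimate for the second derivative on discs of radius
  r/2, that is 2! M / (r/2)^2 = 8 M / r^2. The bound sees \<open>\<phi>\<close> only through
  \<open>M\<close> and is therefore uniform in a parameter.\<close>

lemma difference_quotient_bound:
  assumes hol: "\<phi> holomorphic_on ball 0 R" and r: "0 < r" "r < R"
    and M: "\<And>t. cmod t \<le> r \<Longrightarrow> cmod (\<phi> t) \<le> M"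
    and h: "h \<noteq> 0" "cmod h \<le> r / 2" and d: "(\<phi> has_field_derivative D) (at 0)"
  shows "cmod ((\<phi> h - \<phi> 0) / h - D) \<le> 8 * M / r\<^sup>2 * cmod h"
proof -
  define F where "F i = (deriv ^^ i) \<phi>" for i
  have D: "F i holomorphic_on ball 0 R" for i
    unfolding F_def by (rule holomorphic_higher_deriv[OF hol]) simp
  have "cmod (F 0 h - (\<Sum>i\<le>1. F i 0 * (h - 0) ^ i / fact i)) \<le> (8 * M / r\<^sup>2) * cmod (h - 0) ^ Suc 1 / fact 1"
  proof (rule complex_Taylor[where S = "cball 0 (r / 2)" and n = 1 and f = F and B = "8 * M / r\<^sup>2"])
    show "(F i has_field_derivative F (Suc i) x) (at x within cball 0 (r / 2))" if "x \<in> cball 0 (r / 2)" for i x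
    proof -
      have "x \<in> ball 0 R" using that r by auto
      then have "(F i has_field_derivative deriv (F i) x) (at x)" by (intro holomorphic_derivI[OF D]) auto
      then show ?thesis by (simp add: F_def has_field_derivative_at_within)
    qed
    show "cmod (F (Suc 1) x) \<le> 8 * M / r\<^sup>2" if x: "x \<in> cball 0 (r / 2)" for x
    proof -
      have sub: "cball x (r / 2) \<subseteq> cball 0 r"
      proof
        fix y assume "y \<in> cball x (r / 2)"
        then show "y \<in> cball 0 r"
          using x norm_triangle_ineq[of x "y - x"] by (simp add: dist_norm norm_minus_commute)
      qed
      have subR: "cball x (r / 2) \<subseteq> ball 0 R"
        by (rule order_trans[OF sub]) (use r in auto)
      have "cmod ((deriv ^^ 2) \<phi> x) \<le> fact 2 * M / (r / 2) ^ 2"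
      proof (rule Cauchy_inequality)
        show "\<phi> holomorphic_on ball x (r / 2)"
          by (rule holomorphic_on_subset[OF hol order_trans[OF ball_subset_cball subR]])
        show "continuous_on (cball x (r / 2)) \<phi>"
          by (rule holomorphic_on_imp_continuous_on[OF holomorphic_on_subset[OF hol subR]])
        show "cmod (\<phi> y) \<le> M" if "cmod (x - y) = r / 2" for y
        proof (rule M)
          have "y \<in> cball x (r / 2)" using that by (simp add: dist_norm)
          with sub show "cmod y \<le> r" by (auto simp: subset_iff)
        qed
      qed (use r in simp)
      then show ?thesis by (simp add: F_def numeral_2_eq_2 power2_eq_square)
    qed
  qed (use h r in \<open>auto simp: F_def\<close>)
  moreover have "deriv \<phi> 0 = D" using d by (rule DERIV_imp_deriv)
  ultimately have "cmod (\<phi> h - \<phi> 0 - D * h) \<le> 8 * M / r\<^sup>2 * (cmod h)\<^sup>2"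
    by (simp add: F_def diff_diff_eq power2_eq_square)
  moreover have "(\<phi> h - \<phi> 0) / h - D = (\<phi> h - \<phi> 0 - D * h) / h" using h by (simp add: field_simps)
  ultimately show ?thesis
    using h by (simp add: norm_divide divide_le_eq power2_eq_square mult.assoc)
qed

text \<open>One null sequence \<open>h\<close> serves a whole ball, so the uniform limit theorem and
  Weierstrass' theorem can be applied to the difference quotients. The common bound \<open>M\<close>
  comes from compactness of the set swept out by the shifts.\<close>

lemma deriv_last_local_limit:
  fixes f :: "(complex, 'n::{finite,linorder}) vec \<Rightarrow> complex"
  assumes f: "holo_tube f" and w0: "w0 \<in> tube_domain"
  shows "\<exists>\<delta> h. \<delta> > 0 \<and> cball w0 \<delta> \<subseteq> tube_domain \<and> (\<forall>k. h k \<noteq> (0::complex)) \<and>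
    (\<forall>w\<in>cball w0 \<delta>. \<forall>k. shift_last w (h k) \<in> tube_domain) \<and>
    uniform_limit (cball w0 \<delta>) (\<lambda>k w. (f (shift_last w (h k)) - f w) / h k) (deriv_last f) sequentially"
proof -
  let ?T = "tube_domain :: (complex, 'n) vec set"
  \<comment> \<open>With rho(w0) = 4r, all points near w0 have rho > 2r, and their last coordinate
    can be moved by up to r within the domain.\<close>
  define r where "r = tube_rho w0 / 4"
  have r: "r > 0" using w0 by (simp add: r_def tube_domain_iff)
  have "open {w. tube_rho w > 2 * r}"
    by (intro open_Collect_less continuous_intros continuous_on_tube_rho)
  moreover have "w0 \<in> {w. tube_rho w > 2 * r}" using r by (simp add: r_def)
  ultimately obtain \<delta> where \<delta>: "\<delta> > 0" "cball w0 \<delta> \<subseteq> {w. tube_rho w > 2 * r}"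
    using open_contains_cball[of "{w. tube_rho w > 2 * r}"] by blast
  then have rho: "tube_rho w > 2 * r" if "w \<in> cball w0 \<delta>" for w using that by auto
  have inT: "w \<in> ?T" if "w \<in> cball w0 \<delta>" for w using rho[OF that] r by (simp add: tube_domain_iff)
  define K where "K = (\<lambda>(w, t). shift_last w t) ` (cball w0 \<delta> \<times> cball 0 r)"
  have "compact K"
    unfolding K_def case_prod_beta
    by (intro compact_continuous_image compact_Times compact_cball continuous_on_shift_last continuous_intros)
  have KT: "shift_last w t \<in> ?T" if "w \<in> cball w0 \<delta>" "cmod t \<le> r" for w t
    by (rule shift_last_in) (use inT rho[OF that(1)] that r in auto)
  then have "K \<subseteq> ?T" by (auto simp: K_def)
  then have "compact (f ` K)"
    using f \<open>compact K\<close> unfolding holo_tube_def by (meson compact_continuous_image continuous_on_subset)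
  then obtain M where M: "\<And>y. y \<in> f ` K \<Longrightarrow> cmod y \<le> M"
    using compact_imp_bounded bounded_iff by metis
  define h where "h k = complex_of_real (r / 2 * inverse (real (Suc k)))" for k
  have h: "h k \<noteq> 0" "cmod (h k) \<le> r / 2" for k
  proof -
    have "0 < r / 2 * inverse (real (Suc k))" using r by simp
    moreover have "r / 2 * inverse (real (Suc k)) \<le> r / 2 * 1"
      using r by (intro mult_left_mono) (auto simp: inverse_eq_divide)
    ultimately show "h k \<noteq> 0" "cmod (h k) \<le> r / 2"
      unfolding h_def norm_of_real of_real_eq_0_iff by auto
  qed
  have hr: "cmod (h k) \<le> r" for k using h(2)[of k] r by simp
  have lim: "(\<lambda>k. 8 * M / r\<^sup>2 * cmod (h k)) \<longlonglongrightarrow> 0"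
  proof -
    have "h \<longlonglongrightarrow> of_real (r / 2 * 0)"
      unfolding h_def by (intro tendsto_intros LIMSEQ_inverse_real_of_nat)
    then have "(\<lambda>k. 8 * M / r\<^sup>2 * cmod (h k)) \<longlonglongrightarrow> 8 * M / r\<^sup>2 * cmod (of_real (r / 2 * 0))"
      by (intro tendsto_intros)
    then show ?thesis by simp
  qed
  have bound: "cmod ((f (shift_last w (h k)) - f w) / h k - deriv_last f w) \<le> 8 * M / r\<^sup>2 * cmod (h k)"
    if w: "w \<in> cball w0 \<delta>" for w k
  proof -
    have "cmod ((f (shift_last w (h k)) - f (shift_last w 0)) / h k - deriv_last f w) \<le> 8 * M / r\<^sup>2 * cmod (h k)"
    proof (rule difference_quotient_bound[OF holomorphic_shift_last[OF f inT[OF w]] _ _ _ h])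
      show "cmod (f (shift_last w t)) \<le> M" if "cmod t \<le> r" for t
        by (rule M) (use w that in \<open>force simp: K_def\<close>)
    qed (use r rho[OF w] deriv_last_shift[OF f inT[OF w]] in auto)
    then show ?thesis by simp
  qed
  have "uniform_limit (cball w0 \<delta>) (\<lambda>k w. (f (shift_last w (h k)) - f w) / h k) (deriv_last f) sequentially"
  proof (rule uniform_limitI)
    fix e :: real assume "e > 0"
    from order_tendstoD(2)[OF lim this]
    show "\<forall>\<^sub>F k in sequentially. \<forall>w\<in>cball w0 \<delta>. dist ((f (shift_last w (h k)) - f w) / h k) (deriv_last f w) < e"
      by eventually_elim (use bound in \<open>fastforce simp: dist_norm intro: le_less_trans\<close>)
  qed
  with \<delta>(1) h(1) inT KT hr show ?thesis by blast
qed

text \<open>Holomorphy along a curve is local, so it is checked on the preimage of a ball on which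
  the quotients converge uniformly.\<close>

lemma holo_tube_deriv_last:
  fixes f :: "(complex, 'n::{finite,linorder}) vec \<Rightarrow> complex"
  assumes f: "holo_tube f"
  shows "holo_tube (deriv_last f)"
  unfolding holo_tube_def
proof (intro conjI allI impI)
  let ?T = "tube_domain :: (complex, 'n) vec set"
  have cf: "continuous_on ?T f" using f by (simp add: holo_tube_def)
  have "continuous (at w0) (deriv_last f)" if w0: "w0 \<in> ?T" for w0
  proof -
    obtain \<delta> h where L: "\<delta> > 0" "cball w0 \<delta> \<subseteq> ?T" "\<forall>k. h k \<noteq> 0"
      "\<forall>w\<in>cball w0 \<delta>. \<forall>k. shift_last w (h k) \<in> ?T"
      "uniform_limit (cball w0 \<delta>) (\<lambda>k w. (f (shift_last w (h k)) - f w) / h k) (deriv_last f) sequentially"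
      using deriv_last_local_limit[OF f w0] by (elim exE conjE)
    have "continuous_on (cball w0 \<delta>) (\<lambda>w. (f (shift_last w (h k)) - f w) / h k)" for k
      by (intro continuous_intros continuous_on_compose2[OF cf] continuous_on_shift_last) (use L in auto)
    then have "continuous_on (cball w0 \<delta>) (deriv_last f)"
      by (intro uniform_limit_theorem[OF _ L(5)]) auto
    then show ?thesis
      using L(1) by (simp add: continuous_on_interior)
  qed
  then show "continuous_on ?T (deriv_last f)"
    by (simp add: continuous_at_imp_continuous_on)
next
  let ?T = "tube_domain :: (complex, 'n) vec set"
  fix U and \<gamma> :: "complex \<Rightarrow> (complex, 'n) vec"
  assume U: "open U" and \<gamma>: "\<forall>j. (\<lambda>t. \<gamma> t $ j) holomorphic_on U" and \<gamma>T: "\<gamma> ` U \<subseteq> ?T"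
  have c\<gamma>: "continuous_on U \<gamma>"
  proof -
    have "continuous_on U (\<lambda>t. \<chi> j. \<gamma> t $ j)"
      using \<gamma> by (intro continuous_on_vec_lambda) (auto intro: holomorphic_on_imp_continuous_on)
    then show ?thesis by simp
  qed
  have "\<exists>V. open V \<and> t0 \<in> V \<and> V \<subseteq> U \<and> (\<lambda>t. deriv_last f (\<gamma> t)) holomorphic_on V" if t0: "t0 \<in> U" for t0
  proof -
    have w0: "\<gamma> t0 \<in> ?T" using t0 \<gamma>T by auto
    obtain \<delta> h where L: "\<delta> > 0" "cball (\<gamma> t0) \<delta> \<subseteq> ?T" "\<forall>k. h k \<noteq> 0"
      "\<forall>w\<in>cball (\<gamma> t0) \<delta>. \<forall>k. shift_last w (h k) \<in> ?T"
      "uniform_limit (cball (\<gamma> t0) \<delta>) (\<lambda>k w. (f (shift_last w (h k)) - f w) / h k) (deriv_last f) sequentially"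
      using deriv_last_local_limit[OF f w0] by (elim exE conjE)
    define V where "V = U \<inter> \<gamma> -` ball (\<gamma> t0) \<delta>"
    have V: "open V" unfolding V_def by (rule continuous_open_preimage[OF c\<gamma> U]) simp
    have V\<gamma>: "\<gamma> t \<in> cball (\<gamma> t0) \<delta>" if "t \<in> V" for t using that by (auto simp: V_def)
    have "V \<subseteq> U" by (auto simp: V_def)
    then have hol: "(\<lambda>t. \<gamma> t $ j) holomorphic_on V" for j
      using \<gamma> holomorphic_on_subset by blast
    have "(\<lambda>t. deriv_last f (\<gamma> t)) holomorphic_on V"
    proof (rule holomorphic_uniform_sequence[OF V])
      fix k
      show "(\<lambda>t. (f (shift_last (\<gamma> t) (h k)) - f (\<gamma> t)) / h k) holomorphic_on V"
        by (intro holomorphic_intros holo_tube_shift_last[OF f V hol] holo_tube_comp[OF f V hol])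
           (use L V\<gamma> in auto)
    next
      fix x assume "x \<in> V"
      with V obtain d where d: "d > 0" "cball x d \<subseteq> V" by (meson open_contains_cball)
      have "uniform_limit (cball x d) (\<lambda>k t. (f (shift_last (\<gamma> t) (h k)) - f (\<gamma> t)) / h k) (\<lambda>t. deriv_last f (\<gamma> t)) sequentially"
        by (rule uniform_limit_compose'[OF L(5)]) (use d V\<gamma> in auto)
      with d show "\<exists>d>0. cball x d \<subseteq> V \<and> uniform_limit (cball x d) (\<lambda>k t. (f (shift_last (\<gamma> t) (h k)) - f (\<gamma> t)) / h k) (\<lambda>t. deriv_last f (\<gamma> t)) sequentially"
        by blast
    qed
    moreover have "t0 \<in> V" using t0 L(1) by (simp add: V_def)
    ultimately show ?thesis using V \<open>V \<subseteq> U\<close> by blast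
  qed
  then show "(\<lambda>t. deriv_last f (\<gamma> t)) holomorphic_on U"
    by (meson U holomorphic_on_def holomorphic_on_imp_differentiable_at field_differentiable_at_within subset_iff)
qed

text \<open>Cauchy's formula for the derivative, estimated in modulus. As a nonnegative integral the
  bound allows Tonelli in \<open>tube_finite_deriv_last\<close> without an integrability
  condition.\<close>

lemma deriv_circle_bound:
  assumes hol: "G holomorphic_on ball 0 R" and R: "R > 1" and D: "(G has_field_derivative D) (at 0)"
  shows "ennreal (cmod D) \<le> (\<integral>\<^sup>+x. indicator {0..1} x * ennreal (cmod (G (exp (2 * of_real pi * \<i> * of_real x)))) \<partial>lborel)"
proof -
  let ?e = "\<lambda>x::real. exp (2 * of_real pi * \<i> * of_real x)"
  have cont: "continuous_on (cball 0 1) G"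
    by (rule holomorphic_on_imp_continuous_on[OF holomorphic_on_subset[OF hol]]) (use R in auto)
  have "G holomorphic_on ball 0 1"
    by (rule holomorphic_on_subset[OF hol]) (use R in auto)
  then have "((\<lambda>u. G u / (u - 0)\<^sup>2) contour_integrable_on circlepath 0 1)"
    and der: "(G has_field_derivative (1 / (2 * of_real pi * \<i>) * contour_integral (circlepath 0 1) (\<lambda>u. G u / (u - 0)\<^sup>2))) (at 0)"
    using Cauchy_derivative_integral_circlepath[OF cont, of 0] by auto
  then have "((\<lambda>u. G u / u\<^sup>2) has_contour_integral (contour_integral (circlepath 0 1) (\<lambda>u. G u / u\<^sup>2))) (circlepath 0 1)"
    by (simp add: has_contour_integral_integral)
  moreover have "contour_integral (circlepath 0 1) (\<lambda>u. G u / u\<^sup>2) = 2 * of_real pi * \<i> * D"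
    using DERIV_unique[OF D der] by (simp add: field_simps)
  ultimately have "((\<lambda>u. G u / u\<^sup>2) has_contour_integral (2 * of_real pi * \<i> * D)) (circlepath 0 1)"
    by simp
  then have "((\<lambda>x. G (?e x) / (?e x)\<^sup>2 * (2 * of_real pi * \<i> * ?e x)) has_integral (2 * of_real pi * \<i> * D)) {0..1}"
    unfolding has_contour_integral_def
    by (rule has_integral_eq[rotated])
       (simp add: vector_derivative_circlepath01, simp add: circlepath)
  then have HI: "norm (2 * of_real pi * \<i> * D) \<le> integral {0..1} (\<lambda>x. 2 * pi * cmod (G (?e x)))"
  proof (subst integral_unique[symmetric], assumption, intro integral_norm_bound_integral)
    show "(\<lambda>x. 2 * pi * cmod (G (?e x))) integrable_on {0..1}"
      by (intro integrable_continuous_interval continuous_intros continuous_on_compose2[OF cont]) auto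
  qed (auto simp: norm_mult norm_divide norm_power dest: has_integral_integrable)
  have ci: "continuous_on {0..1} (\<lambda>x. cmod (G (?e x)))"
    by (intro continuous_intros continuous_on_compose2[OF cont]) auto
  have "norm (2 * of_real pi * \<i> * D) = 2 * pi * cmod D" by (simp add: norm_mult)
  with HI have "cmod D \<le> integral {0..1} (\<lambda>x. cmod (G (?e x)))"
    by simp
  moreover have "(\<integral>\<^sup>+x. ennreal (indicator {0..1} x * cmod (G (?e x))) \<partial>lborel) = ennreal (integral {0..1} (\<lambda>x. cmod (G (?e x))))"
    by (rule nn_integral_has_integral_lebesgue)
       (auto intro!: integrable_integral integrable_continuous_interval ci)
  ultimately show ?thesis
    by (simp add: ennreal_mult' ennreal_indicator ennreal_leI)
qed

text \<open>The map is not holomorphic, so real coordinates are used. At a fixed height the real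
  part is only translated, and the heights undergo an affine map of slope k = 1 + Im c / 2, which is
  at least 1/2; its inverse gives the factor 2.\<close>

lemma nn_integral_shear_scale:
  fixes c :: complex and b :: real
  assumes [measurable]: "Q \<in> borel_measurable borel" and c: "cmod c \<le> 1"
  shows "(\<integral>\<^sup>+t. Q (t + of_real ((Im t - b) / 2) * c) \<partial>lborel) \<le> 2 * (\<integral>\<^sup>+t. Q t \<partial>lborel)"
proof -
  define k where "k = 1 + Im c / 2"
  have k: "k \<ge> 1 / 2" using abs_Im_le_cmod[of c] c by (simp add: k_def)
  have [measurable]: "(\<lambda>x. Complex x y) \<in> borel_measurable borel" for y
    unfolding Complex_eq by measurable
  define R where "R y = (\<integral>\<^sup>+x. Q (Complex x y) \<partial>lborel)" for y
  have [measurable]: "R \<in> borel_measurable borel"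
    unfolding R_def[abs_def] Complex_eq by measurable
  have "(\<integral>\<^sup>+t. Q (t + of_real ((Im t - b) / 2) * c) \<partial>lborel)
    = (\<integral>\<^sup>+y. \<integral>\<^sup>+x. Q (Complex x y + of_real ((y - b) / 2) * c) \<partial>lborel \<partial>lborel)"
    by (subst nn_integral_complex) simp_all
  also have "\<dots> = (\<integral>\<^sup>+y. R (y + (y - b) / 2 * Im c) \<partial>lborel)"
  proof (rule nn_integral_cong)
    fix y
    have "Complex x y + of_real ((y - b) / 2) * c = Complex ((y - b) / 2 * Re c + 1 * x) (y + (y - b) / 2 * Im c)" for x
      by (simp add: complex_eq_iff)
    then show "(\<integral>\<^sup>+x. Q (Complex x y + of_real ((y - b) / 2) * c) \<partial>lborel) = R (y + (y - b) / 2 * Im c)"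
      unfolding R_def
      by (subst nn_integral_real_affine[of "\<lambda>x. Q (Complex x (y + (y - b) / 2 * Im c))" 1 "(y - b) / 2 * Re c"]) simp_all
  qed
  also have "\<dots> = (\<integral>\<^sup>+y. R (- b * Im c / 2 + k * y) \<partial>lborel)"
    by (simp add: k_def algebra_simps add_divide_distrib diff_divide_distrib)
  also have "\<dots> \<le> 2 * ennreal \<bar>k\<bar> * (\<integral>\<^sup>+y. R (- b * Im c / 2 + k * y) \<partial>lborel)"
  proof -
    have "1 \<le> 2 * ennreal \<bar>k\<bar>"
    proof -
      have "(1::ennreal) = ennreal 1" by simp
      also have "\<dots> \<le> ennreal (2 * \<bar>k\<bar>)" using k by (intro ennreal_leI) linarith
      finally show ?thesis by (simp add: ennreal_mult')
    qed
    from mult_right_mono[OF this] show ?thesis by simp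
  qed
  also have "\<dots> = 2 * (ennreal \<bar>k\<bar> * (\<integral>\<^sup>+y. R (- b * Im c / 2 + k * y) \<partial>lborel))"
    by (simp add: mult.assoc)
  also have "ennreal \<bar>k\<bar> * (\<integral>\<^sup>+y. R (- b * Im c / 2 + k * y) \<partial>lborel) = (\<integral>\<^sup>+y. R y \<partial>lborel)"
    by (rule nn_integral_real_affine[symmetric]) (use k in auto)
  also have "(\<integral>\<^sup>+y. R y \<partial>lborel) = (\<integral>\<^sup>+t. Q t \<partial>lborel)"
    unfolding R_def by (rule nn_integral_complex[symmetric]) simp
  finally show ?thesis .
qed

text \<open>
  Cauchy's estimate on the circle of radius \<open>\<rho>(w)/2\<close> about \<open>w_n\<close>. For a fixed angle, the passage from
  \<open>w\<close> to the point of that circle is a real affine map with Jacobian at least \<open>1/2\<close> that changes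
  \<open>\<rho>(w)\<close> and \<open>|\<rho>(z,w)|\<close> only by bounded factors.
\<close>

lemma tube_finite_deriv_last:
  fixes f :: "(complex, 'n::{finite,linorder}) vec \<Rightarrow> complex"
  assumes f: "holo_tube f" and fin: "tube_finite s m f" and m: "m \<ge> 0"
  shows "tube_finite (s + 1) m (deriv_last f)"
  unfolding tube_finite_def
proof
  let ?T = "tube_domain :: (complex, 'n) vec set"
  fix z assume z: "z \<in> ?T"
  let ?e = "\<lambda>x::real. exp (2 * of_real pi * \<i> * of_real x)"
  have [measurable]: "?e \<in> borel_measurable borel"
    by (intro borel_measurable_continuous_onI continuous_intros)
  define Q where "Q w = indicator ?T w * ennreal (tube_rho w powr s / cmod (tube_rho2 z w) powr m * cmod (f w))" for w
  have cf: "continuous_on ?T f" using f by (simp add: holo_tube_def)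
  have Q_eq: "Q w = ennreal (norm (indicator ?T w *\<^sub>R tube_kernel s m f z w))" for w
    by (simp add: Q_def norm_tube_kernel split: split_indicator)
  have [measurable]: "Q \<in> borel_measurable borel"
    unfolding Q_eq[abs_def]
    using borel_measurable_tube_kernel[OF cf z, of s m] by measurable
  define \<sigma> where "\<sigma> c w = shift_last w (of_real (tube_rho w / 2) * c)" for c and w :: "(complex, 'n) vec"
  \<comment> \<open>The point \<open>\<sigma> c w\<close> has rho between half and twice rho(w),
    which gives the power of 2. The kernel changes by at most rho(w)/4, hence by at most |rho(z,
    w)|/2, which gives the power of 3/2.\<close>
  define C where "C = 2 powr \<bar>s\<bar> * (3 / 2) powr m"
  have key: "indicator ?T w * ennreal (tube_rho w powr (s + 1) / cmod (tube_rho2 z w) powr m * cmod (deriv_last f w))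
     \<le> ennreal (2 * C) * (\<integral>\<^sup>+x. indicator {0..1} x * Q (\<sigma> (?e x) w) \<partial>lborel)" for w
  proof (cases "w \<in> ?T")
    case w: True
    define r where "r = tube_rho w / 2"
    have r: "r > 0" using w by (simp add: r_def tube_domain_iff)
    \<comment> \<open>Rescaling the circle to radius 1 multiplies the derivative by r = rho(w)/2.
      This accounts for the weight rho^(s+1) and for the factor 2 in front of
      \<open>C\<close>.\<close>
    define G where "G t = f (shift_last w (of_real r * t))" for t
    have G: "G holomorphic_on ball 0 2"
      unfolding G_def
      by (rule holo_tube_shift_last[OF f]) 
         (use w r in \<open>auto intro!: holomorphic_intros shift_last_in simp: norm_mult r_def\<close>)
    have "(G has_field_derivative deriv_last f w * of_real r) (at 0)"
    proof -
      have "((\<lambda>t. f (shift_last w t)) has_field_derivative deriv_last f w) (at (of_real r * 0))"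
        using deriv_last_shift[OF f w] by simp
      moreover have "((\<lambda>t. of_real r * t) has_field_derivative of_real r) (at 0)"
        by (auto intro!: derivative_eq_intros)
      ultimately show ?thesis unfolding G_def by (rule DERIV_chain2)
    qed
    from deriv_circle_bound[OF G _ this]
    have 1: "ennreal (cmod (deriv_last f w) * r) \<le> (\<integral>\<^sup>+x. indicator {0..1} x * ennreal (cmod (G (?e x))) \<partial>lborel)"
      using r by (simp add: norm_mult)
    define A where "A = tube_rho w powr s / cmod (tube_rho2 z w) powr m"
    have 2: "ennreal A * ennreal (cmod (G c)) \<le> ennreal C * Q (\<sigma> c w)" if c: "cmod c = 1" for c
    proof -
      have rc: "cmod (of_real r * c) = r" using c r by (simp add: norm_mult)
      have \<sigma>: "\<sigma> c w = shift_last w (of_real r * c)" by (simp add: \<sigma>_def r_def)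
      have in\<sigma>: "\<sigma> c w \<in> ?T" unfolding \<sigma> by (rule shift_last_in) (use w rc r in \<open>auto simp: r_def\<close>)
      define y where "y = Im (of_real r * c)"
      have "\<bar>y\<bar> \<le> r" unfolding y_def using abs_Im_le_cmod[of "of_real r * c"] rc by simp
      moreover have "tube_rho (\<sigma> c w) = 2 * r + y" "tube_rho w = 2 * r"
        unfolding \<sigma> tube_rho_shift_last y_def by (simp_all add: r_def)
      ultimately have rho: "tube_rho w \<le> 2 * tube_rho (\<sigma> c w)" "tube_rho (\<sigma> c w) \<le> 2 * tube_rho w"
        using r by auto
      have p: "tube_rho w > 0" "tube_rho (\<sigma> c w) > 0" using w in\<sigma> by (auto simp: tube_domain_iff)
      have S: "tube_rho w powr s \<le> 2 powr \<bar>s\<bar> * tube_rho (\<sigma> c w) powr s"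
      proof (cases "s \<ge> 0")
        case True
        then have "tube_rho w powr s \<le> (2 * tube_rho (\<sigma> c w)) powr s"
          using rho p by (intro powr_mono2) auto
        then show ?thesis using True p by (simp add: powr_mult)
      next
        case False
        then have "tube_rho w powr s \<le> (tube_rho (\<sigma> c w) / 2) powr s"
          using rho p by (intro powr_mono2') auto
        also have "\<dots> = 2 powr \<bar>s\<bar> * tube_rho (\<sigma> c w) powr s"
          using False p by (simp add: powr_divide powr_minus field_simps)
        finally show ?thesis .
      qed
      note b = tube_rho2_bounds[OF z w] and b\<sigma> = tube_rho2_bounds[OF z in\<sigma>]
      have "cmod (tube_rho2 z (\<sigma> c w)) \<le> cmod (tube_rho2 z w) + cmod (\<i> / 2 * cnj (of_real r * c))"
        unfolding \<sigma> tube_rho2_shift_last_right by (rule norm_triangle_ineq)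
      also have "cmod (\<i> / 2 * cnj (of_real r * c)) = r / 2"
        using rc by (simp add: norm_mult norm_divide)
      also have "r / 2 \<le> cmod (tube_rho2 z w) / 2" using b(5) by (simp add: r_def)
      finally have "cmod (tube_rho2 z (\<sigma> c w)) \<le> 3 / 2 * cmod (tube_rho2 z w)" by simp
      then have "cmod (tube_rho2 z (\<sigma> c w)) powr m \<le> (3 / 2 * cmod (tube_rho2 z w)) powr m"
        using m by (intro powr_mono2) auto
      then have K: "cmod (tube_rho2 z (\<sigma> c w)) powr m \<le> (3 / 2) powr m * cmod (tube_rho2 z w) powr m"
        by (subst (asm) powr_mult) auto
      have "A \<le> C * (tube_rho (\<sigma> c w) powr s / cmod (tube_rho2 z (\<sigma> c w)) powr m)"
      proof -
        have kp: "cmod (tube_rho2 z w) powr m > 0" "cmod (tube_rho2 z (\<sigma> c w)) powr m > 0" using b b\<sigma> by auto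
        have "1 / cmod (tube_rho2 z w) powr m \<le> (3 / 2) powr m / cmod (tube_rho2 z (\<sigma> c w)) powr m"
          using K kp by (simp add: divide_simps mult.commute)
        from mult_mono[OF S this] show ?thesis by (simp add: A_def C_def mult_ac)
      qed
      then have "A * cmod (G c) \<le> C * (tube_rho (\<sigma> c w) powr s / cmod (tube_rho2 z (\<sigma> c w)) powr m * cmod (f (\<sigma> c w)))"
        unfolding G_def \<sigma>[symmetric] mult.assoc[symmetric] by (rule mult_right_mono) simp
      then have "ennreal (A * cmod (G c)) \<le> ennreal (C * (tube_rho (\<sigma> c w) powr s / cmod (tube_rho2 z (\<sigma> c w)) powr m * cmod (f (\<sigma> c w))))"
        by (rule ennreal_leI)
      moreover have "Q (\<sigma> c w) = ennreal (tube_rho (\<sigma> c w) powr s / cmod (tube_rho2 z (\<sigma> c w)) powr m * cmod (f (\<sigma> c w)))"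
        using in\<sigma> by (simp add: Q_def)
      moreover have "A \<ge> 0" "C \<ge> 0" by (simp_all add: A_def C_def)
      ultimately show ?thesis
        by (simp only: ennreal_mult')
    qed
    have [measurable]: "(\<lambda>x. indicator {0..1} x * ennreal (cmod (G (?e x)))) \<in> borel_measurable borel"
    proof -
      have "continuous_on {0..1} (\<lambda>x. cmod (G (?e x)))"
        by (intro continuous_intros continuous_on_compose2[OF holomorphic_on_imp_continuous_on[OF G]]) auto
      then have "(\<lambda>x. indicator {0..1} x *\<^sub>R cmod (G (?e x))) \<in> borel_measurable borel"
        by (intro borel_measurable_continuous_on_indicator) auto
      then have "(\<lambda>x. ennreal (indicator {0..1} x *\<^sub>R cmod (G (?e x)))) \<in> borel_measurable borel"
        by (rule measurable_compose[OF _ measurable_ennreal])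
      then show ?thesis by (simp add: ennreal_mult' ennreal_indicator)
    qed
    have e2: "ennreal (2 * X) = 2 * ennreal X" for X
      by (subst ennreal_mult') auto
    have "indicator ?T w * ennreal (tube_rho w powr (s + 1) / cmod (tube_rho2 z w) powr m * cmod (deriv_last f w))
      = ennreal (2 * A) * ennreal (cmod (deriv_last f w) * r)"
      using w r by (simp add: A_def r_def powr_add ennreal_mult'[symmetric] tube_domain_iff mult_ac)
    also have "\<dots> \<le> ennreal (2 * A) * (\<integral>\<^sup>+x. indicator {0..1} x * ennreal (cmod (G (?e x))) \<partial>lborel)"
      by (intro mult_left_mono 1) simp
    also have "\<dots> = (\<integral>\<^sup>+x. ennreal (2 * A) * (indicator {0..1} x * ennreal (cmod (G (?e x)))) \<partial>lborel)"
      by (rule nn_integral_cmult[symmetric]) simp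
    also have "\<dots> \<le> (\<integral>\<^sup>+x. ennreal (2 * C) * (indicator {0..1} x * Q (\<sigma> (?e x) w)) \<partial>lborel)"
    proof (rule nn_integral_mono)
      fix x :: real
      have "2 * indicator {0..1} x * (ennreal A * ennreal (cmod (G (?e x)))) \<le> 2 * indicator {0..1} x * (ennreal C * Q (\<sigma> (?e x) w))"
        by (intro mult_left_mono 2) auto
      then show "ennreal (2 * A) * (indicator {0..1} x * ennreal (cmod (G (?e x)))) \<le> ennreal (2 * C) * (indicator {0..1} x * Q (\<sigma> (?e x) w))"
        unfolding e2 by (simp only: mult_ac)
    qed
    also have "\<dots> = ennreal (2 * C) * (\<integral>\<^sup>+x. indicator {0..1} x * Q (\<sigma> (?e x) w) \<partial>lborel)"
      unfolding \<sigma>_def by (rule nn_integral_cmult) measurable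
    finally show ?thesis .
  qed simp
  have sub: "(\<integral>\<^sup>+w. Q (\<sigma> c w) \<partial>lborel) \<le> 2 * (\<integral>\<^sup>+w. Q w \<partial>lborel)" if c: "cmod c \<le> 1" for c
  proof -
    have "(\<integral>\<^sup>+w. Q (\<sigma> c w) \<partial>lborel) \<le> (\<integral>\<^sup>+w. 2 * Q w \<partial>lborel)"
    proof (rule nn_integral_fibre_le[where k = last_index])
      show "(\<lambda>w. Q (\<sigma> c w)) \<in> borel_measurable borel" unfolding \<sigma>_def by measurable
      fix v :: "(complex, 'n) vec"
      define b where "b = (\<Sum>j\<in>rest. (Im (v $ j))\<^sup>2)"
      have "\<sigma> c (vec_upd v last_index t) = vec_upd v last_index (t + of_real ((Im t - b) / 2) * c)" for t
        by (simp add: \<sigma>_def shift_last_def tube_rho_def b_def)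
      then show "(\<integral>\<^sup>+t. Q (\<sigma> c (vec_upd v last_index t)) \<partial>lborel) \<le> (\<integral>\<^sup>+t. 2 * Q (vec_upd v last_index t) \<partial>lborel)"
        using nn_integral_shear_scale[of "\<lambda>t. Q (vec_upd v last_index t)" c b] c
        by (simp add: nn_integral_cmult)
    qed measurable
    then show ?thesis by (simp add: nn_integral_cmult)
  qed
  have "(\<integral>\<^sup>+w. indicator ?T w * ennreal (tube_rho w powr (s + 1) / cmod (tube_rho2 z w) powr m * cmod (deriv_last f w)) \<partial>lborel)
    \<le> (\<integral>\<^sup>+w. ennreal (2 * C) * (\<integral>\<^sup>+x. indicator {0..1} x * Q (\<sigma> (?e x) w) \<partial>lborel) \<partial>lborel)"
    by (intro nn_integral_mono key)
  also have "\<dots> = ennreal (2 * C) * (\<integral>\<^sup>+w. (\<integral>\<^sup>+x. indicator {0..1} x * Q (\<sigma> (?e x) w) \<partial>lborel) \<partial>lborel)"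
    unfolding \<sigma>_def by (rule nn_integral_cmult) measurable
  \<comment> \<open>After the exchange the angle is fixed in the inner integral, where
    \<open>sub\<close> applies.\<close>
  also have "(\<integral>\<^sup>+w. (\<integral>\<^sup>+x. indicator {0..1} x * Q (\<sigma> (?e x) w) \<partial>lborel) \<partial>lborel)
     = (\<integral>\<^sup>+x. (\<integral>\<^sup>+w. indicator {0..1::real} x * Q (\<sigma> (?e x) w) \<partial>lborel) \<partial>lborel)"
    unfolding \<sigma>_def by (rule lborel_pair.Fubini') measurable
  also have "\<dots> \<le> (\<integral>\<^sup>+x. indicator {0..1::real} x * (2 * (\<integral>\<^sup>+w. Q w \<partial>lborel)) \<partial>lborel)"
  proof (rule nn_integral_mono)
    fix x :: real
    have "(\<integral>\<^sup>+w. indicator {0..1::real} x * Q (\<sigma> (?e x) w) \<partial>lborel) = indicator {0..1::real} x * (\<integral>\<^sup>+w. Q (\<sigma> (?e x) w) \<partial>lborel)"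
      unfolding \<sigma>_def by (rule nn_integral_cmult) measurable
    also have "\<dots> \<le> indicator {0..1::real} x * (2 * (\<integral>\<^sup>+w. Q w \<partial>lborel))"
      by (intro mult_left_mono sub) auto
    finally show "(\<integral>\<^sup>+w. indicator {0..1::real} x * Q (\<sigma> (?e x) w) \<partial>lborel) \<le> \<dots>" .
  qed
  also have "\<dots> = 2 * (\<integral>\<^sup>+w. Q w \<partial>lborel)"
    by (subst nn_integral_multc) auto
  finally have "(\<integral>\<^sup>+w. indicator ?T w * ennreal (tube_rho w powr (s + 1) / cmod (tube_rho2 z w) powr m * cmod (deriv_last f w)) \<partial>lborel)
    \<le> ennreal (2 * C) * (2 * (\<integral>\<^sup>+w. Q w \<partial>lborel))"
    by (simp add: mult_left_mono)
  also have "\<dots> < \<infinity>"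
    using fin z by (auto simp: tube_finite_def Q_def ennreal_mult_less_top)
  finally show "(\<integral>\<^sup>+w. indicator ?T w * ennreal (tube_rho w powr (s + 1) / cmod (tube_rho2 z w) powr m * cmod (deriv_last f w)) \<partial>lborel) < \<infinity>" .
qed

section \<open>Integration along vertical rays\<close>

lemma integral_atLeast_eq_minus:
  fixes F f :: "real \<Rightarrow> complex"
  assumes int: "set_integrable lborel {0..} f"
    and der: "\<And>x. x \<ge> 0 \<Longrightarrow> (F has_vector_derivative f x) (at x)"
    and lim: "(F \<longlongrightarrow> 0) at_top"
  shows "(LINT x:{0..}|lborel. f x) = - F 0"
proof -
  have "(LINT x:{0..b}|lborel. f x) = F b - F 0" if "b \<ge> 0" for b
  proof -
    have "(f has_integral (F b - F 0)) {0..b}"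
      by (rule fundamental_theorem_of_calculus[OF that]) (auto intro!: has_vector_derivative_at_within der)
    moreover have "set_integrable lborel {0..b} f"
      by (rule set_integrable_subset[OF int]) auto
    ultimately show ?thesis
      by (simp add: set_borel_integral_eq_integral(2) integral_unique)
  qed
  then have "eventually (\<lambda>b. (LINT x:{0..b}|lborel. f x) = F b - F 0) at_top"
    by (auto simp: eventually_at_top_linorder)
  moreover have "((\<lambda>b. F b - F 0) \<longlongrightarrow> 0 - F 0) at_top"
    by (intro tendsto_intros lim)
  ultimately have "((\<lambda>b. LINT x:{0..b}|lborel. f x) \<longlongrightarrow> 0 - F 0) at_top"
    by (simp add: tendsto_cong)
  moreover have "((\<lambda>b. LINT x:{0..b}|lborel. f x) \<longlongrightarrow> (LINT x:{0..}|lborel. f x)) at_top"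
    by (rule tendsto_set_lebesgue_integral_at_top[OF _ int]) auto
  ultimately show ?thesis
    using tendsto_unique[OF trivial_limit_at_top_linorder] by fastforce
qed

text \<open>The cross term t Re X of |X + t/2|^2 is nonnegative. Going up a ray therefore only
  enlarges |rho(z, w)|, which yields both domination and decay.\<close>

lemma cmod_add_half_ge:
  assumes "Re X > 0" "t \<ge> 0"
  shows "cmod X \<le> cmod (X + of_real t / 2)" "(cmod X + t / 2) / 2 \<le> cmod (X + of_real t / 2)" "t / 2 \<le> cmod (X + of_real t / 2)"
proof -
  have "(cmod (X + of_real t / 2))\<^sup>2 = (cmod X)\<^sup>2 + t * Re X + (t / 2)\<^sup>2"
    unfolding cmod_sq by (simp add: power2_eq_square field_simps)
  moreover have "t * Re X \<ge> 0" using assms by simp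
  ultimately have sq: "(cmod X)\<^sup>2 + (t / 2)\<^sup>2 \<le> (cmod (X + of_real t / 2))\<^sup>2" by linarith
  show 1: "cmod X \<le> cmod (X + of_real t / 2)"
    by (rule power2_le_imp_le) (use sq zero_le_power2[of "t / 2"] in linarith, simp)
  show 2: "t / 2 \<le> cmod (X + of_real t / 2)"
    by (rule power2_le_imp_le) (use sq zero_le_power2[of "cmod X"] in linarith, simp)
  show "(cmod X + t / 2) / 2 \<le> cmod (X + of_real t / 2)" using 1 2 by simp
qed

lemma tendsto_neg_powr_shift:
  assumes "m > 0" "Re X > 0"
  shows "((\<lambda>t. cmod (X + of_real t / 2) powr (- m)) \<longlongrightarrow> 0) at_top"
proof (rule tendsto_neg_powr)
  show "filterlim (\<lambda>t. cmod (X + of_real t / 2)) at_top at_top"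
  proof (rule filterlim_at_top_mono)
    show "filterlim (\<lambda>t::real. (1 / 2) * t) at_top at_top"
      by (rule filterlim_tendsto_pos_mult_at_top[OF tendsto_const _ filterlim_ident]) simp
    show "\<forall>\<^sub>F t in at_top. (1 / 2) * t \<le> cmod (X + of_real t / 2)"
      using eventually_ge_at_top[of 0] by eventually_elim (use cmod_add_half_ge(3)[OF assms(2)] in simp)
  qed
qed (use assms in auto)

text \<open>A multiple of |X|^(-m) is wanted because it reduces the condition of Fubini to
  \<open>tube_finite s m\<close>. It comes from |X + t/2| \<ge> (|X| + t/2)/2, since the power of
  the right side has an explicit antiderivative.\<close>

lemma nn_integral_powr_shift:
  assumes "m > 0" "Re X > 0"
  shows "(\<integral>\<^sup>+t. indicator {0..} t * ennreal (1 / cmod (X + of_real t / 2) powr (m + 1)) \<partial>lborel)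
    \<le> ennreal (2 powr (m + 1) * (2 / m) / cmod X powr m)"
proof -
  define r where "r = cmod X"
  have r: "r > 0" using assms by (auto simp: r_def)
  have "(\<integral>\<^sup>+t. indicator {0..} t * ennreal (1 / cmod (X + of_real t / 2) powr (m + 1)) \<partial>lborel)
     \<le> (\<integral>\<^sup>+t. ennreal (2 powr (m + 1) * (r + t / 2) powr (- m - 1)) * indicator {0..} t \<partial>lborel)"
  proof (rule nn_integral_mono)
    fix t :: real
    show "indicator {0..} t * ennreal (1 / cmod (X + of_real t / 2) powr (m + 1)) 
       \<le> ennreal (2 powr (m + 1) * (r + t / 2) powr (- m - 1)) * indicator {0..} t"
    proof (cases "t \<ge> 0")
      case True
      have p: "(r + t / 2) / 2 > 0" using r True by simp
      have "((r + t / 2) / 2) powr (m + 1) \<le> cmod (X + of_real t / 2) powr (m + 1)"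
        using cmod_add_half_ge(2)[OF assms(2) True] assms p by (intro powr_mono2) (auto simp: r_def)
      then have "1 / cmod (X + of_real t / 2) powr (m + 1) \<le> 1 / ((r + t / 2) / 2) powr (m + 1)"
        using p by (intro divide_left_mono mult_pos_pos) (auto simp: less_le_trans[OF _ cmod_add_half_ge(2)[OF assms(2) True]] r_def)
      also have "\<dots> = 2 powr (m + 1) * (r + t / 2) powr (- m - 1)"
        using p powr_minus_divide[of "r + t / 2" "m + 1"] by (simp add: powr_divide)
      finally show ?thesis using True by (simp add: ennreal_leI)
    qed simp
  qed
  also have "\<dots> = ennreal (0 - (- (2 powr (m + 1) * (2 / m) * (r + 0 / 2) powr (- m))))"
  proof (rule nn_integral_FTC_atLeast)
    show "((\<lambda>t. - (2 powr (m + 1) * (2 / m) * (r + t / 2) powr (- m))) has_real_derivative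
       2 powr (m + 1) * (r + x / 2) powr (- m - 1)) (at x)" if "0 \<le> x" for x
      using that r assms by (auto intro!: derivative_eq_intros simp: field_simps)
    have "((\<lambda>t. (r + t / 2) powr (- m)) \<longlongrightarrow> 0) at_top"
    proof (rule tendsto_neg_powr)
      show "filterlim (\<lambda>t. r + t / 2) at_top at_top"
        using filterlim_tendsto_add_at_top[OF tendsto_const[of r] filterlim_tendsto_pos_mult_at_top[OF tendsto_const[of "1 / 2"] _ filterlim_ident]]
        by simp
    qed (use assms in auto)
    then have "((\<lambda>t. - (2 powr (m + 1) * (2 / m) * (r + t / 2) powr (- m))) \<longlongrightarrow> - (2 powr (m + 1) * (2 / m) * 0)) at_top"
      by (intro tendsto_intros)
    then show "((\<lambda>t. - (2 powr (m + 1) * (2 / m) * (r + t / 2) powr (- m))) \<longlongrightarrow> 0) at_top" by simp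
  qed auto
  also have "\<dots> = ennreal (2 powr (m + 1) * (2 / m) / cmod X powr m)"
    using r by (simp add: r_def powr_minus_divide)
  finally show ?thesis .
qed

lemma powr_shift_continuous:
  assumes "Re X > 0"
  shows "continuous_on {0..} (\<lambda>t. 1 / (X + of_real t / 2) powr of_real m)"
proof -
  have "X + of_real t / 2 \<notin> \<real>\<^sub>\<le>\<^sub>0" if "t \<ge> 0" for t
    using assms that by (auto simp: complex_nonpos_Reals_iff)
  moreover have "X + of_real t / 2 \<noteq> 0" if "t \<ge> 0" for t
    using assms that by (auto simp: complex_eq_iff)
  ultimately show ?thesis
    using assms by (intro continuous_intros) auto
qed

lemma integral_powr_shift:
  assumes "m > 0" "Re X > 0"
  shows "set_integrable lborel {0..} (\<lambda>t. 1 / (X + of_real t / 2) powr of_real (m + 1))"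
    and "(LINT t:{0..}|lborel. 1 / (X + of_real t / 2) powr of_real (m + 1)) = of_real (2 / m) / X powr of_real m"
proof -
  let ?f = "\<lambda>t. 1 / (X + of_real t / 2) powr of_real (m + 1)"
  show int: "set_integrable lborel {0..} ?f"
    unfolding set_integrable_def
  proof (rule integrableI_bounded)
    show "(\<lambda>t. indicator {0..} t *\<^sub>R ?f t) \<in> borel_measurable lborel"
      using borel_measurable_continuous_on_indicator[OF _ powr_shift_continuous[OF assms(2), of "m + 1"]] by simp
    have "(\<integral>\<^sup>+t. ennreal (norm (indicator {0..} t *\<^sub>R ?f t)) \<partial>lborel)
      = (\<integral>\<^sup>+t. indicator {0..} t * ennreal (1 / cmod (X + of_real t / 2) powr (m + 1)) \<partial>lborel)"
      by (intro nn_integral_cong) (auto simp: norm_divide norm_powr_real_powr' split: split_indicator)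
    also have "\<dots> < \<infinity>" by (rule le_less_trans[OF nn_integral_powr_shift[OF assms]]) simp
    finally show "(\<integral>\<^sup>+t. ennreal (norm (indicator {0..} t *\<^sub>R ?f t)) \<partial>lborel) < \<infinity>" .
  qed
  have "(LINT t:{0..}|lborel. ?f t) = - (- of_real (2 / m) * (X + of_real 0 / 2) powr (- of_real m))"
  proof (rule integral_atLeast_eq_minus[OF int])
    fix t :: real assume t: "t \<ge> 0"
    have ne: "X + of_real t / 2 \<notin> \<real>\<^sub>\<le>\<^sub>0"
      using assms t by (auto simp: complex_nonpos_Reals_iff)
    have inner: "((\<lambda>z. X + z / 2) has_field_derivative 1 / 2) (at (of_real t))"
      by (auto intro!: derivative_eq_intros)
    have "((\<lambda>z. (X + z / 2) powr (- of_real m)) has_field_derivative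
       - of_real m * (X + of_real t / 2) powr (- of_real m - 1) * (1 / 2)) (at (of_real t))"
      by (rule DERIV_chain2[where f = "\<lambda>z. z powr (- of_real m)" and g = "\<lambda>z. X + z / 2"])
         (rule has_field_derivative_powr[OF ne], rule inner)
    then have "((\<lambda>z. - of_real (2 / m) * (X + z / 2) powr (- of_real m)) has_field_derivative
       - of_real (2 / m) * (- of_real m * (X + of_real t / 2) powr (- of_real m - 1) * (1 / 2))) (at (of_real t))"
      by (rule DERIV_cmult)
    moreover have "- of_real (2 / m) * (- of_real m * (X + of_real t / 2) powr (- of_real m - 1) * (1 / 2)) = ?f t"
      using assms powr_minus_divide[of "X + of_real t / 2" "of_real (m + 1)"] by simp
    ultimately show "((\<lambda>t. - of_real (2 / m) * (X + of_real t / 2) powr (- of_real m)) has_vector_derivative ?f t) (at t)"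
      using has_vector_derivative_real_field by fastforce
  next
    have "((\<lambda>t. (2 / m) * cmod (X + of_real t / 2) powr (- m)) \<longlongrightarrow> (2 / m) * 0) at_top"
      by (intro tendsto_intros tendsto_neg_powr_shift assms)
    then show "((\<lambda>t. - of_real (2 / m) * (X + of_real t / 2) powr (- of_real m)) \<longlongrightarrow> 0) at_top"
      using assms norm_powr_real_powr'[of "- of_real m"]
      by (subst tendsto_norm_zero_iff[symmetric]) (simp add: norm_mult norm_divide)
  qed
  then show "(LINT t:{0..}|lborel. ?f t) = of_real (2 / m) / X powr of_real m"
    by (simp add: powr_minus_divide)
qed

definition tube_up :: "(complex, 'n::{finite,linorder}) vec \<Rightarrow> real \<Rightarrow> (complex, 'n::{finite,linorder}) vec" where
  "tube_up z t = shift_last z (\<i> * of_real t)"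

lemma tube_up_in: "z \<in> tube_domain \<Longrightarrow> t \<ge> 0 \<Longrightarrow> tube_up z t \<in> tube_domain"
  by (simp add: tube_up_def tube_domain_iff tube_rho_shift_last)

lemma tube_rho2_up: "tube_rho2 (tube_up z t) w = tube_rho2 z w + of_real t / 2"
  by (simp add: tube_up_def tube_rho2_shift_last_left)

text \<open>Fubini, with \<open>integral_powr_shift\<close> for the integral over the ray. Absolute
  convergence is required for the exponent \<open>m\<close> of the outcome, not for the larger
  exponent of the integrals along the ray.\<close>

lemma tube_int_up:
  fixes F :: "(complex, 'n::{finite,linorder}) vec \<Rightarrow> complex"
  assumes F: "continuous_on tube_domain F" "tube_finite s m F" and m: "m > 0" and z: "z \<in> tube_domain"
  shows "set_integrable lborel {0..} (\<lambda>t. tube_int s (m + 1) F (tube_up z t))"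
    and "(LINT t:{0..}|lborel. tube_int s (m + 1) F (tube_up z t)) = of_real (2 / m) * tube_int s m F z"
proof -
  let ?T = "tube_domain :: (complex, 'n) vec set"
  define h where "h t w = indicator {0..} t *\<^sub>R (indicator ?T w *\<^sub>R tube_kernel s (m + 1) F (tube_up z t) w)" for t :: real and w
  have h_eq: "h t w = indicator ?T w *\<^sub>R (of_real (tube_rho w powr s) * F w *
      (indicator {0..} t *\<^sub>R (1 / (tube_rho2 z w + of_real t / 2) powr of_real (m + 1))))" for t w
    by (simp add: h_def tube_kernel_def tube_rho2_up)
  have Re: "Re (tube_rho2 z w) > 0" if "w \<in> ?T" for w using tube_rho2_bounds(1)[OF z that] .
  have meas: "(\<lambda>(w, t). h t w) \<in> borel_measurable (lborel \<Otimes>\<^sub>M lborel)"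
  proof -
    have nn: "tube_rho2 z w + of_real t / 2 \<notin> \<real>\<^sub>\<le>\<^sub>0" "tube_rho2 z w + of_real t / 2 \<noteq> 0"
        "0 \<le> Re (tube_rho2 z w + of_real t / 2)" "tube_rho w \<noteq> 0"
      if "w \<in> ?T" "t \<ge> 0" for w t
    proof -
      define X where "X = tube_rho2 z w + of_real t / 2"
      have "Re X > 0" using Re[OF that(1)] that(2) by (simp add: X_def)
      then have "X \<notin> \<real>\<^sub>\<le>\<^sub>0" "X \<noteq> 0" "0 \<le> Re X" by (auto simp: complex_nonpos_Reals_iff)
      then show "tube_rho2 z w + of_real t / 2 \<notin> \<real>\<^sub>\<le>\<^sub>0" "tube_rho2 z w + of_real t / 2 \<noteq> 0"
        "0 \<le> Re (tube_rho2 z w + of_real t / 2)"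
        by (simp_all only: X_def not_False_eq_True)
      show "tube_rho w \<noteq> 0" using that by (simp add: tube_domain_iff)
    qed
    have c: "continuous_on (?T \<times> {0..}) (\<lambda>p. tube_rho2 z (fst p) + of_real (snd p) / 2)"
      by (intro continuous_intros continuous_on_compose2[OF continuous_on_tube_rho2[of UNIV]]) auto
    have "continuous_on (?T \<times> {0..}) (\<lambda>p. of_real (tube_rho (fst p) powr s) * F (fst p) *
       (1 / (tube_rho2 z (fst p) + of_real (snd p) / 2) powr of_real (m + 1)))"
      by (intro continuous_intros c continuous_on_compose2[OF F(1)] continuous_on_compose2[OF continuous_on_tube_rho[of UNIV]])
         (use nn in auto)
    then have "(\<lambda>p. indicator (?T \<times> {0..}) p *\<^sub>R (of_real (tube_rho (fst p) powr s) * F (fst p) *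
       (1 / (tube_rho2 z (fst p) + of_real (snd p) / 2) powr of_real (m + 1)))) \<in> borel_measurable borel"
      by (intro borel_measurable_continuous_on_indicator) (auto intro!: borel_Times)
    also have "(\<lambda>p. indicator (?T \<times> {0..}) p *\<^sub>R (of_real (tube_rho (fst p) powr s) * F (fst p) *
       (1 / (tube_rho2 z (fst p) + of_real (snd p) / 2) powr of_real (m + 1)))) = (\<lambda>(w, t). h t w)"
      by (auto simp: fun_eq_iff h_eq indicator_def)
    finally show ?thesis by (simp add: lborel_prod)
  qed
  have nn: "(\<integral>\<^sup>+t. ennreal (norm (h t w)) \<partial>lborel) \<le>
     ennreal (2 powr (m + 1) * (2 / m)) * (indicator ?T w * ennreal (tube_rho w powr s / cmod (tube_rho2 z w) powr m * cmod (F w)))" for w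
  proof (cases "w \<in> ?T")
    case True
    define B where "B = tube_rho w powr s * cmod (F w)"
    have B: "B \<ge> 0" by (simp add: B_def)
    have "(\<integral>\<^sup>+t. ennreal (norm (h t w)) \<partial>lborel)
      = (\<integral>\<^sup>+t. ennreal B * (indicator {0..} t * ennreal (1 / cmod (tube_rho2 z w + of_real t / 2) powr (m + 1))) \<partial>lborel)"
      using True by (intro nn_integral_cong)
        (auto simp: h_eq B_def norm_mult norm_divide norm_powr_real_powr' ennreal_mult'[symmetric] split: split_indicator)
    also have "\<dots> = ennreal B * (\<integral>\<^sup>+t. indicator {0..} t * ennreal (1 / cmod (tube_rho2 z w + of_real t / 2) powr (m + 1)) \<partial>lborel)"
      by (rule nn_integral_cmult) measurable
    also have "\<dots> \<le> ennreal B * ennreal (2 powr (m + 1) * (2 / m) / cmod (tube_rho2 z w) powr m)"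
      by (intro mult_left_mono nn_integral_powr_shift m Re True) simp
    also have "\<dots> = ennreal (2 powr (m + 1) * (2 / m)) * ennreal (tube_rho w powr s / cmod (tube_rho2 z w) powr m * cmod (F w))"
      using m B by (simp add: ennreal_mult'[symmetric] B_def mult_ac)
    finally show ?thesis using True by simp
  qed (simp add: h_eq)
  have I: "integrable (lborel \<Otimes>\<^sub>M lborel) (\<lambda>(w, t). h t w)"
  proof (rule integrableI_bounded[OF meas])
    have "(\<integral>\<^sup>+p. ennreal (norm (case p of (w, t) \<Rightarrow> h t w)) \<partial>(lborel \<Otimes>\<^sub>M lborel))
       = (\<integral>\<^sup>+w. \<integral>\<^sup>+t. ennreal (norm (h t w)) \<partial>lborel \<partial>lborel)"
      using meas by (subst lborel.nn_integral_fst[symmetric]) auto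
    also have "\<dots> \<le> (\<integral>\<^sup>+w. ennreal (2 powr (m + 1) * (2 / m)) * (indicator ?T w * ennreal (tube_rho w powr s / cmod (tube_rho2 z w) powr m * cmod (F w))) \<partial>lborel)"
      by (intro nn_integral_mono nn)
    also have "\<dots> = ennreal (2 powr (m + 1) * (2 / m)) * (\<integral>\<^sup>+w. indicator ?T w * ennreal (tube_rho w powr s / cmod (tube_rho2 z w) powr m * cmod (F w)) \<partial>lborel)"
    proof (rule nn_integral_cmult)
      have "(\<lambda>w. ennreal (norm (indicator ?T w *\<^sub>R tube_kernel s m F z w))) \<in> borel_measurable lborel"
        using borel_measurable_tube_kernel[OF F(1) z, of s m] by measurable
      also have "(\<lambda>w. ennreal (norm (indicator ?T w *\<^sub>R tube_kernel s m F z w))) =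
         (\<lambda>w. indicator ?T w * ennreal (tube_rho w powr s / cmod (tube_rho2 z w) powr m * cmod (F w)))"
        by (auto simp: fun_eq_iff norm_tube_kernel split: split_indicator)
      finally show "\<dots> \<in> borel_measurable lborel" .
    qed
    also have "\<dots> < \<infinity>"
      using F(2) z by (auto simp: tube_finite_def ennreal_mult_less_top)
    finally show "(\<integral>\<^sup>+p. ennreal (norm (case p of (w, t) \<Rightarrow> h t w)) \<partial>(lborel \<Otimes>\<^sub>M lborel)) < \<infinity>" .
  qed
  have h_t: "(\<integral>w. h t w \<partial>lborel) = indicator {0..} t *\<^sub>R tube_int s (m + 1) F (tube_up z t)" for t
    by (cases "t \<ge> 0") (simp_all add: h_def tube_int_def set_lebesgue_integral_def)
  have h_w: "(\<integral>t. h t w \<partial>lborel) = of_real (2 / m) * (indicator ?T w *\<^sub>R tube_kernel s m F z w)" for w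
  proof (cases "w \<in> ?T")
    case True
    have "(\<integral>t. h t w \<partial>lborel) = of_real (tube_rho w powr s) * F w *
      (LINT t:{0..}|lborel. 1 / (tube_rho2 z w + of_real t / 2) powr of_real (m + 1))"
      unfolding h_eq set_lebesgue_integral_def indicator_simps(1)[OF True] scaleR_one
      by (rule integral_mult_right_zero)
    also have "\<dots> = of_real (tube_rho w powr s) * F w * (of_real (2 / m) / tube_rho2 z w powr of_real m)"
      by (simp only: integral_powr_shift(2)[OF m Re[OF True]])
    finally show ?thesis
      using True by (simp add: tube_kernel_def)
  qed (simp add: h_eq)
  from lborel_pair.integrable_snd[OF I] show "set_integrable lborel {0..} (\<lambda>t. tube_int s (m + 1) F (tube_up z t))"
    unfolding set_integrable_def h_t .
  from lborel_pair.Fubini_integral[OF I]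
  show "(LINT t:{0..}|lborel. tube_int s (m + 1) F (tube_up z t)) = of_real (2 / m) * tube_int s m F z"
    unfolding h_t h_w integral_mult_right_zero by (simp only: set_lebesgue_integral_def tube_int_def)
qed

lemma tube_int_up_tendsto_0:
  fixes F :: "(complex, 'n::{finite,linorder}) vec \<Rightarrow> complex"
  assumes F: "continuous_on tube_domain F" "tube_finite s m F" and m: "m > 0" and z: "z \<in> tube_domain"
  shows "((\<lambda>t. tube_int s m F (tube_up z t)) \<longlongrightarrow> 0) at_top"
proof -
  let ?T = "tube_domain :: (complex, 'n) vec set"
  \<comment> \<open>Replacing t by max 0 t keeps the point in the domain for every real t, since
    measurability is required for all t.\<close>
  define z' where "z' t = tube_up z (max 0 t)" for t
  have z': "z' t \<in> ?T" for t unfolding z'_def by (rule tube_up_in[OF z]) simp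
  have Re: "Re (tube_rho2 z w) > 0" if "w \<in> ?T" for w using tube_rho2_bounds(1)[OF z that] .
  have "((\<lambda>t. \<integral>w. indicator ?T w *\<^sub>R tube_kernel s m F (z' t) w \<partial>lborel) \<longlongrightarrow> (\<integral>w. 0 \<partial>(lborel :: (complex, 'n) vec measure))) at_top"
  proof (rule integral_dominated_convergence_at_top)
    show "integrable lborel (\<lambda>w. norm (indicator ?T w *\<^sub>R tube_kernel s m F z w))"
      using tube_kernel_integrable[OF F z] unfolding set_integrable_def by (rule integrable_norm)
    show "(\<lambda>w. indicator ?T w *\<^sub>R tube_kernel s m F (z' t) w) \<in> borel_measurable lborel" for t
      using borel_measurable_tube_kernel[OF F(1) z'] by simp
    show "AE w in lborel. ((\<lambda>t. indicator ?T w *\<^sub>R tube_kernel s m F (z' t) w) \<longlongrightarrow> 0) at_top"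
    proof (rule AE_I2)
      fix w
      show "((\<lambda>t. indicator ?T w *\<^sub>R tube_kernel s m F (z' t) w) \<longlongrightarrow> 0) at_top"
      proof (cases "w \<in> ?T")
        case True
        have "((\<lambda>t. tube_rho w powr s * cmod (F w) * cmod (tube_rho2 z w + of_real t / 2) powr (- m)) \<longlongrightarrow>
            tube_rho w powr s * cmod (F w) * 0) at_top"
          by (intro tendsto_intros tendsto_neg_powr_shift m Re True)
        then have "((\<lambda>t. tube_rho w powr s * cmod (F w) * cmod (tube_rho2 z w + of_real t / 2) powr (- m)) \<longlongrightarrow> 0) at_top"
          by simp
        moreover have "\<forall>\<^sub>F t in at_top. tube_rho w powr s * cmod (F w) * cmod (tube_rho2 z w + of_real t / 2) powr (- m)
            = norm (tube_kernel s m F (z' t) w)"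
          using eventually_ge_at_top[of 0]
          by eventually_elim (simp add: norm_tube_kernel z'_def tube_rho2_up max_def powr_minus_divide)
        ultimately have "((\<lambda>t. norm (tube_kernel s m F (z' t) w)) \<longlongrightarrow> 0) at_top"
          by (rule Lim_transform_eventually)
        then show ?thesis using True by (simp add: tendsto_norm_zero_iff)
      qed simp
    qed
    show "\<forall>\<^sub>F t in at_top. AE w in lborel. norm (indicator ?T w *\<^sub>R tube_kernel s m F (z' t) w)
       \<le> norm (indicator ?T w *\<^sub>R tube_kernel s m F z w)"
    proof (intro always_eventually allI AE_I2)
      fix t w
      show "norm (indicator ?T w *\<^sub>R tube_kernel s m F (z' t) w) \<le> norm (indicator ?T w *\<^sub>R tube_kernel s m F z w)"
      proof (cases "w \<in> ?T")
        case True
        have "cmod (tube_rho2 z w) powr m \<le> cmod (tube_rho2 (z' t) w) powr m"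
          unfolding z'_def tube_rho2_up using m cmod_add_half_ge(1)[OF Re[OF True], of "max 0 t"]
          by (intro powr_mono2) auto
        moreover have "cmod (tube_rho2 z w) powr m > 0" "cmod (tube_rho2 (z' t) w) powr m > 0"
          using tube_rho2_bounds(2)[OF z True] tube_rho2_bounds(2)[OF z' True] by simp_all
        ultimately show ?thesis
          using True by (auto simp: norm_tube_kernel intro!: mult_right_mono divide_left_mono)
      qed simp
    qed
  qed auto
  then have "((\<lambda>t. tube_int s m F (z' t)) \<longlongrightarrow> 0) at_top"
    by (simp add: tube_int_def set_lebesgue_integral_def)
  moreover have "\<forall>\<^sub>F t in at_top. tube_int s m F (z' t) = tube_int s m F (tube_up z t)"
    using eventually_ge_at_top[of 0] by eventually_elim (simp add: z'_def max_def)
  ultimately show ?thesis by (rule Lim_transform_eventually)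
qed

text \<open>For fixed \<open>z\<close> the modulus of rho(z, w) is at least rho(z)/2, so one more
  power in the denominator costs the constant 2/rho(z). The inductive hypothesis, with its larger
  kernel exponent, becomes applicable in this way.\<close>

lemma tube_finite_Suc_exponent:
  fixes f :: "(complex, 'n::{finite,linorder}) vec \<Rightarrow> complex"
  assumes f: "continuous_on tube_domain f" and fin: "tube_finite s m f"
  shows "tube_finite s (m + 1) f"
  unfolding tube_finite_def
proof
  let ?T = "tube_domain :: (complex, 'n) vec set"
  fix z assume z: "z \<in> ?T"
  let ?Q = "\<lambda>w. indicator ?T w * ennreal (tube_rho w powr s / cmod (tube_rho2 z w) powr m * cmod (f w))"
  have Q: "?Q \<in> borel_measurable lborel"
  proof -
    have "(\<lambda>w. ennreal (norm (indicator ?T w *\<^sub>R tube_kernel s m f z w))) \<in> borel_measurable lborel"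
      using borel_measurable_tube_kernel[OF f z, of s m] by measurable
    also have "(\<lambda>w. ennreal (norm (indicator ?T w *\<^sub>R tube_kernel s m f z w))) = ?Q"
      by (auto simp: fun_eq_iff norm_tube_kernel split: split_indicator)
    finally show ?thesis .
  qed
  have "(\<integral>\<^sup>+w. indicator ?T w * ennreal (tube_rho w powr s / cmod (tube_rho2 z w) powr (m + 1) * cmod (f w)) \<partial>lborel)
    \<le> (\<integral>\<^sup>+w. ennreal (2 / tube_rho z) * ?Q w \<partial>lborel)"
  proof (rule nn_integral_mono)
    fix w
    show "indicator ?T w * ennreal (tube_rho w powr s / cmod (tube_rho2 z w) powr (m + 1) * cmod (f w)) \<le> ennreal (2 / tube_rho z) * ?Q w"
    proof (cases "w \<in> ?T")
      case True
      note b = tube_rho2_bounds[OF z True]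
      have "1 / cmod (tube_rho2 z w) \<le> 2 / tube_rho z" using b by (simp add: field_simps)
      from mult_left_mono[OF this, of "tube_rho w powr s / cmod (tube_rho2 z w) powr m * cmod (f w)"]
      have "tube_rho w powr s / cmod (tube_rho2 z w) powr (m + 1) * cmod (f w)
        \<le> 2 / tube_rho z * (tube_rho w powr s / cmod (tube_rho2 z w) powr m * cmod (f w))"
        using b by (simp add: powr_add mult_ac)
      then show ?thesis using True b(6) by (simp add: ennreal_mult'[symmetric] ennreal_leI)
    qed simp
  qed
  also have "\<dots> = ennreal (2 / tube_rho z) * (\<integral>\<^sup>+w. ?Q w \<partial>lborel)"
    by (rule nn_integral_cmult[OF Q])
  also have "\<dots> < \<infinity>" using fin z by (auto simp: tube_finite_def ennreal_mult_less_top)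
  finally show "(\<integral>\<^sup>+w. indicator ?T w * ennreal (tube_rho w powr s / cmod (tube_rho2 z w) powr (m + 1) * cmod (f w)) \<partial>lborel) < \<infinity>" .
qed

section \<open>Induction on the order of the derivative\<close>

lemma holo_tube_deriv_last_pow: "holo_tube f \<Longrightarrow> holo_tube ((deriv_last ^^ N) f)"
  by (induction N) (auto intro: holo_tube_deriv_last)

lemma tube_finite_deriv_last_pow:
  assumes "holo_tube f" "tube_finite s m f" "m \<ge> 0"
  shows "tube_finite (s + real N) m ((deriv_last ^^ N) f)"
proof (induction N)
  case (Suc N)
  have "tube_finite (s + real N + 1) m (deriv_last ((deriv_last ^^ N) f))"
    by (rule tube_finite_deriv_last[OF holo_tube_deriv_last_pow[OF assms(1)] Suc assms(3)])
  then show ?case by (simp add: add_ac)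
qed (use assms in simp)

lemma deriv_last_up:
  assumes "holo_tube f" "z \<in> tube_domain" "t \<ge> 0"
  shows "((\<lambda>t. f (tube_up z t)) has_vector_derivative \<i> * deriv_last f (tube_up z t)) (at t)"
proof -
  have T: "tube_up z t \<in> tube_domain" by (rule tube_up_in[OF assms(2,3)])
  have eq: "f (shift_last (tube_up z t) (\<i> * (u - of_real t))) = f (shift_last z (\<i> * u))" for u
    by (rule arg_cong[where f = f]) (simp add: vec_eq_iff shift_last_nth tube_up_def algebra_simps)
  have "((\<lambda>u. f (shift_last (tube_up z t) u)) has_field_derivative deriv_last f (tube_up z t)) (at (\<i> * (of_real t - of_real t)))"
    using deriv_last_shift[OF assms(1) T] by simp
  moreover have "((\<lambda>u. \<i> * (u - of_real t)) has_field_derivative \<i>) (at (of_real t))"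
    by (auto intro!: derivative_eq_intros)
  ultimately have "((\<lambda>u. f (shift_last (tube_up z t) (\<i> * (u - of_real t)))) has_field_derivative deriv_last f (tube_up z t) * \<i>) (at (of_real t))"
    by (rule DERIV_chain2[where f = "\<lambda>u. f (shift_last (tube_up z t) u)" and g = "\<lambda>u. \<i> * (u - of_real t)"])
  then have "((\<lambda>u. f (shift_last z (\<i> * u))) has_field_derivative deriv_last f (tube_up z t) * \<i>) (at (of_real t))"
    unfolding eq .
  from has_vector_derivative_real_field[OF this, of UNIV] show ?thesis
    by (simp add: tube_up_def mult.commute)
qed

lemma tube_int_deriv_formula:
  fixes f :: "(complex, 'n::{finite,linorder}) vec \<Rightarrow> complex"
  assumes "holo_tube f" "tube_finite a (real CARD('n) + 1 + a) f" "a > -1" "z \<in> tube_domain"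
  shows "tube_int (a + real N) (real CARD('n) + 1 + a) ((deriv_last ^^ N) f) z
    = of_real (2 ^ (CARD('n) + 1) * pi ^ CARD('n) * Gamma (1 + a + real N) / Gamma (real CARD('n) + 1 + a)) * (\<i> / 2) ^ N * f z"
  using assms
proof (induction N arbitrary: a f z)
  case 0
  then show ?case using reproducing_formula[OF 0] by (simp add: add_ac)
next
  case (Suc N)
  let ?n = "CARD('n)"
  define m where "m = real ?n + 1 + a"
  define g where "g = deriv_last f"
  define F where "F = (deriv_last ^^ N) g"
  define c where "c = complex_of_real (2 ^ (?n + 1) * pi ^ ?n * Gamma (1 + (a + 1) + real N) / Gamma (real ?n + 1 + (a + 1))) * (\<i> / 2) ^ N"
  note f = Suc.prems(1) and z = Suc.prems(4) and a = Suc.prems(3)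
  have m: "m > 0" using a by (simp add: m_def)
  have finf: "tube_finite a m f" using Suc.prems(2) by (simp add: m_def)
  have cf: "continuous_on tube_domain f" using f by (simp add: holo_tube_def)
  have g: "holo_tube g" unfolding g_def by (rule holo_tube_deriv_last[OF f])
  have cg: "continuous_on tube_domain g" using g by (simp add: holo_tube_def)
  have fing: "tube_finite (a + 1) m g"
    unfolding g_def by (rule tube_finite_deriv_last[OF f finf]) (use m in simp)
  have "tube_finite (a + 1) (real ?n + 1 + (a + 1)) g"
    using tube_finite_Suc_exponent[OF cg fing] by (simp add: m_def add_ac)
  then have IH: "tube_int (a + 1 + real N) (m + 1) F y = c * g y" if "y \<in> tube_domain" for y
    using Suc.IH[OF g _ _ that, of "a + 1"] a by (simp add: F_def m_def c_def add_ac)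
  have "holo_tube F" unfolding F_def by (rule holo_tube_deriv_last_pow[OF g])
  then have cF: "continuous_on tube_domain F" by (simp add: holo_tube_def)
  \<comment> \<open>The kernel exponent stays at \<open>m\<close>, the one left after the
    integration over the ray.\<close>
  have finF: "tube_finite (a + 1 + real N) m F"
    unfolding F_def by (rule tube_finite_deriv_last_pow[OF g fing]) (use m in simp)
  have "Gamma (1 + (a + 1) + real N) > 0" "Gamma (real ?n + 1 + (a + 1)) > 0" "Gamma (a + 1) > 0" "Gamma m > 0"
    using a m by (auto intro!: Gamma_real_pos)
  note Gp = this[THEN less_imp_neq, symmetric]
  have c0: "c \<noteq> 0"
    unfolding c_def using Gp by (simp del: of_real_mult of_real_divide of_real_power)
  define C where "C = complex_of_real (2 ^ (?n + 1) * pi ^ ?n * Gamma (a + 1) / Gamma m)"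
  have C0: "C \<noteq> 0"
    unfolding C_def using Gp by (simp del: of_real_mult of_real_divide of_real_power)
  have rf: "tube_int a m f y = C * f y" if "y \<in> tube_domain" for y
    using reproducing_formula[OF f _ a that] finf by (simp add: C_def m_def)
  have lim: "((\<lambda>t. f (tube_up z t)) \<longlongrightarrow> 0) at_top"
  proof -
    have "((\<lambda>t. tube_int a m f (tube_up z t) / C) \<longlongrightarrow> 0 / C) at_top"
      by (intro tendsto_intros tube_int_up_tendsto_0 cf finf m z C0)
    moreover have "\<forall>\<^sub>F t in at_top. tube_int a m f (tube_up z t) / C = f (tube_up z t)"
      using eventually_ge_at_top[of 0] by eventually_elim (simp add: rf tube_up_in z C0)
    ultimately show ?thesis by (simp add: Lim_transform_eventually)
  qed
  have up: "indicator {0..} t *\<^sub>R tube_int (a + 1 + real N) (m + 1) F (tube_up z t) = c * (indicator {0..} t *\<^sub>R g (tube_up z t))" for t :: real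
    by (auto simp: IH tube_up_in z split: split_indicator)
  \<comment> \<open>Integrability of \<open>g\<close> on the ray is inherited from
    \<open>tube_int_up\<close> because c is not 0; no estimate of \<open>g\<close> itself is
    needed.\<close>
  have "integrable lborel (\<lambda>t. c * (indicator {0..} t *\<^sub>R g (tube_up z t)))"
    using tube_int_up(1)[OF cF finF m z] unfolding set_integrable_def up .
  from integrable_mult_right[OF this, of "inverse c"]
  have "set_integrable lborel {0..} (\<lambda>t. g (tube_up z t))"
    unfolding set_integrable_def by (simp only: mult.assoc[symmetric] left_inverse[OF c0] mult_1_left)
  then have int: "set_integrable lborel {0..} (\<lambda>t. \<i> * g (tube_up z t))"
    by (rule set_integrable_mult_right)
  have "(LINT t:{0..}|lborel. \<i> * g (tube_up z t)) = - f (tube_up z 0)"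
    by (rule integral_atLeast_eq_minus[OF int]) (auto intro: deriv_last_up[OF f z, folded g_def] lim)
  then have I: "(LINT t:{0..}|lborel. g (tube_up z t)) = \<i> * f z"
    by (simp add: tube_up_def complex_eq_iff)
  have "of_real (2 / m) * tube_int (a + 1 + real N) m F z = c * (\<i> * f z)"
  proof -
    have "of_real (2 / m) * tube_int (a + 1 + real N) m F z = (\<integral>t. c * (indicator {0..} t *\<^sub>R g (tube_up z t)) \<partial>lborel)"
      using tube_int_up(2)[OF cF finF m z] unfolding set_lebesgue_integral_def up by (rule sym)
    also have "\<dots> = c * (\<integral>t. indicator {0..} t *\<^sub>R g (tube_up z t) \<partial>lborel)"
      by (rule integral_mult_right_zero)
    also have "(\<integral>t. indicator {0..} t *\<^sub>R g (tube_up z t) \<partial>lborel) = \<i> * f z"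
      using I unfolding set_lebesgue_integral_def .
    finally show ?thesis .
  qed
  then have "tube_int (a + 1 + real N) m F z = of_real (m / 2) * (c * (\<i> * f z))"
    using m by (simp add: field_simps)
  \<comment> \<open>From m/2 the factor m turns 1/Gamma (m + 1) into 1/Gamma m, and the 1/2 joins i
    to form the new factor i/2.\<close>
  also have "\<dots> = of_real (2 ^ (?n + 1) * pi ^ ?n * Gamma (1 + a + real (Suc N)) / Gamma m) * (\<i> / 2) ^ Suc N * f z"
  proof -
    have "real ?n + 1 + (a + 1) = m + 1" by (simp add: m_def)
    moreover have "Gamma (m + 1) = m * Gamma m" using m by (intro Gamma_plus1) auto
    moreover have "1 + (a + 1) + real N = 1 + a + real (Suc N)" by simp
    ultimately show ?thesis
      unfolding c_def using m by (simp only:) (simp add: field_simps)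
  qed
  finally show ?case
    by (simp add: F_def g_def m_def funpow_swap1 add_ac)
qed

section \<open>Integrability of Bergman functions\<close>

lemma nn_integral_one_plus_abs_powr:
  fixes d :: real
  assumes "d > 0"
  shows "(\<integral>\<^sup>+x. ennreal ((1 + \<bar>x\<bar>) powr (- 1 - d)) \<partial>lborel) < \<infinity>"
proof -
  let ?g = "\<lambda>x::real. ennreal ((1 + x) powr (- 1 - d)) * indicator {0..} x"
  have "((\<lambda>x. (1 + x) powr (- d)) \<longlongrightarrow> 0) at_top"
  proof (rule tendsto_neg_powr)
    show "filterlim (\<lambda>x::real. 1 + x) at_top at_top"
      by (rule filterlim_tendsto_add_at_top[OF tendsto_const filterlim_ident])
  qed (use assms in auto)
  then have "((\<lambda>x. - (1 / d) * (1 + x) powr (- d)) \<longlongrightarrow> - (1 / d) * 0) at_top"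
    by (intro tendsto_intros)
  then have lim: "((\<lambda>x. - (1 / d) * (1 + x) powr (- d)) \<longlongrightarrow> 0) at_top" by simp
  have "(\<integral>\<^sup>+x. ?g x \<partial>lborel) = ennreal (0 - (- (1 / d) * (1 + 0) powr (- d)))"
  proof (rule nn_integral_FTC_atLeast[OF _ _ _ lim])
    show "((\<lambda>x. - (1 / d) * (1 + x) powr (- d)) has_real_derivative (1 + x) powr (- 1 - d)) (at x)" if "0 \<le> x" for x
    proof -
      have e: "- 1 - d = - d - 1" by simp
      show ?thesis
        unfolding e using that assms by (auto intro!: derivative_eq_intros)
    qed
  qed auto
  then have g: "(\<integral>\<^sup>+x. ?g x \<partial>lborel) < \<infinity>" by simp
  have "(\<integral>\<^sup>+x. ?g x \<partial>lborel) = (\<integral>\<^sup>+x. ?g (- x) \<partial>lborel)"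
    using nn_integral_real_affine[of ?g "-1" 0] by simp
  with g have g': "(\<integral>\<^sup>+x. ?g (- x) \<partial>lborel) < \<infinity>" by simp
  have "(\<integral>\<^sup>+x. ennreal ((1 + \<bar>x\<bar>) powr (- 1 - d)) \<partial>lborel) \<le> (\<integral>\<^sup>+x. ?g x + ?g (- x) \<partial>lborel)"
    by (rule nn_integral_mono) (auto simp: indicator_def)
  also have "\<dots> = (\<integral>\<^sup>+x. ?g x \<partial>lborel) + (\<integral>\<^sup>+x. ?g (- x) \<partial>lborel)"
    by (rule nn_integral_add) auto
  also have "\<dots> < \<infinity>" using g g' by simp
  finally show ?thesis .
qed

text \<open>Near 0 the integrand is controlled by x^s with s > -1, at infinity it behaves like
  x^(-1-d) with d > 0; the two regimes are separated at 1.\<close>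

lemma nn_integral_powr_ratio:
  fixes d s :: real
  assumes d: "d > 0" and s: "s > -1"
  shows "(\<integral>\<^sup>+x. indicator {0<..} x * ennreal (x powr s * (1 + x) powr (- (s + 1 + d))) \<partial>lborel) < \<infinity>"
proof -
  have "(\<integral>\<^sup>+x. indicator {0<..} x * ennreal (x powr s * (1 + x) powr (- (s + 1 + d))) \<partial>lborel)
    \<le> (\<integral>\<^sup>+x. ennreal (indicator {0..1} x * x powr s) + ennreal (2 powr \<bar>s\<bar>) * ennreal ((1 + \<bar>x\<bar>) powr (- 1 - d)) \<partial>lborel)"
  proof (rule nn_integral_mono)
    fix x :: real
    consider "x \<le> 0" | "0 < x" "x \<le> 1" | "1 < x" by linarith
    then show "indicator {0<..} x * ennreal (x powr s * (1 + x) powr (- (s + 1 + d)))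
      \<le> ennreal (indicator {0..1} x * x powr s) + ennreal (2 powr \<bar>s\<bar>) * ennreal ((1 + \<bar>x\<bar>) powr (- 1 - d))"
    proof cases
      case 2
      have "(1 + x) powr (- (s + 1 + d)) \<le> (1 + x) powr 0"
        using 2 assms by (intro powr_mono) auto
      then have "x powr s * (1 + x) powr (- (s + 1 + d)) \<le> x powr s"
        using mult_left_mono[of _ 1 "x powr s"] 2 by simp
      then have "ennreal (x powr s * (1 + x) powr (- (s + 1 + d))) \<le> ennreal (x powr s)" by (rule ennreal_leI)
      then show ?thesis using 2 by (simp add: add_increasing2)
    next
      case 3
      have "x powr s \<le> 2 powr \<bar>s\<bar> * (1 + x) powr s"
      proof (cases "s \<ge> 0")
        case True
        then have "x powr s \<le> (1 + x) powr s" using 3 by (intro powr_mono2) auto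
        also have "\<dots> \<le> 2 powr \<bar>s\<bar> * (1 + x) powr s"
          using mult_right_mono[of 1 "2 powr \<bar>s\<bar>" "(1 + x) powr s"] ge_one_powr_ge_zero[of 2 "\<bar>s\<bar>"] by simp
        finally show ?thesis .
      next
        case False
        then have "x powr s \<le> ((1 + x) / 2) powr s" using 3 by (intro powr_mono2') auto
        also have "\<dots> = 2 powr \<bar>s\<bar> * (1 + x) powr s"
          using False 3 by (simp add: powr_divide powr_minus field_simps)
        finally show ?thesis .
      qed
      then have "x powr s * (1 + x) powr (- (s + 1 + d)) \<le> 2 powr \<bar>s\<bar> * (1 + x) powr s * (1 + x) powr (- (s + 1 + d))"
        by (rule mult_right_mono) simp
      also have "\<dots> = 2 powr \<bar>s\<bar> * (1 + \<bar>x\<bar>) powr (- 1 - d)"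
        using 3 by (simp add: mult.assoc powr_add[symmetric])
      finally have "ennreal (x powr s * (1 + x) powr (- (s + 1 + d))) \<le> ennreal (2 powr \<bar>s\<bar> * (1 + \<bar>x\<bar>) powr (- 1 - d))"
        by (rule ennreal_leI)
      then show ?thesis using 3 by (simp add: ennreal_mult')
    qed simp
  qed
  also have "\<dots> = (\<integral>\<^sup>+x. ennreal (indicator {0..1} x * x powr s) \<partial>lborel) +
     ennreal (2 powr \<bar>s\<bar>) * (\<integral>\<^sup>+x. ennreal ((1 + \<bar>x\<bar>) powr (- 1 - d)) \<partial>lborel)"
    by (simp add: nn_integral_add nn_integral_cmult)
  also have "(\<integral>\<^sup>+x. ennreal (indicator {0..1} x * x powr s) \<partial>lborel) = ennreal (integral {0..1} (\<lambda>x. x powr s))"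
    by (rule nn_integral_has_integral_lebesgue)
       (use integrable_on_powr_from_0[OF s, of 1] in \<open>auto intro: integrable_integral\<close>)
  also have "ennreal (integral {0..1} (\<lambda>x. x powr s)) + ennreal (2 powr \<bar>s\<bar>) * (\<integral>\<^sup>+x. ennreal ((1 + \<bar>x\<bar>) powr (- 1 - d)) \<partial>lborel) < \<infinity>"
    using nn_integral_one_plus_abs_powr[OF d] by (simp add: ennreal_mult_less_top)
  finally show ?thesis .
qed

lemma prod_mono_ennreal:
  fixes f g :: "'b \<Rightarrow> ennreal"
  assumes "\<And>k. k \<in> A \<Longrightarrow> f k \<le> g k"
  shows "prod f A \<le> prod g A"
  using assms by (induction A rule: infinite_finite_induct) (auto intro!: mult_mono)

text \<open>
  After a change of variables, \<open>|\<rho>(z,w)|\<close> dominates each of \<open>1 + Im v_n\<close>, \<open>1 + |Re v_n|\<close>, \<open>(1 + |Re v_k|)\<^sup>2\<close>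
  and \<open>(1 + |Im v_k|)\<^sup>2\<close>. Its power \<open>-\<tau>\<close> is therefore bounded by a product of functions of one real
  variable, with the excess of \<open>\<tau>\<close> over \<open>\<sigma> + n + 1\<close> shared equally among the factors.
\<close>

lemma forelli_rudin_finite:
  fixes z :: "(complex, 'n::{finite,linorder}) vec"
  assumes z: "z \<in> tube_domain" and s: "\<sigma> > -1" and t: "\<tau> > \<sigma> + real CARD('n) + 1"
  shows "(\<integral>\<^sup>+w. indicator tube_domain w * ennreal (tube_rho w powr \<sigma> / cmod (tube_rho2 z w) powr \<tau>) \<partial>lborel) < \<infinity>"
proof -
  let ?l = "last_index :: 'n" and ?T = "tube_domain :: (complex, 'n) vec set" and ?n = "CARD('n)"
  define r where "r = tube_rho z"
  have r: "r > 0" using z by (simp add: r_def tube_domain_iff)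
  \<comment> \<open>There are n + 1 shares: one each for Re v_n and Im v_n, and one for every other
    coordinate, halved between its real and imaginary parts.\<close>
  define d where "d = (\<tau> - \<sigma> - real ?n - 1) / (real ?n + 1)"
  have d: "d > 0" using t by (simp add: d_def)
  have d_eq: "\<tau> = \<sigma> + real ?n + 1 + (real ?n + 1) * d" by (simp add: d_def)
  have tau: "\<tau> > 0" using s t by simp
  define F where "F w = indicator ?T w * ennreal (tube_rho w powr \<sigma> / cmod (tube_rho2 z w) powr \<tau>)" for w
  have [measurable]: "F \<in> borel_measurable borel" unfolding F_def[abs_def] by measurable
  define S where "S v = (\<Sum>k\<in>rest. (cmod (v $ k))\<^sup>2)" for v :: "(complex, 'n) vec"
  have [measurable]: "S \<in> borel_measurable borel" unfolding S_def[abs_def] by measurable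
  \<comment> \<open>The imaginary part of this shift turns rho into Im v_n itself, and the real part
    centres the kernel at Re v_n = 0.\<close>
  define c where "c v = of_real (Re (base_pt z)) + \<i> * of_real (S v / 2)" for v
  have [measurable]: "c \<in> borel_measurable borel" unfolding c_def[abs_def] by measurable
  define v' where "v' v = vec_upd v ?l (v $ ?l + c v)" for v
  have [measurable]: "v' \<in> borel \<rightarrow>\<^sub>M borel" unfolding v'_def[abs_def] by measurable
  have S_upd: "S (vec_upd v ?l t) = S v" for v t
    unfolding S_def by (rule sum.cong) auto
  have "(\<integral>\<^sup>+w. F w \<partial>lborel) = (\<integral>\<^sup>+v. F (heis z v) \<partial>lborel)"
    by (rule nn_integral_heis[symmetric]) simp
  also have "\<dots> = (\<integral>\<^sup>+v. F (heis z (v' v)) \<partial>lborel)"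
  proof (rule nn_integral_fibre_eq[where k = ?l])
    fix v
    have "v' (vec_upd v ?l t) = vec_upd v ?l (t + c v)" for t
      by (simp add: v'_def c_def S_upd)
    then show "(\<integral>\<^sup>+t. F (heis z (vec_upd v ?l t)) \<partial>lborel) = (\<integral>\<^sup>+t. F (heis z (v' (vec_upd v ?l t))) \<partial>lborel)"
      using nn_integral_complex_translate[of "\<lambda>t. F (heis z (vec_upd v ?l t))" "c v"] by simp
  qed measurable
  finally have step1: "(\<integral>\<^sup>+w. F w \<partial>lborel) = (\<integral>\<^sup>+v. F (heis z (v' v)) \<partial>lborel)" .
  \<comment> \<open>For A = |rho(z, w)| one has 2 \<le> (4/r) A and S \<le> 4 A, so (1 + |y|)^2
    \<le> 2 + 2 y^2 \<le> M A whenever y^2 \<le> S. The same constant serves the other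
    bounds.\<close>
  define M where "M = 4 / r + 8"
  have M: "M > 0" using r by (simp add: M_def add_pos_pos)
  define \<phi> where "\<phi> b x = (if b = axis ?l \<i> then indicator {0<..} x * ennreal (x powr \<sigma> * (1 + x) powr (- (\<sigma> + 1 + d)))
      else ennreal ((1 + \<bar>x\<bar>) powr (- 1 - d)))" for b :: "(complex, 'n) vec" and x :: real
  have bound: "F (heis z (v' v)) \<le> ennreal (M powr \<tau>) * (\<Prod>b\<in>Basis. \<phi> b (v \<bullet> b))" for v
  proof (cases "Im (v $ ?l) > 0")
    case False
    have "tube_rho (heis z (v' v)) = Im (v $ ?l)"
      by (simp add: tube_rho_heis v'_def c_def S_def)
    then show ?thesis using False by (simp add: F_def tube_domain_iff)
  next
    case True
    have rho: "tube_rho (heis z (v' v)) = Im (v $ ?l)"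
      by (simp add: tube_rho_heis v'_def c_def S_def)
    define K where "K = tube_rho2 z (heis z (v' v))"
    have "u / (2 * \<i>) = - (\<i> / 2) * u" for u
      by (simp add: divide_eq_eq complex_eq_iff)
    then have Kc: "K = - (\<i> / 2) * (base_pt z - cnj (v $ ?l + c v))"
      by (simp add: K_def tube_rho2_heis v'_def)
    have ReK: "Re K = (r + Im (v $ ?l)) / 2 + S v / 4"
      unfolding Kc c_def r_def Im_base_pt[symmetric] by (simp add: field_simps)
    have ImK: "Im K = Re (v $ ?l) / 2"
      unfolding Kc c_def by (simp add: field_simps)
    have S0: "(cmod (v $ k))\<^sup>2 \<le> S v" if "k \<noteq> ?l" for k
      unfolding S_def by (rule member_le_sum) (use that in auto)
    have "S v \<ge> 0" unfolding S_def by (intro sum_nonneg) auto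
    define A where "A = cmod K"
    have A1: "r \<le> 2 * A" "Im (v $ ?l) \<le> 2 * A" "S v \<le> 4 * A"
      using complex_Re_le_cmod[of K] ReK r True \<open>S v \<ge> 0\<close> by (auto simp: A_def field_simps)
    have A2: "\<bar>Re (v $ ?l)\<bar> \<le> 2 * A" using abs_Im_le_cmod[of K] ImK by (simp add: A_def)
    have A: "A > 0" using A1 r by linarith
    have one: "2 \<le> 4 / r * A" using A1(1) r by (simp add: field_simps)
    have MA: "M * A = 4 / r * A + 8 * A" by (simp add: M_def algebra_simps)
    have b1: "1 + Im (v $ ?l) \<le> M * A" unfolding MA using one A1 A by linarith
    have b2: "1 + \<bar>Re (v $ ?l)\<bar> \<le> M * A" unfolding MA using one A2 A by linarith
    have b3: "(1 + \<bar>y\<bar>)\<^sup>2 \<le> M * A" if "y\<^sup>2 \<le> S v" for y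
    proof -
      have "(1 + \<bar>y\<bar>)\<^sup>2 \<le> 2 + 2 * y\<^sup>2"
        using sum_squares_bound[of 1 "\<bar>y\<bar>"] by (simp add: power2_sum)
      then show ?thesis unfolding MA using that one A1 by linarith
    qed
    have sq: "(Re (v $ k))\<^sup>2 \<le> S v" "(Im (v $ k))\<^sup>2 \<le> S v" if "k \<noteq> ?l" for k
      using S0[OF that] by (auto simp: cmod_power2 intro: order_trans[rotated])
    define x where "x = M * A"
    have x: "x > 0" using M A by (simp add: x_def)
    have e0: "x powr (- (\<sigma> + 1 + d)) \<le> (1 + Im (v $ ?l)) powr (- (\<sigma> + 1 + d))"
      by (rule powr_mono2') (use True b1 s d in \<open>auto simp: x_def\<close>)
    have e1: "x powr (- 1 - d) \<le> (1 + \<bar>Re (v $ ?l)\<bar>) powr (- 1 - d)"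
      by (rule powr_mono2') (use b2 d in \<open>auto simp: x_def\<close>)
    \<comment> \<open>Half of the exponent is enough because \<open>x\<close> bounds the square of 1
      + |y|.\<close>
    have e2: "x powr (- (1 + d) / 2) \<le> (1 + \<bar>y\<bar>) powr (- 1 - d)" if "y\<^sup>2 \<le> S v" for y
    proof -
      have "x powr (- (1 + d) / 2) \<le> ((1 + \<bar>y\<bar>)\<^sup>2) powr (- (1 + d) / 2)"
        by (rule powr_mono2') (use b3[OF that] d in \<open>auto simp: x_def\<close>)
      also have "((1 + \<bar>y\<bar>)\<^sup>2) powr (- (1 + d) / 2) = (1 + \<bar>y\<bar>) powr (2 * (- (1 + d) / 2))"
        by (simp add: powr_powr flip: powr_numeral)
      also have "2 * (- (1 + d) / 2) = - 1 - d" by simp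
      finally show ?thesis .
    qed
    define \<psi> where "\<psi> k = (if k = ?l then Im (v $ ?l) powr \<sigma> * x powr (- (\<sigma> + 1 + d)) * x powr (- 1 - d) else x powr (- 1 - d))" for k
    have "(\<Prod>k\<in>UNIV. ennreal (\<psi> k)) \<le> (\<Prod>k\<in>UNIV. \<phi> (axis k 1) (v \<bullet> axis k 1) * \<phi> (axis k \<i>) (v \<bullet> axis k \<i>))"
    proof (rule prod_mono_ennreal)
      fix k :: 'n
      show "ennreal (\<psi> k) \<le> \<phi> (axis k 1) (v \<bullet> axis k 1) * \<phi> (axis k \<i>) (v \<bullet> axis k \<i>)"
      proof (cases "k = ?l")
        case k: True
        have "\<psi> k \<le> (1 + \<bar>Re (v $ ?l)\<bar>) powr (- 1 - d) * (Im (v $ ?l) powr \<sigma> * (1 + Im (v $ ?l)) powr (- (\<sigma> + 1 + d)))"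
          using mult_mono[OF e1 mult_left_mono[OF e0, of "Im (v $ ?l) powr \<sigma>"]]
          by (simp add: \<psi>_def k mult_ac)
        then show ?thesis
          using True by (simp add: \<phi>_def k axis_eq_axis inner_axis ennreal_mult'[symmetric] ennreal_leI complex_eq_iff)
      next
        case False
        have "x powr (- 1 - d) = x powr (- (1 + d) / 2) * x powr (- (1 + d) / 2)"
          by (simp add: powr_add[symmetric])
        also have "\<dots> \<le> (1 + \<bar>Re (v $ k)\<bar>) powr (- 1 - d) * (1 + \<bar>Im (v $ k)\<bar>) powr (- 1 - d)"
          by (intro mult_mono e2 sq False) auto
        finally show ?thesis
          using False by (simp add: \<psi>_def \<phi>_def axis_eq_axis inner_axis ennreal_mult'[symmetric] ennreal_leI)
      qed
    qed
    also have "\<dots> = (\<Prod>b\<in>Basis. \<phi> b (v \<bullet> b))"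
      by (simp add: prod_Basis_vec prod_Basis_complex)
    finally have P: "(\<Prod>k\<in>UNIV. ennreal (\<psi> k)) \<le> (\<Prod>b\<in>Basis. \<phi> b (v \<bullet> b))" .
    have "(\<Prod>k\<in>UNIV. ennreal (\<psi> k)) = ennreal (\<Prod>k\<in>UNIV. \<psi> k)"
      by (rule prod_ennreal) (simp add: \<psi>_def)
    also have "(\<Prod>k\<in>UNIV. \<psi> k) = \<psi> ?l * (\<Prod>k\<in>rest. \<psi> k)"
      by (rule prod.remove) auto
    also have "(\<Prod>k\<in>rest. \<psi> k) = (\<Prod>k\<in>(rest :: 'n set). x powr (- 1 - d))"
      by (rule prod.cong) (auto simp: \<psi>_def)
    also have "\<dots> = x powr ((- 1 - d) * (real ?n - 1))"
      using x by (simp add: powr_powr[symmetric] powr_realpow[symmetric] of_nat_diff)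
    also have "\<psi> ?l * x powr ((- 1 - d) * (real ?n - 1)) = Im (v $ ?l) powr \<sigma> * x powr (- \<tau>)"
    proof -
      have "- \<tau> = - (\<sigma> + 1 + d) + ((- 1 - d) + (- 1 - d) * (real ?n - 1))"
        unfolding d_eq by (simp add: algebra_simps)
      then show ?thesis by (simp only: \<psi>_def if_True refl powr_add mult.assoc)
    qed
    also have "Im (v $ ?l) powr \<sigma> * x powr (- \<tau>) = M powr (- \<tau>) * (Im (v $ ?l) powr \<sigma> / A powr \<tau>)"
      unfolding x_def using M A by (simp add: powr_mult powr_minus divide_inverse mult_ac)
    finally have Q: "ennreal (M powr (- \<tau>) * (Im (v $ ?l) powr \<sigma> / A powr \<tau>)) \<le> (\<Prod>b\<in>Basis. \<phi> b (v \<bullet> b))"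
      using P by simp
    have "F (heis z (v' v)) \<le> ennreal (Im (v $ ?l) powr \<sigma> / A powr \<tau>)"
      unfolding F_def rho K_def[symmetric] A_def by (simp add: indicator_def)
    also have "\<dots> = ennreal (M powr \<tau> * (M powr (- \<tau>) * (Im (v $ ?l) powr \<sigma> / A powr \<tau>)))"
      using M by (simp add: powr_minus)
    also have "\<dots> = ennreal (M powr \<tau>) * ennreal (M powr (- \<tau>) * (Im (v $ ?l) powr \<sigma> / A powr \<tau>))"
      by (rule ennreal_mult') simp
    also have "\<dots> \<le> ennreal (M powr \<tau>) * (\<Prod>b\<in>Basis. \<phi> b (v \<bullet> b))"
      by (rule mult_left_mono[OF Q]) simp
    finally show ?thesis .
  qed
  have \<phi>m: "\<phi> b \<in> borel_measurable borel" for b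
    unfolding \<phi>_def[abs_def] by (cases "b = axis ?l \<i>") auto
  have \<phi>f: "(\<integral>\<^sup>+x. \<phi> b x \<partial>lborel) < \<infinity>" for b
    unfolding \<phi>_def using nn_integral_powr_ratio[OF d s] nn_integral_one_plus_abs_powr[OF d]
    by (cases "b = axis ?l \<i>") auto
  have "(\<integral>\<^sup>+v. F (heis z (v' v)) \<partial>lborel) \<le> (\<integral>\<^sup>+v. ennreal (M powr \<tau>) * (\<Prod>b\<in>Basis. \<phi> b (v \<bullet> b)) \<partial>lborel)"
    by (intro nn_integral_mono bound)
  also have "\<dots> = ennreal (M powr \<tau>) * (\<integral>\<^sup>+v. (\<Prod>b\<in>Basis. \<phi> b (v \<bullet> b)) \<partial>lborel)"
    by (rule nn_integral_cmult) (use \<phi>m in measurable)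
  also have "(\<integral>\<^sup>+v. (\<Prod>b\<in>Basis. \<phi> b (v \<bullet> b)) \<partial>lborel) = (\<Prod>b\<in>Basis. \<integral>\<^sup>+x. \<phi> b x \<partial>lborel)"
    by (rule nn_integral_lborel_prod) (use \<phi>m in auto)
  also have "ennreal (M powr \<tau>) * \<dots> < \<infinity>"
  proof -
    have "(\<Prod>b\<in>A. \<integral>\<^sup>+x. \<phi> b x \<partial>lborel) < \<infinity>" for A
      by (induction A rule: infinite_finite_induct) (use \<phi>f in \<open>auto simp: ennreal_mult_less_top\<close>)
    then show ?thesis by (simp add: ennreal_mult_less_top)
  qed
  finally show ?thesis unfolding F_def[symmetric] step1 .
qed

text \<open>For p > 1, Young's inequality separates the Bergman integrand from a pure kernel
  integral with exponents sigma and tau; sigma > -1 is exactly the condition alpha > (l + 1)/p - 1.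
  For p = 1 the weight is at most a multiple of rho^l: the power alpha - l \<ge> 0 of rho(w) is
  absorbed by the kernel, and the kernel power that remains is bounded since rho(z) \<le> 2 |rho(z,
  w)|.\<close>

lemma tube_bergman_finite:
  fixes f :: "(complex, 'n::{finite,linorder}) vec \<Rightarrow> complex"
  assumes p: "1 \<le> p" and l: "l > -1"
    and a1: "1 < p \<Longrightarrow> \<alpha> > (l + 1) / p - 1" and a2: "p = 1 \<Longrightarrow> \<alpha> \<ge> l"
    and f: "f \<in> tube_bergman_space p l"
  shows "tube_finite \<alpha> (real CARD('n) + 1 + \<alpha>) f"
  unfolding tube_finite_def
proof
  let ?T = "tube_domain :: (complex, 'n) vec set"
  fix z assume z: "z \<in> ?T"
  define m where "m = real CARD('n) + 1 + \<alpha>"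
  define B where "B w = indicator ?T w *\<^sub>R (norm (f w) powr p * tube_rho w powr l)" for w
  have intB: "integrable lborel B"
    using f unfolding tube_bergman_space_def B_def[abs_def] set_integrable_def by blast
  have [measurable]: "B \<in> borel_measurable borel" using borel_measurable_integrable[OF intB] by simp
  have B0: "B w \<ge> 0" for w by (simp add: B_def)
  have finB: "(\<integral>\<^sup>+w. ennreal (B w) \<partial>lborel) < \<infinity>"
    using intB B0 by (simp add: integrable_iff_bounded)
  have "\<exists>C D \<sigma> \<tau>. C \<ge> 0 \<and> D \<ge> 0 \<and> \<sigma> > -1 \<and> \<tau> > \<sigma> + real CARD('n) + 1 \<and> (\<forall>w\<in>?T.
     tube_rho w powr \<alpha> / cmod (tube_rho2 z w) powr m * cmod (f w) \<le>
       C * B w + D * (tube_rho w powr \<sigma> / cmod (tube_rho2 z w) powr \<tau>))"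
  proof (cases "p = 1")
    case True
    have al: "\<alpha> \<ge> l" using a2[OF True] .
    define e where "e = real CARD('n) + 1 + l"
    have e: "e > 0" using l by (simp add: e_def)
    define C where "C = 2 powr (\<alpha> - l) * (2 / tube_rho z) powr e"
    have "tube_rho w powr \<alpha> / cmod (tube_rho2 z w) powr m * cmod (f w) \<le> C * B w" if w: "w \<in> ?T" for w
    proof -
      note b = tube_rho2_bounds[OF z w]
      define k where "k = cmod (tube_rho2 z w)"
      have k: "k > 0" using b by (simp add: k_def)
      have "tube_rho w powr (\<alpha> - l) \<le> (2 * k) powr (\<alpha> - l)"
        using b al by (intro powr_mono2) (auto simp: k_def)
      then have 1: "tube_rho w powr (\<alpha> - l) \<le> 2 powr (\<alpha> - l) * k powr (\<alpha> - l)"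
        using k by (simp add: powr_mult)
      have "(1 / k) powr e \<le> (2 / tube_rho z) powr e"
        using b k e by (intro powr_mono2) (auto simp: k_def field_simps)
      then have 2: "k powr (- e) \<le> (2 / tube_rho z) powr e"
        using k by (simp add: powr_divide powr_minus_divide)
      have "tube_rho w powr \<alpha> / k powr m = tube_rho w powr l * (tube_rho w powr (\<alpha> - l) * k powr (- m))"
        using b k by (simp add: powr_diff powr_minus_divide)
      also have "\<dots> \<le> tube_rho w powr l * (2 powr (\<alpha> - l) * k powr (\<alpha> - l) * k powr (- m))"
        by (intro mult_left_mono mult_right_mono 1) auto
      also have "\<dots> = tube_rho w powr l * (2 powr (\<alpha> - l) * k powr (- e))"
        by (simp add: mult.assoc powr_add[symmetric] m_def e_def)
      also have "\<dots> \<le> tube_rho w powr l * (2 powr (\<alpha> - l) * (2 / tube_rho z) powr e)"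
        by (intro mult_left_mono 2) auto
      also have "\<dots> = C * tube_rho w powr l" by (simp add: C_def)
      finally have "tube_rho w powr \<alpha> / k powr m * cmod (f w) \<le> C * tube_rho w powr l * cmod (f w)"
        by (rule mult_right_mono) simp
      then show ?thesis using w True by (simp add: B_def k_def mult_ac)
    qed
    moreover have "C \<ge> 0" by (simp add: C_def)
    ultimately show ?thesis
      by (intro exI[of _ C] exI[of _ 0] exI[of _ "real CARD('n) + 2"]) auto
  next
    case False
    with p have p1: "p > 1" by simp
    define q where "q = p / (p - 1)"
    have q: "q > 1" "1 / p + 1 / q = 1" using p1 by (auto simp: q_def field_simps)
    define \<sigma> where "\<sigma> = (\<alpha> - l / p) * q"
    define \<tau> where "\<tau> = m * q"
    have "(\<alpha> - l / p) > - (1 / q)" 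
    proof -
      have "1 / q = 1 - 1 / p" using q by simp
      then show ?thesis using a1[OF p1] by (simp add: add_divide_distrib)
    qed
    then have "(\<alpha> - l / p) * q > - (1 / q) * q" using q by (intro mult_strict_right_mono) auto
    then have s: "\<sigma> > -1" using q by (simp add: \<sigma>_def)
    have t: "\<tau> > \<sigma> + real CARD('n) + 1"
    proof -
      \<comment> \<open>Here q - 1 and q/p are both equal to 1/(p - 1).\<close>
      have "\<tau> - \<sigma> - (real CARD('n) + 1) = (real CARD('n) + 1 + l) / (p - 1)"
        using p1 by (simp add: \<tau>_def \<sigma>_def m_def q_def divide_simps) (simp add: algebra_simps)
      moreover have "\<dots> > 0" using p1 l by (intro divide_pos_pos) auto
      ultimately show ?thesis by simp
    qed
    have "tube_rho w powr \<alpha> / cmod (tube_rho2 z w) powr m * cmod (f w) \<le>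
       1 / p * B w + 1 / q * (tube_rho w powr \<sigma> / cmod (tube_rho2 z w) powr \<tau>)" if w: "w \<in> ?T" for w
    proof -
      note b = tube_rho2_bounds[OF z w]
      \<comment> \<open>The weight is split so that X^p is the Bergman integrand, which leaves the
        exponent alpha - l/p for the kernel factor Y.\<close>
      define X where "X = cmod (f w) * tube_rho w powr (l / p)"
      define Y where "Y = tube_rho w powr (\<alpha> - l / p) / cmod (tube_rho2 z w) powr m"
      have "X * Y \<le> X powr p / p + Y powr q / q"
        by (rule Youngs_inequality) (use p1 q in \<open>auto simp: X_def Y_def\<close>)
      moreover have "X * Y = tube_rho w powr \<alpha> / cmod (tube_rho2 z w) powr m * cmod (f w)"
        using b by (simp add: X_def Y_def powr_diff)
      moreover have "X powr p = B w"
        using p1 w by (simp add: X_def B_def powr_mult powr_powr)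
      moreover have "Y powr q = tube_rho w powr \<sigma> / cmod (tube_rho2 z w) powr \<tau>"
        by (simp add: Y_def powr_divide powr_powr \<sigma>_def \<tau>_def)
      ultimately show ?thesis by (simp add: mult.commute)
    qed
    then show ?thesis
      using s t p1 q by (intro exI[of _ "1 / p"] exI[of _ "1 / q"] exI[of _ \<sigma>] exI[of _ \<tau>]) auto
  qed
  then obtain C D \<sigma> \<tau> where CD: "C \<ge> 0" "D \<ge> 0" "\<sigma> > -1" "\<tau> > \<sigma> + real CARD('n) + 1"
    and le: "\<And>w. w \<in> ?T \<Longrightarrow> tube_rho w powr \<alpha> / cmod (tube_rho2 z w) powr m * cmod (f w) \<le>
       C * B w + D * (tube_rho w powr \<sigma> / cmod (tube_rho2 z w) powr \<tau>)"
    by blast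
  define R where "R w = indicator ?T w * ennreal (tube_rho w powr \<sigma> / cmod (tube_rho2 z w) powr \<tau>)" for w
  have [measurable]: "R \<in> borel_measurable borel" unfolding R_def[abs_def] by measurable
  have "(\<integral>\<^sup>+w. indicator ?T w * ennreal (tube_rho w powr \<alpha> / cmod (tube_rho2 z w) powr m * cmod (f w)) \<partial>lborel)
     \<le> (\<integral>\<^sup>+w. ennreal C * ennreal (B w) + ennreal D * R w \<partial>lborel)"
  proof (rule nn_integral_mono)
    fix w
    show "indicator ?T w * ennreal (tube_rho w powr \<alpha> / cmod (tube_rho2 z w) powr m * cmod (f w)) \<le> ennreal C * ennreal (B w) + ennreal D * R w"
    proof (cases "w \<in> ?T")
      case True
      define y where "y = tube_rho w powr \<sigma> / cmod (tube_rho2 z w) powr \<tau>"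
      have "y \<ge> 0" by (simp add: y_def)
      moreover have "R w = ennreal y" using True by (simp add: R_def y_def)
      ultimately have "ennreal (C * B w + D * y) = ennreal C * ennreal (B w) + ennreal D * R w"
        using CD B0[of w] by (simp add: ennreal_mult')
      then have "ennreal (C * B w + D * (tube_rho w powr \<sigma> / cmod (tube_rho2 z w) powr \<tau>)) = ennreal C * ennreal (B w) + ennreal D * R w"
        unfolding y_def .
      with ennreal_leI[OF le[OF True]] show ?thesis using True by simp
    qed simp
  qed
  also have "\<dots> = ennreal C * (\<integral>\<^sup>+w. ennreal (B w) \<partial>lborel) + ennreal D * (\<integral>\<^sup>+w. R w \<partial>lborel)"
    by (simp add: nn_integral_add nn_integral_cmult)
  also have "\<dots> < \<infinity>"
    using finB forelli_rudin_finite[OF z CD(3,4)] unfolding R_def by (simp add: ennreal_mult_less_top)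
  finally show "(\<integral>\<^sup>+w. indicator ?T w * ennreal (tube_rho w powr \<alpha> / cmod (tube_rho2 z w) powr (real CARD('n) + 1 + \<alpha>) * cmod (f w)) \<partial>lborel) < \<infinity>"
    unfolding m_def .
qed

theorem theoremD:
  fixes f :: "complex ^ ('n::{finite,linorder}) \<Rightarrow> complex"
    and p l \<alpha> :: real and N :: nat
  assumes "1 \<le> p" and "l > -1"
    and "1 < p \<Longrightarrow> \<alpha> > (l + 1) / p - 1"
    and "p = 1 \<Longrightarrow> \<alpha> \<ge> l"
    and "f \<in> tube_bergman_space p l"
  shows "\<forall>z\<in>tube_domain.
           tube_T_converges \<alpha> (\<lambda>w. of_real (tube_rho w ^ N) * (deriv_last ^^ N) f w) z \<and>
           f z = (- 2 * \<i>) ^ N * of_real (Gamma (1 + \<alpha>) / Gamma (1 + \<alpha> + real N))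
                 * tube_T \<alpha> (\<lambda>w. of_real (tube_rho w ^ N) * (deriv_last ^^ N) f w) z"
proof
  let ?T = "tube_domain :: (complex, 'n) vec set" and ?n = "CARD('n)"
  fix z :: "(complex, 'n) vec" assume z: "z \<in> ?T"
  let ?g = "\<lambda>w. of_real (tube_rho w ^ N) * (deriv_last ^^ N) f w"
  define m where "m = real ?n + 1 + \<alpha>"
  have a: "\<alpha> > -1"
  proof (cases "p = 1")
    case True
    then show ?thesis using assms by simp
  next
    case False
    then have "p > 1" using assms(1) by simp
    then have "(l + 1) / p > 0" using assms(2) by simp
    then show ?thesis using assms(3)[OF \<open>p > 1\<close>] by linarith
  qed
  have f: "holo_tube f"
    using assms(5) by (auto simp: tube_bergman_space_def intro: holo_tubeI)
  have fin: "tube_finite \<alpha> m f"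
    unfolding m_def by (rule tube_bergman_finite[OF assms])
  have finN: "tube_finite (\<alpha> + real N) m ((deriv_last ^^ N) f)"
    by (rule tube_finite_deriv_last_pow[OF f fin]) (use a in \<open>simp add: m_def\<close>)
  have cN: "continuous_on ?T ((deriv_last ^^ N) f)"
    using holo_tube_deriv_last_pow[OF f, of N] by (simp add: holo_tube_def)
  \<comment> \<open>Merging rho^alpha and rho^N into one real power uses rho > 0, so the indicators
    of the domain stay in the equation.\<close>
  have eq: "indicator ?T w *\<^sub>R tube_integrand \<alpha> ?g z w = indicator ?T w *\<^sub>R tube_kernel (\<alpha> + real N) m ((deriv_last ^^ N) f) z w" for w
  proof (cases "w \<in> ?T")
    case True
    then have "tube_rho w powr (\<alpha> + real N) = tube_rho w powr \<alpha> * tube_rho w ^ N"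
      by (simp add: tube_domain_iff powr_add powr_realpow)
    then show ?thesis
      by (simp add: tube_integrand_def tube_kernel_def m_def)
  qed simp
  have conv: "tube_T_converges \<alpha> ?g z"
    using tube_kernel_integrable[OF cN finN z] unfolding tube_T_converges_def set_integrable_def eq .
  have "(LINT w:?T|lborel. tube_integrand \<alpha> ?g z w) = tube_int (\<alpha> + real N) m ((deriv_last ^^ N) f) z"
    unfolding tube_int_def set_lebesgue_integral_def eq ..
  also have "\<dots> = of_real (2 ^ (?n + 1) * pi ^ ?n * Gamma (1 + \<alpha> + real N) / Gamma m) * (\<i> / 2) ^ N * f z"
    unfolding m_def by (rule tube_int_deriv_formula[OF f fin[unfolded m_def] a z])
  finally have I: "(LINT w:?T|lborel. tube_integrand \<alpha> ?g z w) = \<dots>" .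
  have G: "Gamma (1 + \<alpha>) \<noteq> 0" "Gamma (1 + \<alpha> + real N) \<noteq> 0" "Gamma m \<noteq> 0"
    using a by (auto simp: m_def intro!: less_imp_neq[symmetric] Gamma_real_pos)
  have "Gamma (1 + \<alpha>) / Gamma (1 + \<alpha> + real N) * (Gamma m / (2 ^ (?n + 1) * pi ^ ?n * Gamma (1 + \<alpha>)))
     * (2 ^ (?n + 1) * pi ^ ?n * Gamma (1 + \<alpha> + real N) / Gamma m) = 1"
    using G by (simp add: field_simps)
  then have 1: "complex_of_real (Gamma (1 + \<alpha>) / Gamma (1 + \<alpha> + real N)) * of_real (Gamma m / (2 ^ (?n + 1) * pi ^ ?n * Gamma (1 + \<alpha>)))
     * of_real (2 ^ (?n + 1) * pi ^ ?n * Gamma (1 + \<alpha> + real N) / Gamma m) = 1"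
    by (metis of_real_1 of_real_mult)
  \<comment> \<open>The N ray integrations produced (i/2)^N, and inverting this determines the sign
    of the factor in the theorem.\<close>
  have 2: "(- 2 * \<i>) ^ N * (\<i> / 2) ^ N = 1"
    by (simp add: power_mult_distrib[symmetric])
  have "(- 2 * \<i>) ^ N * of_real (Gamma (1 + \<alpha>) / Gamma (1 + \<alpha> + real N)) * tube_T \<alpha> ?g z
    = ((- 2 * \<i>) ^ N * (\<i> / 2) ^ N) * (of_real (Gamma (1 + \<alpha>) / Gamma (1 + \<alpha> + real N)) * of_real (Gamma m / (2 ^ (?n + 1) * pi ^ ?n * Gamma (1 + \<alpha>)))
     * of_real (2 ^ (?n + 1) * pi ^ ?n * Gamma (1 + \<alpha> + real N) / Gamma m)) * f z"
    unfolding tube_T_def I m_def[symmetric] add.commute[of \<alpha> 1] by (simp only: mult_ac)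
  also have "\<dots> = f z" unfolding 1 2 by simp
  finally show "tube_T_converges \<alpha> ?g z \<and> f z = (- 2 * \<i>) ^ N * of_real (Gamma (1 + \<alpha>) / Gamma (1 + \<alpha> + real N)) * tube_T \<alpha> ?g z"
    using conv by simp
qed

end
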